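(* Assume that the system $dx_t=P(x_t)\,dt+\sigma\,dB_t$, $x_0=0$, is noise propagating. Let $\mathscr O\subset\mathbf R^n$ be a non-empty open set with continuous boundary $\partial\mathscr O$ containing $0$, and suppose there exist $j\in\{1,\dots,n\}$, $\delta>0$ and a continuous function $b:\mathbf R^{n-1}\to\mathbf R$ such that $$\partial\mathscr O\cap B_\delta(0)=\{x\in B_\delta(0):x^j=b(x^1,\dots,x^{j-1},x^{j+1},\dots,x^n)\},$$ $$\mathscr O\cap B_\delta(0)=\{x\in B_\delta(0):x^j>b(x^1,\dots,x^{j-1},x^{j+1},\dots,x^n)\}.$$ For $\epsilon>0$ let $r_\epsilon=\prod_{i=1}^n(-\epsilon^{\mathfrak b_i},\epsilon^{\mathfrak b_i})$, $\mathscr O_\epsilon=\{x\in r_\epsilon:x^j>b(x^1,\dots,x^{j-1},x^{j+1},\dots,x^n)\}$, $\Gamma_\epsilon=\{x\in r_\epsilon:x^j=b(x^1,\dots,x^{j-1},x^{j+1},\dots,x^n)\}$, and let $\epsilon_*>0$ be such that $\Gamma_\epsilon=r_\epsilon\cap\partial\mathscr O$ and $\mathscr O_\epsilon=r_\epsilon\cap\mathscr O$ for every $\epsilon\in(0,\epsilon_* )$. If there exists a non-empty open set $\mathscr O_*$ for which $$\mathscr O_*\subset S_{\epsilon,\mathrm D}(\mathscr O_\epsilon)\ \text{ for all }\epsilon\in(0,\epsilon_* )\qquad\text{and}\qquad\bigcup_{t\in(0,1]}\mathrm{cl}(A_{\mathrm D,t}(0))\cap\mathscr O_*\neq\emptyset,$$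 then $0\in\mathbf R^n$ is regular for $(x_t,\mathscr O)$.
   Context: Setting. $I=\{1,\dots,n\}$, $P=(P^1,\dots,P^n):\mathbf R^n\to\mathbf R^n$ is a polynomial vector field, $\sigma=\mathrm{diag}(\sigma^1,\dots,\sigma^n)$ with constants $\sigma^i\ge0$ (some may vanish), $B_t$ is a standard $n$-dimensional Brownian motion on a filtered probability space with probability $\mathbf P$, and $x_t$ is the pathwise solution of $dx_t=P(x_t)dt+\sigma dB_t$, $x_0=0$, up to its explosion time, after which $x_t=\Delta$ for a death state $\Delta\notin\mathbf R^n$. $B_\delta(0)$ is the open ball of radius $\delta$ about $0$, and $\mathrm{cl}$ is closure in $\mathbf R^n$. Regularity. With $\xi=\inf\{t>0:x_t\in\mathscr O\}$, the point $0$ is regular for $(x_t,\mathscr O)$ if $\mathbf P\{\xi=0\}=1$. Power scalings (the second coordinates of the paper's pair scalings are all zero here and are omitted). Work in $\tfrac12\mathbf Z_{\ge0}\cup\{\infty\}$ with the usual order, $c+\infty=\infty$, $\ell\cdot\infty=\infty$ for $\ell\ge1$, $0\cdot\infty=0$. For a monomial $m(x)=\alpha(x^1)^{n_1}\cdots(x^n)^{n_n}$, $\alpha\ne0$, put $m(c_1,\dots,c_n)=n_1c_1+\cdots+n_nc_n$; the zero polynomial has value $\infty$; a nonzero polynomial, written as a sum of a minimal number of monomials (standard form), has value the minimum of the values of its monomials. Inductive procedure. $I_0=\{j\in I:\sigma^j>0\}$; $b_{0,j}=1/2$ and $P^j_{\mathrm D}\equiv0$ for $j\in I_0$; $b_{0,j}=\infty$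 for $j\notin I_0$. For $\ell\ge0$: if $I\setminus\bigcup_{k=0}^\ell I_k=\emptyset$ or $P^j(b_{\ell,1},\dots,b_{\ell,n})=\infty$ for all $j\in I\setminus\bigcup_{k=0}^\ell I_k$, stop and set $I_i=\emptyset$ for $i\ge\ell+1$. Otherwise let $m_{\ell+1}=\min\{P^j(b_{\ell,1},\dots,b_{\ell,n}):j\in I\setminus\bigcup_{k=0}^\ell I_k\}$, $I_{\ell+1}=\{j\in I\setminus\bigcup_{k=0}^\ell I_k:P^j(b_{\ell,1},\dots,b_{\ell,n})=m_{\ell+1}\}$; $b_{\ell+1,j}=m_{\ell+1}+1$ for $j\in I_{\ell+1}$ and $b_{\ell+1,j}=b_{\ell,j}$ otherwise; for $j\in I_{\ell+1}$ let $P^j_{\mathrm D}$ be the sum of those monomials in the standard form of $P^j$ whose value at $(b_{\ell,1},\dots,b_{\ell,n})$ equals $m_{\ell+1}$. The system is noise propagating if $\bigcup_{k=0}^\ell I_k=I$ for some $\ell\ge0$; with $\dim$ the smallest such $\ell$, $\mathfrak b_j:=b_{\dim,j}$. $P_{\mathrm D}=(P^1_{\mathrm D},\dots,P^n_{\mathrm D})$, and $$S_{\epsilon,\mathrm D}(x)=\Big(\frac{x^1}{\epsilon^{\mathfrak b_1}},\dots,\frac{x^n}{\epsilon^{\mathfrak b_n}}\Big),\qquad \epsilon>0.$$ Control problem. $\mathcal H$ is the set of absolutely continuous $h:[0,1]\to\mathbf R^n$ with $h_0=0$, $\dot h\in L^2([0,1];\mathbf R^n)$. For $f\in\mathcal H$,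 $\varphi_t(P_{\mathrm D},f)x$ is the solution on $[0,1]$ (which always exists) of $\dot x=P_{\mathrm D}(x)+\sigma\dot f$, $x_0=x$. For $t\in(0,1]$, $A_{\mathrm D,t}(x)=\{y\in\mathbf R^n:\varphi_t(P_{\mathrm D},f)x=y\text{ for some }f\in\mathcal H\}$. *)

theory Defs
  imports "HOL-Probability.Probability" "HOL-Library.Poly_Mapping"
begin

section \<open>Polynomials in the coordinates of \<open>real ^ 'n\<close>\<close>

text \<open>
  A real polynomial is the finitely supported map from exponents to coefficients; its keys are
  exactly the exponents of the monomials in its standard form.
\<close>

type_synonym 'n rpoly = "('n \<Rightarrow>\<^sub>0 nat) \<Rightarrow>\<^sub>0 real"

definition poly_fun :: "'n::finite rpoly \<Rightarrow> real ^ 'n \<Rightarrow> real" where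
  "poly_fun p x =
    (\<Sum>m\<in>Poly_Mapping.keys p. Poly_Mapping.lookup p m * (\<Prod>i\<in>UNIV. (x $ i) ^ Poly_Mapping.lookup m i))"

definition vector_field :: "'n::finite rpoly ^ 'n \<Rightarrow> real ^ 'n \<Rightarrow> real ^ 'n" where
  "vector_field P x = (\<chi> i. poly_fun (P $ i) x)"

section \<open>Power scalings and the inductive procedure\<close>

text \<open>
  Weights live in \<^typ>\<open>ennreal\<close>, where \<open>0 * \<infinity> = 0\<close>; only values in
  \<open>{0, 1/2, 1, 3/2, \<dots>, \<infinity>}\<close> occur. The zero polynomial has value \<open>Inf {} = \<infinity>\<close>.
\<close>

definition monomial_value :: "('n::finite \<Rightarrow>\<^sub>0 nat) \<Rightarrow> ('n \<Rightarrow> ennreal) \<Rightarrow> ennreal" where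
  "monomial_value m c = (\<Sum>i\<in>UNIV. of_nat (Poly_Mapping.lookup m i) * c i)"

definition poly_value :: "'n::finite rpoly \<Rightarrow> ('n \<Rightarrow> ennreal) \<Rightarrow> ennreal" where
  "poly_value p c = (INF m\<in>Poly_Mapping.keys p. monomial_value m c)"

text \<open>
  \<open>layer P \<sigma> l\<close> is \<open>I\<^sub>l\<close>, \<open>weight P \<sigma> l j\<close> is \<open>b\<^sub>l\<^sub>,\<^sub>j\<close>, and \<open>next_value P \<sigma> l\<close> is \<open>m\<^sub>l\<^sub>+\<^sub>1\<close>
  (meaningful only if the procedure does not stop at \<open>l\<close>). Once the procedure stops, all later layers
  are empty and the weights no longer change, so that the stopping condition persists.
\<close>

context
  notes image_cong [fundef_cong]
begin

function (sequential)
  layer :: "'n::finite rpoly ^ 'n \<Rightarrow> real ^ 'n \<Rightarrow> nat \<Rightarrow> 'n set"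
  and weight :: "'n rpoly ^ 'n \<Rightarrow> real ^ 'n \<Rightarrow> nat \<Rightarrow> 'n \<Rightarrow> ennreal"
  and next_value :: "'n rpoly ^ 'n \<Rightarrow> real ^ 'n \<Rightarrow> nat \<Rightarrow> ennreal"
where
  "layer P \<sigma> 0 = {j. \<sigma> $ j > 0}"
| "layer P \<sigma> (Suc l) =
    (let R = UNIV - (\<Union>k\<in>{..l}. layer P \<sigma> k) in
     if R = {} \<or> (\<forall>j\<in>R. poly_value (P $ j) (weight P \<sigma> l) = \<infinity>) then {}
     else {j\<in>R. poly_value (P $ j) (weight P \<sigma> l) = next_value P \<sigma> l})"
| "weight P \<sigma> 0 = (\<lambda>j. if \<sigma> $ j > 0 then 1 / 2 else \<infinity>)"
| "weight P \<sigma> (Suc l) =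
    (\<lambda>j. if j \<in> layer P \<sigma> (Suc l) then next_value P \<sigma> l + 1 else weight P \<sigma> l j)"
| "next_value P \<sigma> l =
    Min ((\<lambda>j. poly_value (P $ j) (weight P \<sigma> l)) ` (UNIV - (\<Union>k\<in>{..l}. layer P \<sigma> k)))"
  by pat_completeness auto

termination
  by (relation "Wellfounded.measure (\<lambda>a. case a of
      Inl (_, _, l) \<Rightarrow> 3 * l
    | Inr (Inl (_, _, l)) \<Rightarrow> 3 * l + 1
    | Inr (Inr (_, _, l)) \<Rightarrow> 3 * l + 2)") auto

end

definition noise_propagating :: "'n::finite rpoly ^ 'n \<Rightarrow> real ^ 'n \<Rightarrow> bool" where
  "noise_propagating P \<sigma> \<longleftrightarrow> (\<exists>l. (\<Union>k\<in>{..l}. layer P \<sigma> k) = UNIV)"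

definition noise_dim :: "'n::finite rpoly ^ 'n \<Rightarrow> real ^ 'n \<Rightarrow> nat" where
  "noise_dim P \<sigma> = (LEAST l. (\<Union>k\<in>{..l}. layer P \<sigma> k) = UNIV)"

definition final_weight :: "'n::finite rpoly ^ 'n \<Rightarrow> real ^ 'n \<Rightarrow> 'n \<Rightarrow> real" where
  "final_weight P \<sigma> j = enn2real (weight P \<sigma> (noise_dim P \<sigma>) j)"

text \<open>
  The layers are disjoint, so \<open>l\<close> is unique below. The value at a \<open>j\<close> in no layer is arbitrary;
  there is none for a noise propagating system.
\<close>

definition dominant_part :: "'n::finite rpoly ^ 'n \<Rightarrow> real ^ 'n \<Rightarrow> 'n rpoly ^ 'n" where
  "dominant_part P \<sigma> = (\<chi> j.
    if j \<in> layer P \<sigma> 0 then 0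
    else let l = (THE l. j \<in> layer P \<sigma> (Suc l)) in
      (\<Sum>m | m \<in> Poly_Mapping.keys (P $ j) \<and> monomial_value m (weight P \<sigma> l) = next_value P \<sigma> l.
        Poly_Mapping.single m (Poly_Mapping.lookup (P $ j) m)))"

definition dominant_scaling ::
  "'n::finite rpoly ^ 'n \<Rightarrow> real ^ 'n \<Rightarrow> real \<Rightarrow> real ^ 'n \<Rightarrow> real ^ 'n" where
  "dominant_scaling P \<sigma> \<epsilon> x = (\<chi> i. x $ i / \<epsilon> powr final_weight P \<sigma> i)"

definition scaled_box :: "'n::finite rpoly ^ 'n \<Rightarrow> real ^ 'n \<Rightarrow> real \<Rightarrow> (real ^ 'n) set" where
  "scaled_box P \<sigma> \<epsilon> =
    {x. \<forall>i. x $ i \<in> {- (\<epsilon> powr final_weight P \<sigma> i) <..< \<epsilon> powr final_weight P \<sigma> i}}"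

section \<open>The control problem\<close>

definition absolutely_continuous_on :: "real set \<Rightarrow> (real \<Rightarrow> 'a::real_normed_vector) \<Rightarrow> bool" where
  "absolutely_continuous_on S h \<longleftrightarrow>
    (\<forall>\<epsilon>>0. \<exists>\<delta>>0. \<forall>d T. d division_of T \<and> T \<subseteq> S \<and> (\<Sum>K\<in>d. Sup K - Inf K) < \<delta> \<longrightarrow>
      (\<Sum>K\<in>d. norm (h (Sup K) - h (Inf K))) < \<epsilon>)"

definition cameron_martin :: "(real \<Rightarrow> real ^ 'n::finite) set" where
  "cameron_martin = {h. absolutely_continuous_on {0..1} h \<and> h 0 = 0 \<and>
    (\<exists>g. (AE t in lebesgue_on {0..1}. (h has_vector_derivative g t) (at t within {0..1})) \<and>
      g \<in> borel_measurable (lebesgue_on {0..1}) \<and>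
      integrable (lebesgue_on {0..1}) (\<lambda>t. (norm (g t))\<^sup>2))}"

text \<open>
  \<open>\<phi>\<close> is a solution on \<open>[0,1]\<close>, in the sense of Caratheodory, of
  \<open>\<phi>' = Q(\<phi>) + \<sigma> f'\<close>, \<open>\<phi>(0) = x\<close>, where \<open>\<sigma>\<close> acts as a diagonal matrix.
\<close>

definition controlled_solution ::
  "'n::finite rpoly ^ 'n \<Rightarrow> real ^ 'n \<Rightarrow> (real \<Rightarrow> real ^ 'n) \<Rightarrow> real ^ 'n \<Rightarrow> (real \<Rightarrow> real ^ 'n) \<Rightarrow> bool"
where
  "controlled_solution Q \<sigma> f x \<phi> \<longleftrightarrow>
    absolutely_continuous_on {0..1} \<phi> \<and> \<phi> 0 = x \<and>
    (AE t in lebesgue_on {0..1}. \<exists>v. (f has_vector_derivative v) (at t within {0..1}) \<and>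
      (\<phi> has_vector_derivative (vector_field Q (\<phi> t) + (\<chi> i. \<sigma> $ i * v $ i))) (at t within {0..1}))"

definition accessible_set ::
  "'n::finite rpoly ^ 'n \<Rightarrow> real ^ 'n \<Rightarrow> real \<Rightarrow> real ^ 'n \<Rightarrow> (real ^ 'n) set" where
  "accessible_set P \<sigma> t x =
    {y. \<exists>f\<in>cameron_martin. \<exists>\<phi>. controlled_solution (dominant_part P \<sigma>) \<sigma> f x \<phi> \<and> \<phi> t = y}"

section \<open>Brownian motion, pathwise solutions and regular points\<close>

text \<open>Only the values of \<open>F\<close> and \<open>B\<close> at times \<open>t \<ge> 0\<close> are relevant.\<close>

definition filtered_prob_space :: "'a measure \<Rightarrow> (real \<Rightarrow> 'a measure) \<Rightarrow> bool" where
  "filtered_prob_space M F \<longleftrightarrow>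
    prob_space M \<and> (\<forall>t\<ge>0. subalgebra M (F t)) \<and>
    (\<forall>s t. 0 \<le> s \<and> s \<le> t \<longrightarrow> sets (F s) \<subseteq> sets (F t))"

definition standard_brownian_motion ::
  "'a measure \<Rightarrow> (real \<Rightarrow> 'a measure) \<Rightarrow> (real \<Rightarrow> 'a \<Rightarrow> real ^ 'n::finite) \<Rightarrow> bool" where
  "standard_brownian_motion M F B \<longleftrightarrow>
    (\<forall>t\<ge>0. B t \<in> borel_measurable (F t)) \<and>
    (AE \<omega> in M. B 0 \<omega> = 0) \<and>
    (AE \<omega> in M. continuous_on {0..} (\<lambda>t. B t \<omega>)) \<and>
    (\<forall>s t. 0 \<le> s \<and> s < t \<longrightarrow>
      prob_space.indep_set M (sets (F s))
        {(\<lambda>\<omega>. B t \<omega> - B s \<omega>) -` A \<inter> space M | A. A \<in> sets borel} \<and>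
      distributed M lborel (\<lambda>\<omega>. B t \<omega> - B s \<omega>)
        (\<lambda>y. ennreal (\<Prod>i\<in>UNIV. normal_density 0 (sqrt (t - s)) (y $ i))))"

text \<open>
  The death state is \<open>None\<close>. The noise is additive, so \<open>dx = P(x) dt + \<sigma> dB\<close> is read path by path
  as an integral equation for a continuous path on the maximal interval \<open>[0, \<tau>)\<close>, with \<open>\<tau>\<close> the
  explosion time.
\<close>

definition pathwise_solution ::
  "'a measure \<Rightarrow> 'n::finite rpoly ^ 'n \<Rightarrow> real ^ 'n \<Rightarrow> (real \<Rightarrow> 'a \<Rightarrow> real ^ 'n) \<Rightarrow> real ^ 'n
    \<Rightarrow> (real \<Rightarrow> 'a \<Rightarrow> (real ^ 'n) option) \<Rightarrow> bool" where
  "pathwise_solution M P \<sigma> B x0 x \<longleftrightarrow>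
    (AE \<omega> in M. \<exists>(\<tau>::ereal) y. \<tau> > 0 \<and>
      continuous_on {t. 0 \<le> t \<and> ereal t < \<tau>} y \<and>
      (\<forall>t\<ge>0. ereal t < \<tau> \<longrightarrow> x t \<omega> = Some (y t) \<and>
        y t = x0 + integral {0..t} (\<lambda>s. vector_field P (y s)) + (\<chi> i. \<sigma> $ i * B t \<omega> $ i)) \<and>
      (\<forall>t\<ge>0. \<tau> \<le> ereal t \<longrightarrow> x t \<omega> = None) \<and>
      (\<tau> < \<infinity> \<longrightarrow> filterlim (\<lambda>t. norm (y t)) at_top (at_left (real_of_ereal \<tau>))))"

definition entrance_time ::
  "(real \<Rightarrow> 'a \<Rightarrow> (real ^ 'n) option) \<Rightarrow> (real ^ 'n) set \<Rightarrow> 'a \<Rightarrow> ereal" where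
  "entrance_time x U \<omega> = Inf {ereal t | t. t > 0 \<and> x t \<omega> \<in> Some ` U}"

text \<open>
  Regularity of the starting point of \<open>x\<close> for \<open>(x, U)\<close>. As \<open>M\<close> need not be complete and \<open>x\<close> is
  determined only up to null sets, "the entrance time is \<open>0\<close> with probability one" is stated by \<open>AE\<close>.
\<close>

definition regular_start ::
  "'a measure \<Rightarrow> (real \<Rightarrow> 'a \<Rightarrow> (real ^ 'n) option) \<Rightarrow> (real ^ 'n) set \<Rightarrow> bool" where
  "regular_start M x U \<longleftrightarrow> (AE \<omega> in M. entrance_time x U \<omega> = 0)"

section \<open>Continuous boundaries\<close>

text \<open>
  A continuous function of the \<open>n - 1\<close> coordinates other than \<open>j\<close> is an element of
  \<open>continuous_graph_map j\<close>, evaluated at \<open>drop_coord j x\<close>. The product topology on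
  \<open>UNIV - {j} \<rightarrow>\<^sub>E \<real>\<close> is that of \<open>\<real>\<close> to the power \<open>n - 1\<close>, including \<open>n = 1\<close>.
\<close>

definition drop_coord :: "'n::finite \<Rightarrow> real ^ 'n \<Rightarrow> ('n \<Rightarrow> real)" where
  "drop_coord j x = restrict (\<lambda>i. x $ i) (UNIV - {j})"

definition continuous_graph_map :: "'n::finite \<Rightarrow> (('n \<Rightarrow> real) \<Rightarrow> real) set" where
  "continuous_graph_map j = {b. continuous_map (powertop_real (UNIV - {j})) euclideanreal b}"

text \<open>
  Near each boundary point, in suitable orthonormal coordinates, the boundary is the graph of a
  continuous function and the set lies above it. Reflections are allowed, so "above" is no restriction.
\<close>

definition has_continuous_boundary :: "(real ^ 'n::finite) set \<Rightarrow> bool" where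
  "has_continuous_boundary U \<longleftrightarrow>
    (\<forall>p\<in>frontier U. \<exists>(T :: real ^ 'n \<Rightarrow> real ^ 'n) j r. \<exists>b\<in>continuous_graph_map j.
      orthogonal_transformation T \<and> r > 0 \<and>
      frontier U \<inter> ball p r = {x\<in>ball p r. T x $ j = b (drop_coord j (T x))} \<and>
      U \<inter> ball p r = {x\<in>ball p r. T x $ j > b (drop_coord j (T x))})"

end

theory Submission
  imports Defs
begin

text \<open>The idea is to look at the process through the scaling \<open>S\<^sub>\<epsilon>\<close> on the time scale \<open>\<epsilon>\<close>. If \<open>y\<close> solves the
equation with noise \<open>B\<close>, then \<open>X\<^sub>s = S\<^sub>\<epsilon> (y\<^bsub>\<epsilon>s\<^esub>)\<close> solves an equation of the same form on \<open>[0,1]\<close> whose noise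
is the rescaled Brownian motion \<open>B\<^bsub>\<epsilon>s\<^esub> / sqrt \<epsilon>\<close> and in whose drift a monomial of \<open>P\<^sup>j\<close> carries a power
\<open>\<epsilon>\<close> to the \<open>excess\<close> of that monomial (\<open>dominant_scaling_solution\<close>). The weights are chosen exactly so
that no excess is negative and that the monomials of excess zero are those of \<open>P\<^sub>D\<close>
(\<open>excess_nonneg\<close>, \<open>poly_fun_dominant_part\<close>). Hence the rescaled drift tends to \<open>P\<^sub>D\<close> uniformly on bounded
sets, and \<open>X\<close> is a perturbation of the control system: by Gronwall's argument it stays close to a
controlled path \<open>\<phi>\<close> with control \<open>f\<close> as soon as \<open>\<epsilon>\<close> is small and the rescaled Brownian path is uniformly
close to \<open>f\<close> (\<open>perturbed_solution_close\<close>).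

An open set that meets the closure of an accessible set meets the accessible set itself, so some such
\<open>\<phi>\<close> has \<open>\<phi> t \<in> W\<close>. If \<open>X\<close> is close to \<open>\<phi>\<close>, then \<open>X\<^sub>t \<in> W \<subseteq> S\<^sub>\<epsilon> (V \<epsilon>)\<close>, that is, \<open>y\<close> is in \<open>U\<close> at time \<open>\<epsilon>t\<close>.
Regularity therefore reduces to a property of Brownian motion alone
(\<open>rescaled_paths_recurrent\<close>): for each continuous \<open>f\<close> with \<open>f 0 = 0\<close>, the rescaled path is almost surely
uniformly close to \<open>f\<close> for arbitrarily small \<open>\<epsilon>\<close>.

This recurrence holds because, on every time interval and conditionally on the past, the Brownian
increment follows a prescribed Lipschitz path within a given tolerance with positive probability. If the
Lipschitz constant and the tolerance are measured relative to the Brownian scale of the interval, the lower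
bound for this probability does not depend on the interval (\<open>tracking\<close>). Along scales that decrease fast,
the intervals \<open>[\<epsilon>\<^sub>k\<^sub>+\<^sub>1, \<epsilon>\<^sub>k]\<close> give infinitely many attempts, each successful with at least this
probability whatever happened before, so almost surely infinitely many succeed. What happens before time
\<open>\<epsilon>\<^sub>k\<^sub>+\<^sub>1\<close> is negligible at scale \<open>\<epsilon>\<^sub>k\<close> by the Borel-Cantelli lemma.\<close>

section \<open>Absolutely continuous paths\<close>

lemma absolutely_continuous_onD:
  assumes "absolutely_continuous_on S h" "e > 0"
  obtains d where "d > 0" "\<And>D T. D division_of T \<Longrightarrow> T \<subseteq> S \<Longrightarrow> (\<Sum>K\<in>D. Sup K - Inf K) < d \<Longrightarrow>
      (\<Sum>K\<in>D. norm (h (Sup K) - h (Inf K))) < e"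
  using assms unfolding absolutely_continuous_on_def by metis

lemma absolutely_continuous_on_subset:
  assumes "absolutely_continuous_on S h" "T \<subseteq> S"
  shows "absolutely_continuous_on T h"
  using assms unfolding absolutely_continuous_on_def by (meson subset_trans)

lemma absolutely_continuous_on_add:
  assumes "absolutely_continuous_on S f" "absolutely_continuous_on S g"
  shows "absolutely_continuous_on S (\<lambda>t. f t + g t)"
  unfolding absolutely_continuous_on_def
proof (intro allI impI)
  fix e :: real assume "e > 0"
  then have e2: "e / 2 > 0" by simp
  obtain d1 where d1: "d1 > 0" "\<And>D T. D division_of T \<Longrightarrow> T \<subseteq> S \<Longrightarrow> (\<Sum>K\<in>D. Sup K - Inf K) < d1 \<Longrightarrow>
      (\<Sum>K\<in>D. norm (f (Sup K) - f (Inf K))) < e / 2"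
    using absolutely_continuous_onD[OF assms(1) e2] by metis
  obtain d2 where d2: "d2 > 0" "\<And>D T. D division_of T \<Longrightarrow> T \<subseteq> S \<Longrightarrow> (\<Sum>K\<in>D. Sup K - Inf K) < d2 \<Longrightarrow>
      (\<Sum>K\<in>D. norm (g (Sup K) - g (Inf K))) < e / 2"
    using absolutely_continuous_onD[OF assms(2) e2] by metis
  show "\<exists>\<delta>>0. \<forall>D T. D division_of T \<and> T \<subseteq> S \<and> (\<Sum>K\<in>D. Sup K - Inf K) < \<delta> \<longrightarrow>
      (\<Sum>K\<in>D. norm (f (Sup K) + g (Sup K) - (f (Inf K) + g (Inf K)))) < e"
  proof (intro exI[of _ "min d1 d2"] conjI allI impI)
    fix D T assume a: "D division_of T \<and> T \<subseteq> S \<and> (\<Sum>K\<in>D. Sup K - Inf K) < min d1 d2"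
    have "(\<Sum>K\<in>D. norm (f (Sup K) + g (Sup K) - (f (Inf K) + g (Inf K))))
      \<le> (\<Sum>K\<in>D. norm (f (Sup K) - f (Inf K)) + norm (g (Sup K) - g (Inf K)))"
      by (intro sum_mono) (metis add_diff_add norm_triangle_ineq)
    also have "\<dots> < e"
      using d1(2)[of D T] d2(2)[of D T] a by (simp add: sum.distrib)
    finally show "(\<Sum>K\<in>D. norm (f (Sup K) + g (Sup K) - (f (Inf K) + g (Inf K)))) < e" .
  qed (use d1 d2 in auto)
qed

lemma lipschitz_on_imp_absolutely_continuous_on:
  assumes "L-lipschitz_on {a..b::real} f"
  shows "absolutely_continuous_on {a..b} f"
  unfolding absolutely_continuous_on_def
proof (intro allI impI)
  fix e :: real assume e: "e > 0"
  have L: "L \<ge> 0" using assms by (rule lipschitz_on_nonneg)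
  show "\<exists>\<delta>>0. \<forall>D T. D division_of T \<and> T \<subseteq> {a..b} \<and> (\<Sum>K\<in>D. Sup K - Inf K) < \<delta> \<longrightarrow>
      (\<Sum>K\<in>D. norm (f (Sup K) - f (Inf K))) < e"
  proof (intro exI[of _ "e / (L + 1)"] conjI allI impI)
    fix D T assume a: "D division_of T \<and> T \<subseteq> {a..b} \<and> (\<Sum>K\<in>D. Sup K - Inf K) < e / (L + 1)"
    have "(\<Sum>K\<in>D. norm (f (Sup K) - f (Inf K))) \<le> (\<Sum>K\<in>D. L * (Sup K - Inf K))"
    proof (rule sum_mono)
      fix K assume K: "K \<in> D"
      then obtain u v where uv: "K = {u..v}" "K \<subseteq> T" "K \<noteq> {}"
        using a division_ofD(2,3,4)[of D T K] by (metis interval_cbox)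
      then have "u \<le> v" "{u..v} \<subseteq> {a..b}" using a by (auto simp del: atLeastatMost_subset_iff)
      moreover from this have "u \<in> {a..b}" "v \<in> {a..b}" by auto
      ultimately show "norm (f (Sup K) - f (Inf K)) \<le> L * (Sup K - Inf K)"
        using lipschitz_onD[OF assms, of v u] uv(1) by (auto simp: dist_norm)
    qed
    also have "\<dots> = L * (\<Sum>K\<in>D. Sup K - Inf K)" by (simp add: sum_distrib_left)
    also have "\<dots> \<le> L * (e / (L + 1))" using a L by (intro mult_left_mono) auto
    also have "\<dots> < e" using L e by (simp add: field_simps)
    finally show "(\<Sum>K\<in>D. norm (f (Sup K) - f (Inf K))) < e" .
  qed (use L e in auto)
qed

lemma lipschitz_on_compose_absolutely_continuous_on:
  assumes "L-lipschitz_on UNIV g" "absolutely_continuous_on S f"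
  shows "absolutely_continuous_on S (\<lambda>t. g (f t))"
  unfolding absolutely_continuous_on_def
proof (intro allI impI)
  fix e :: real assume e: "e > 0"
  have L: "L \<ge> 0" using assms(1) by (rule lipschitz_on_nonneg)
  then have "e / (L + 1) > 0" using e by simp
  then obtain d where d: "d > 0" "\<And>D T. D division_of T \<Longrightarrow> T \<subseteq> S \<Longrightarrow> (\<Sum>K\<in>D. Sup K - Inf K) < d \<Longrightarrow>
      (\<Sum>K\<in>D. norm (f (Sup K) - f (Inf K))) < e / (L + 1)"
    using absolutely_continuous_onD[OF assms(2)] by metis
  show "\<exists>\<delta>>0. \<forall>D T. D division_of T \<and> T \<subseteq> S \<and> (\<Sum>K\<in>D. Sup K - Inf K) < \<delta> \<longrightarrow>
      (\<Sum>K\<in>D. norm (g (f (Sup K)) - g (f (Inf K)))) < e"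
  proof (intro exI[of _ d] conjI allI impI)
    fix D T assume a: "D division_of T \<and> T \<subseteq> S \<and> (\<Sum>K\<in>D. Sup K - Inf K) < d"
    have "(\<Sum>K\<in>D. norm (g (f (Sup K)) - g (f (Inf K)))) \<le> (\<Sum>K\<in>D. L * norm (f (Sup K) - f (Inf K)))"
      using lipschitz_onD[OF assms(1)] by (intro sum_mono) (auto simp: dist_norm)
    also have "\<dots> = L * (\<Sum>K\<in>D. norm (f (Sup K) - f (Inf K)))" by (simp add: sum_distrib_left)
    also have "\<dots> \<le> L * (e / (L + 1))" using d(2)[of D T] a L by (intro mult_left_mono) auto
    also have "\<dots> < e" using L e by (simp add: field_simps)
    finally show "(\<Sum>K\<in>D. norm (g (f (Sup K)) - g (f (Inf K)))) < e" .
  qed (use d in auto)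
qed

lemma bounded_vector_derivative_imp_lipschitz_on:
  fixes p :: "real \<Rightarrow> 'b::real_normed_vector"
  assumes der: "\<And>t. t \<in> {a..b} \<Longrightarrow> (p has_vector_derivative p' t) (at t within {a..b})"
    and C: "\<And>t. t \<in> {a..b} \<Longrightarrow> norm (p' t) \<le> C" and "a \<le> b"
  shows "C-lipschitz_on {a..b} p"
proof (rule lipschitz_onI)
  show "0 \<le> C" using order_trans[OF norm_ge_zero C[of a]] \<open>a \<le> b\<close> by simp
  fix s t assume "s \<in> {a..b}" "t \<in> {a..b}"
  then have "norm (p s - p t) \<le> C * norm (s - t)"
  proof (intro differentiable_bound[of "{a..b}" p "\<lambda>x h. h *\<^sub>R p' x"])
    fix x assume x: "x \<in> {a..b}"
    show "(p has_derivative (\<lambda>h. h *\<^sub>R p' x)) (at x within {a..b})"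
      using der[OF x] by (simp add: has_vector_derivative_def)
    show "onorm (\<lambda>h. h *\<^sub>R p' x) \<le> C"
      using C[OF x] by (intro onorm_le) (auto simp: mult.commute[of C] intro!: mult_left_mono)
  qed auto
  then show "dist (p s) (p t) \<le> C * dist s t" by (simp add: dist_norm)
qed

lemma absolutely_continuous_on_imp_continuous_on:
  assumes "absolutely_continuous_on {a..b::real} f"
  shows "continuous_on {a..b} f"
  unfolding continuous_on_iff
proof (intro ballI allI impI)
  fix x e :: real assume x: "x \<in> {a..b}" and e: "e > 0"
  obtain d where d: "d > 0" "\<And>D T. D division_of T \<Longrightarrow> T \<subseteq> {a..b} \<Longrightarrow> (\<Sum>K\<in>D. Sup K - Inf K) < d \<Longrightarrow>
      (\<Sum>K\<in>D. norm (f (Sup K) - f (Inf K))) < e"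
    using absolutely_continuous_onD[OF assms e] by metis
  have "dist (f y) (f x) < e" if y: "y \<in> {a..b}" "dist y x < d" for y
  proof -
    define u v where "u = min x y" and "v = max x y"
    have uv: "u \<le> v" "u \<in> {a..b}" "v \<in> {a..b}" "v - u < d"
      using x y by (auto simp: u_def v_def dist_real_def)
    have "{cbox u v} division_of cbox u v" using uv by (intro division_of_self) auto
    from d(2)[OF this] uv have "norm (f v - f u) < e" by auto
    then show ?thesis
      by (cases "x \<le> y") (auto simp: u_def v_def dist_norm norm_minus_commute)
  qed
  with d(1) show "\<exists>d>0. \<forall>x'\<in>{a..b}. dist x' x < d \<longrightarrow> dist (f x') (f x) < e" by blast
qed

text \<open>The increments are compared along a fine tagged division. Where the tag is a point with derivative
zero, the increment is small relative to the length of the interval; the other intervals lie in an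
open set of small measure, so absolute continuity bounds the sum of their increments.\<close>

lemma absolutely_continuous_on_zero_derivative_constant:
  fixes u :: "real \<Rightarrow> 'a::real_normed_vector"
  assumes ac: "absolutely_continuous_on {a..b} u" and ab: "a \<le> b"
    and der: "AE t in lebesgue_on {a..b}. (u has_vector_derivative 0) (at t within {a..b})"
  shows "u b = u a"
proof -
  obtain N where N: "negligible N"
    and out: "\<And>t. t \<in> {a..b} - N \<Longrightarrow> (u has_vector_derivative 0) (at t within {a..b})"
  proof -
    from der obtain N where N: "N \<in> null_sets (lebesgue_on {a..b})"
      "{t \<in> space (lebesgue_on {a..b}). \<not> (u has_vector_derivative 0) (at t within {a..b})} \<subseteq> N"
      unfolding eventually_ae_filter by blast
    have "N \<in> null_sets lebesgue"
      using N(1) by (subst (asm) null_sets_restrict_space) auto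
    then show thesis
      using that[of N] N(2) by (auto simp: negligible_iff_null_sets)
  qed
  have "norm (u b - u a) \<le> e" if e: "e > 0" for e
  proof -
    define e1 where "e1 = e / (2 * (b - a + 1))"
    have e1: "e1 > 0" "e1 * (b - a) \<le> e / 2" using e ab by (auto simp: e1_def field_simps)
    obtain d where d: "d > 0" "\<And>D T. D division_of T \<Longrightarrow> T \<subseteq> {a..b} \<Longrightarrow> (\<Sum>K\<in>D. Sup K - Inf K) < d \<Longrightarrow>
      (\<Sum>K\<in>D. norm (u (Sup K) - u (Inf K))) < e / 2"
      using absolutely_continuous_onD[OF ac, of "e / 2"] e by auto
    obtain G where G: "open G" "N \<subseteq> G" "G - N \<in> lmeasurable" "emeasure lebesgue (G - N) < ennreal d"
      using sets_lebesgue_outer_open[of N d] N d(1) by (auto simp: negligible_iff_null_sets)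
    have Glm: "G \<in> lmeasurable"
    proof -
      have "G = (G - N) \<union> N" using G by auto
      moreover have "(G - N) \<union> N \<in> lmeasurable"
        using G(3) N negligible_iff_measure by (intro fmeasurable.Un) auto
      ultimately show ?thesis by simp
    qed
    have Gm: "measure lebesgue G < d"
    proof -
      have "G = (G - N) \<union> N" using G by auto
      then have "measure lebesgue G \<le> measure lebesgue (G - N) + measure lebesgue N"
        using measure_Un_le[of "G - N" lebesgue N] G(3) N
        by (metis fmeasurableD negligible_iff_null_sets null_setsD2)
      also have "measure lebesgue N = 0"
        using N by (simp add: negligible_imp_measure0)
      also have "measure lebesgue (G - N) + 0 < d" using G(3,4) d(1)
        by (metis add.right_neutral emeasure_eq_measure2 ennreal_less_iff measure_nonneg)
      finally show ?thesis .
    qed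
    have "\<exists>r>0. (t \<in> N \<longrightarrow> ball t r \<subseteq> G) \<and>
       (t \<in> {a..b} - N \<longrightarrow> (\<forall>y\<in>{a..b}. \<bar>y - t\<bar> < r \<longrightarrow> norm (u y - u t) \<le> e1 * \<bar>y - t\<bar>))" for t
    proof (cases "t \<in> N")
      case True
      then show ?thesis using G by (auto simp: open_contains_ball)
    next
      case False
      show ?thesis
      proof (cases "t \<in> {a..b}")
        case True
        with False out have "(u has_derivative (\<lambda>x. x *\<^sub>R 0)) (at t within {a..b})"
          by (auto simp: has_vector_derivative_def)
        from this[unfolded has_derivative_within_alt] e1(1) obtain r where "r > 0"
          "\<forall>y\<in>{a..b}. norm (y - t) < r \<longrightarrow> norm (u y - u t - (y - t) *\<^sub>R 0) \<le> e1 * norm (y - t)"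
          by blast
        with False show ?thesis by (intro exI[of _ r]) auto
      qed (use False in \<open>auto intro: exI[of _ 1]\<close>)
    qed
    then obtain r where r: "\<And>t. r t > 0" "\<And>t. t \<in> N \<Longrightarrow> ball t (r t) \<subseteq> G"
      "\<And>t y. t \<in> {a..b} - N \<Longrightarrow> y \<in> {a..b} \<Longrightarrow> \<bar>y - t\<bar> < r t \<Longrightarrow> norm (u y - u t) \<le> e1 * \<bar>y - t\<bar>"
      by metis
    have "gauge (\<lambda>t. ball t (r t))" using r(1) by (intro gauge_ball_dependent) auto
    then obtain p where p: "p tagged_division_of {a..b}" "(\<lambda>t. ball t (r t)) fine p"
      using fine_division_exists_real by blast
    define q where "q = {(t, K). (t, K) \<in> p \<and> t \<in> N}"
    have q: "q \<subseteq> p" by (auto simp: q_def)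
    have finp: "finite p" using p(1) by auto
    have qpart: "q tagged_partial_division_of {a..b}"
      using p(1) q by (auto simp: tagged_division_of_def intro: tagged_partial_division_subset)
    have qdiv: "snd ` q division_of \<Union> (snd ` q)"
      by (rule partial_division_of_tagged_division[OF qpart])
    have form: "\<exists>c d. K = {c..d} \<and> c \<le> d \<and> t \<in> {c..d} \<and> {c..d} \<subseteq> {a..b} \<and> {c..d} \<subseteq> ball t (r t)"
      if "(t, K) \<in> p" for t K
      using tagged_division_ofD(2,3,4)[OF p(1) that] fineD[OF p(2) that] by auto
    have over: "(\<Sum>(t,K)\<in>q. norm (u (Sup K) - u (Inf K))) = (\<Sum>K\<in>snd ` q. norm (u (Sup K) - u (Inf K)))"
    proof -
      have ne: "K \<noteq> {}" if "K \<in> snd ` q" for K using that form q by fastforce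
      define w where "w K = (if K = {} then 0 else norm (u (Sup K) - u (Inf K)))" for K
      have "(\<Sum>(t,K)\<in>q. w K) = (\<Sum>K\<in>snd ` q. w K)"
      proof (intro sum.over_tagged_division_lemma[OF tagged_partial_division_of_Union_self[OF qpart]])
        fix c d :: real assume "box c d = {}"
        then have "d \<le> c" by simp
        then show "w (cbox c d) = 0" by (cases "c = d") (auto simp: w_def)
      qed
      moreover have "w K = norm (u (Sup K) - u (Inf K))" if "K \<in> snd ` q" for K
        using ne[OF that] by (simp add: w_def)
      ultimately show ?thesis by (auto simp: case_prod_unfold)
    qed
    have small: "(\<Sum>(t,K)\<in>q. norm (u (Sup K) - u (Inf K))) < e / 2"
      unfolding over
    proof (rule d(2)[OF qdiv])
      show "\<Union> (snd ` q) \<subseteq> {a..b}" using form q by fastforce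
      have UG: "\<Union> (snd ` q) \<subseteq> G"
      proof
        fix y assume "y \<in> \<Union> (snd ` q)"
        then obtain t K where tK: "(t, K) \<in> q" "y \<in> K" by auto
        then have "t \<in> N" "(t, K) \<in> p" by (auto simp: q_def)
        then show "y \<in> G" using form[of t K] r(2)[of t] tK(2) by blast
      qed
      have "(\<Sum>K\<in>snd ` q. Sup K - Inf K) = (\<Sum>K\<in>snd ` q. measure lebesgue K)"
      proof (rule sum.cong[OF refl])
        fix K assume "K \<in> snd ` q"
        then obtain t where "(t, K) \<in> p" using q by force
        from form[OF this] show "Sup K - Inf K = measure lebesgue K" by auto
      qed
      also have "\<dots> = measure lebesgue (\<Union> (snd ` q))"
        using content_division[OF qdiv] by simp
      also have "\<dots> \<le> measure lebesgue G"
        using qdiv UG Glm by (intro measure_mono_fmeasurable)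
           (auto simp: lmeasurable_division fmeasurableD)
      also have "\<dots> < d" by (rule Gm)
      finally show "(\<Sum>K\<in>snd ` q. Sup K - Inf K) < d" .
    qed
    have rest: "(\<Sum>(t,K)\<in>p - q. norm (u (Sup K) - u (Inf K))) \<le> (\<Sum>(t,K)\<in>p - q. e1 * measure lborel K)"
    proof (rule sum_mono, clarify)
      fix t K assume tK: "(t, K) \<in> p" "(t, K) \<notin> q"
      then have tN: "t \<notin> N" by (auto simp: q_def)
      obtain c f where cf: "K = {c..f}" "c \<le> f" "t \<in> {c..f}" "{c..f} \<subseteq> {a..b}" "{c..f} \<subseteq> ball t (r t)"
        using form[OF tK(1)] by blast
      have t: "t \<in> {a..b} - N" using cf tN by auto
      have m: "f \<in> {a..b}" "c \<in> {a..b}" "f \<in> ball t (r t)" "c \<in> ball t (r t)"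
        using cf(2,4,5) by (meson atLeastAtMost_iff order_refl subsetD)+
      then have "norm (u f - u t) \<le> e1 * \<bar>f - t\<bar>" "norm (u c - u t) \<le> e1 * \<bar>c - t\<bar>"
        using r(3)[OF t m(1)] r(3)[OF t m(2)] by (auto simp: dist_real_def abs_minus_commute)
      moreover have "norm (u f - u c) \<le> norm (u f - u t) + norm (u c - u t)"
        using norm_triangle_ineq4[of "u f - u t" "u c - u t"] by simp
      ultimately have "norm (u f - u c) \<le> e1 * \<bar>f - t\<bar> + e1 * \<bar>c - t\<bar>" by linarith
      also have "\<dots> = e1 * (f - c)" using cf by (auto simp: algebra_simps)
      finally show "norm (u (Sup K) - u (Inf K)) \<le> e1 * measure lborel K" using cf by simp
    qed
    have "(\<Sum>(t,K)\<in>p - q. e1 * measure lborel K) \<le> (\<Sum>(t,K)\<in>p. e1 * measure lborel K)"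
      using finp e1(1) by (intro sum_mono2) auto
    also have "\<dots> = e1 * (\<Sum>(t,K)\<in>p. measure lborel K)"
      by (simp add: sum_distrib_left case_prod_unfold)
    also have "(\<Sum>(t,K)\<in>p. measure lborel K) = b - a"
      using additive_content_tagged_division[of p a b] p(1) ab by simp
    finally have rest2: "(\<Sum>(t,K)\<in>p - q. norm (u (Sup K) - u (Inf K))) \<le> e / 2"
      using rest e1(2) by linarith
    have "u b - u a = (\<Sum>(t,K)\<in>p. u (Sup K) - u (Inf K))"
      using additive_tagged_division_1[OF ab p(1), of u] by simp
    then have "norm (u b - u a) \<le> (\<Sum>(t,K)\<in>p. norm (u (Sup K) - u (Inf K)))"
      by (metis (no_types, lifting) norm_sum sum.cong case_prod_unfold)
    also have "\<dots> = (\<Sum>(t,K)\<in>q. norm (u (Sup K) - u (Inf K))) + (\<Sum>(t,K)\<in>p - q. norm (u (Sup K) - u (Inf K)))"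
      using sum.subset_diff[OF q finp] by (simp add: add.commute)
    finally show ?thesis using small rest2 by linarith
  qed
  then have "norm (u b - u a) \<le> 0" by (rule field_le_epsilon[of _ 0, simplified])
  then show ?thesis by simp
qed

section \<open>Weights and the dominant part\<close>

declare layer.simps [simp del] weight.simps [simp del] next_value.simps [simp del]

text \<open>The coordinates that the noise has not reached after step \<open>l\<close>; they are exactly those of infinite weight
(\<open>weight_eq_infinity_iff\<close>).\<close>

definition remaining :: "'n::finite rpoly ^ 'n \<Rightarrow> real ^ 'n \<Rightarrow> nat \<Rightarrow> 'n set" where
  "remaining P \<sigma> l = UNIV - (\<Union>k\<in>{..l}. layer P \<sigma> k)"

lemma remaining_0: "remaining P \<sigma> 0 = - layer P \<sigma> 0"
  by (auto simp: remaining_def)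

lemma remaining_Suc: "remaining P \<sigma> (Suc l) = remaining P \<sigma> l - layer P \<sigma> (Suc l)"
  by (auto simp: remaining_def atMost_Suc)

lemma next_value_le_poly_value:
  assumes "j \<in> remaining P \<sigma> l"
  shows "next_value P \<sigma> l \<le> poly_value (P $ j) (weight P \<sigma> l)"
  using assms unfolding next_value.simps remaining_def[symmetric] by (intro Min_le) auto

lemma layer_SucD:
  assumes "j \<in> layer P \<sigma> (Suc l)"
  shows "j \<in> remaining P \<sigma> l" and "next_value P \<sigma> l < \<infinity>"
proof -
  from assms show r: "j \<in> remaining P \<sigma> l"
    by (auto simp: layer.simps remaining_def[symmetric] Let_def split: if_splits)
  from assms obtain i where i: "i \<in> remaining P \<sigma> l" "poly_value (P $ i) (weight P \<sigma> l) \<noteq> \<infinity>"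
    by (auto simp: layer.simps remaining_def[symmetric] Let_def split: if_splits)
  then show "next_value P \<sigma> l < \<infinity>"
    using next_value_le_poly_value[OF i(1)] by (auto simp: less_top top.not_eq_extremum)
qed

lemma weight_Suc_layer:
  "j \<in> layer P \<sigma> (Suc l) \<Longrightarrow> weight P \<sigma> (Suc l) j = next_value P \<sigma> l + 1"
  by (simp add: weight.simps)

lemma weight_Suc_other:
  "j \<notin> layer P \<sigma> (Suc l) \<Longrightarrow> weight P \<sigma> (Suc l) j = weight P \<sigma> l j"
  by (simp add: weight.simps)

lemma weight_eq_infinity_iff: "weight P \<sigma> l j = \<infinity> \<longleftrightarrow> j \<in> remaining P \<sigma> l"
proof (induction l)
  case 0
  show ?case
    by (auto simp: weight.simps remaining_0 layer.simps ennreal_divide_eq_top_iff)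
next
  case (Suc l)
  show ?case
  proof (cases "j \<in> layer P \<sigma> (Suc l)")
    case True
    then show ?thesis
      using layer_SucD(2)[OF True] by (auto simp: weight_Suc_layer remaining_Suc)
  next
    case False
    then show ?thesis using Suc by (simp add: weight_Suc_other remaining_Suc)
  qed
qed

lemma weight_stable:
  assumes "j \<notin> remaining P \<sigma> l" "l \<le> l'"
  shows "weight P \<sigma> l' j = weight P \<sigma> l j"
  using assms(2)
proof (induction l' rule: dec_induct)
  case (step k)
  have "j \<notin> remaining P \<sigma> k"
    using assms(1) step(1) by (auto simp: remaining_def)
  then show ?case
    using step.IH layer_SucD(1)[of j P \<sigma> k] weight_Suc_other[of j P \<sigma> k] by auto
qed simp

lemma weight_le_monomial_value:
  assumes "Poly_Mapping.lookup \<mu> i \<noteq> 0"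
  shows "c i \<le> monomial_value \<mu> c"
proof -
  have "of_nat 1 \<le> (of_nat (Poly_Mapping.lookup \<mu> i) :: ennreal)"
    using assms by (intro of_nat_mono) simp
  then have "1 * c i \<le> of_nat (Poly_Mapping.lookup \<mu> i) * c i"
    by (intro mult_right_mono) auto
  also have "\<dots> \<le> monomial_value \<mu> c"
    unfolding monomial_value_def by (intro member_le_sum) auto
  finally show ?thesis by simp
qed

lemma monomial_value_cong:
  assumes "\<And>i. Poly_Mapping.lookup \<mu> i \<noteq> 0 \<Longrightarrow> c i = c' i"
  shows "monomial_value \<mu> c = monomial_value \<mu> c'"
  unfolding monomial_value_def using assms by (intro sum.cong refl) (metis mult_zero_left of_nat_0)

lemma next_value_le_monomial_value:
  assumes "j \<in> remaining P \<sigma> l" "\<mu> \<in> Poly_Mapping.keys (P $ j)"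
  shows "next_value P \<sigma> l \<le> monomial_value \<mu> (weight P \<sigma> l)"
  using next_value_le_poly_value[OF assms(1)] assms(2)
  unfolding poly_value_def by (meson INF_lower order_trans)

text \<open>A monomial changes its value in step \<open>k\<close> only if it contains a variable of the new layer. That variable
then has weight \<open>next_value P \<sigma> k + 1\<close>, so even a changed value exceeds \<open>next_value P \<sigma> k\<close>.\<close>

lemma next_value_mono:
  assumes "l \<le> l'" "remaining P \<sigma> l' \<noteq> {}"
  shows "next_value P \<sigma> l \<le> next_value P \<sigma> l'"
  using assms
proof (induction l' rule: dec_induct)
  case (step k)
  have sub: "remaining P \<sigma> (Suc k) \<subseteq> remaining P \<sigma> k" by (auto simp: remaining_Suc)
  have "next_value P \<sigma> k \<le> next_value P \<sigma> (Suc k)"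
    unfolding next_value.simps[of P \<sigma> "Suc k"] remaining_def[symmetric]
  proof (rule Min.boundedI)
    fix v assume "v \<in> (\<lambda>j. poly_value (P $ j) (weight P \<sigma> (Suc k))) ` remaining P \<sigma> (Suc k)"
    then obtain j where j: "j \<in> remaining P \<sigma> (Suc k)" "v = poly_value (P $ j) (weight P \<sigma> (Suc k))"
      by auto
    have "next_value P \<sigma> k \<le> monomial_value \<mu> (weight P \<sigma> (Suc k))"
      if \<mu>: "\<mu> \<in> Poly_Mapping.keys (P $ j)" for \<mu>
    proof (cases "\<exists>i \<in> layer P \<sigma> (Suc k). Poly_Mapping.lookup \<mu> i \<noteq> 0")
      case True
      then obtain i where i: "i \<in> layer P \<sigma> (Suc k)" "Poly_Mapping.lookup \<mu> i \<noteq> 0" by blast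
      have "next_value P \<sigma> k \<le> weight P \<sigma> (Suc k) i" using i by (simp add: weight_Suc_layer)
      also have "\<dots> \<le> monomial_value \<mu> (weight P \<sigma> (Suc k))" by (rule weight_le_monomial_value[OF i(2)])
      finally show ?thesis .
    next
      case False
      then have "monomial_value \<mu> (weight P \<sigma> (Suc k)) = monomial_value \<mu> (weight P \<sigma> k)"
        by (intro monomial_value_cong weight_Suc_other) blast
      then show ?thesis using next_value_le_monomial_value[of j P \<sigma> k \<mu>] j(1) sub \<mu> by auto
    qed
    then show "next_value P \<sigma> k \<le> v"
      unfolding j(2) poly_value_def by (intro INF_greatest) auto
  qed (use step.prems in auto)
  moreover have "next_value P \<sigma> l \<le> next_value P \<sigma> k" using step sub by auto
  ultimately show ?case by order
qed simp

lemma remaining_noise_dim: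
  assumes "noise_propagating P \<sigma>"
  shows "remaining P \<sigma> (noise_dim P \<sigma>) = {}"
  using assms LeastI_ex[of "\<lambda>l. (\<Union>k\<in>{..l}. layer P \<sigma> k) = UNIV"]
  unfolding noise_propagating_def noise_dim_def remaining_def by auto

lemma layer_unique:
  assumes "j \<in> layer P \<sigma> k" "j \<in> layer P \<sigma> l"
  shows "k = l"
proof -
  have *: "\<not> k < l" if "j \<in> layer P \<sigma> k" "j \<in> layer P \<sigma> l" for k l
  proof
    assume "k < l"
    then obtain m where m: "l = Suc m" "k \<le> m" by (cases l) auto
    with that(2) layer_SucD(1)[of j P \<sigma> m] have "j \<notin> layer P \<sigma> k" by (auto simp: remaining_def)
    with that(1) show False by simp
  qed
  show ?thesis using *[of k l] *[of l k] assms by linarith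
qed

lemma layer_exists:
  assumes "noise_propagating P \<sigma>"
  obtains k where "k \<le> noise_dim P \<sigma>" "j \<in> layer P \<sigma> k"
  using remaining_noise_dim[OF assms] by (auto simp: remaining_def)

lemma weight_noise_dim:
  assumes "noise_propagating P \<sigma>"
  shows "weight P \<sigma> (noise_dim P \<sigma>) j = ennreal (final_weight P \<sigma> j)"
  using weight_eq_infinity_iff[of P \<sigma> "noise_dim P \<sigma>" j] remaining_noise_dim[OF assms]
  by (simp add: final_weight_def less_top)

lemma final_weight_nonneg: "final_weight P \<sigma> j \<ge> 0"
  by (simp add: final_weight_def)

lemma final_weight_noisy:
  assumes "\<sigma> $ j > 0"
  shows "final_weight P \<sigma> j = 1 / 2"
proof -
  have "j \<notin> remaining P \<sigma> 0" using assms by (simp add: remaining_0 layer.simps)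
  then have "weight P \<sigma> (noise_dim P \<sigma>) j = weight P \<sigma> 0 j" by (intro weight_stable) auto
  also have "\<dots> = ennreal (1 / 2)" using assms
    by (simp add: weight.simps ennreal_divide_numeral flip: ennreal_1)
  finally show ?thesis unfolding final_weight_def by (simp only: enn2real_ennreal)
qed

text \<open>A coordinate reached later than step \<open>l + 1\<close> gets a weight derived from a later value, and
the values increase. So a monomial discarded at step \<open>l\<close> because of an infinite weight remains
subdominant for the final weights.\<close>

lemma next_value_add_one_le_weight:
  assumes "noise_propagating P \<sigma>" "i \<in> remaining P \<sigma> l"
  shows "next_value P \<sigma> l + 1 \<le> weight P \<sigma> (noise_dim P \<sigma>) i"
proof -
  obtain k where k: "k \<le> noise_dim P \<sigma>" "i \<in> layer P \<sigma> k" by (rule layer_exists[OF assms(1)])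
  with assms(2) have "l < k" by (auto simp: remaining_def not_le[symmetric])
  then obtain m where m: "k = Suc m" "l \<le> m" by (cases k) auto
  have "i \<notin> remaining P \<sigma> k" using k by (auto simp: remaining_def)
  from weight_stable[OF this k(1)] have w: "weight P \<sigma> (noise_dim P \<sigma>) i = next_value P \<sigma> m + 1"
    using k(2) m(1) by (simp add: weight_Suc_layer)
  have "next_value P \<sigma> l \<le> next_value P \<sigma> m"
    using layer_SucD(1)[of i P \<sigma> m] k(2) m by (intro next_value_mono) auto
  then show ?thesis by (simp add: w add_right_mono)
qed

text \<open>The power of \<open>\<epsilon>\<close> in front of the monomial \<open>\<mu>\<close> of \<open>P\<^sup>j\<close> after rescaling: \<open>1\<close> comes from the time scale, the
weight of \<open>j\<close> from dividing the coordinate \<open>j\<close> by its power of \<open>\<epsilon>\<close>, and the sum from the variables.\<close>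

definition excess :: "'n::finite rpoly ^ 'n \<Rightarrow> real ^ 'n \<Rightarrow> 'n \<Rightarrow> ('n \<Rightarrow>\<^sub>0 nat) \<Rightarrow> real" where
  "excess P \<sigma> j \<mu> = 1 - final_weight P \<sigma> j +
    (\<Sum>i\<in>UNIV. real (Poly_Mapping.lookup \<mu> i) * final_weight P \<sigma> i)"

lemma monomial_value_final_weight:
  assumes "noise_propagating P \<sigma>"
  shows "monomial_value \<mu> (weight P \<sigma> (noise_dim P \<sigma>)) =
    ennreal (\<Sum>i\<in>UNIV. real (Poly_Mapping.lookup \<mu> i) * final_weight P \<sigma> i)"
proof -
  have "monomial_value \<mu> (weight P \<sigma> (noise_dim P \<sigma>)) =
      (\<Sum>i\<in>UNIV. ennreal (real (Poly_Mapping.lookup \<mu> i) * final_weight P \<sigma> i))"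
    unfolding monomial_value_def weight_noise_dim[OF assms]
    by (intro sum.cong refl) (simp add: final_weight_nonneg ennreal_mult ennreal_of_nat_eq_real_of_nat)
  also have "\<dots> = ennreal (\<Sum>i\<in>UNIV. real (Poly_Mapping.lookup \<mu> i) * final_weight P \<sigma> i)"
    by (intro sum_ennreal) (simp add: final_weight_nonneg)
  finally show ?thesis .
qed

lemma excess_noisy:
  assumes "j \<in> layer P \<sigma> 0"
  shows "excess P \<sigma> j \<mu> > 0"
proof -
  have "final_weight P \<sigma> j = 1 / 2" using assms by (intro final_weight_noisy) (simp add: layer.simps)
  moreover have "(\<Sum>i\<in>UNIV. real (Poly_Mapping.lookup \<mu> i) * final_weight P \<sigma> i) \<ge> 0"
    by (intro sum_nonneg) (simp add: final_weight_nonneg)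
  ultimately show ?thesis by (simp add: excess_def)
qed

text \<open>For \<open>j\<close> in layer \<open>l + 1\<close> the excess is the value of \<open>\<mu>\<close> at the final weights minus \<open>next_value P \<sigma> l\<close>. If all
variables of \<open>\<mu>\<close> have been reached by step \<open>l\<close>, their weights are final already and this
is the comparison made by the procedure. Otherwise some variable has a final weight that exceeds
\<open>next_value P \<sigma> l\<close> by at least one, and \<open>\<mu>\<close> is strictly subdominant.\<close>

lemma excess_layer_Suc:
  assumes np: "noise_propagating P \<sigma>" and j: "j \<in> layer P \<sigma> (Suc l)"
    and \<mu>: "\<mu> \<in> Poly_Mapping.keys (P $ j)"
  shows "excess P \<sigma> j \<mu> \<ge> 0"
    and "excess P \<sigma> j \<mu> = 0 \<longleftrightarrow> monomial_value \<mu> (weight P \<sigma> l) = next_value P \<sigma> l"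
proof -
  let ?N = "noise_dim P \<sigma>" and ?s = "\<Sum>i\<in>UNIV. real (Poly_Mapping.lookup \<mu> i) * final_weight P \<sigma> i"
  obtain k where "k \<le> ?N" "j \<in> layer P \<sigma> k" by (rule layer_exists[OF np])
  with layer_unique[OF j] have lN: "Suc l \<le> ?N" by metis
  obtain q where q: "next_value P \<sigma> l = ennreal q" "q \<ge> 0"
    using layer_SucD(2)[OF j] by (cases "next_value P \<sigma> l") auto
  have "j \<notin> remaining P \<sigma> (Suc l)" using j by (simp add: remaining_Suc)
  from weight_stable[OF this lN] have "ennreal (final_weight P \<sigma> j) = ennreal (q + 1)"
    using weight_Suc_layer[OF j] q by (simp add: weight_noise_dim[OF np])
  then have fw: "final_weight P \<sigma> j = q + 1" using q(2) final_weight_nonneg[of P \<sigma> j]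
    by (subst (asm) ennreal_inj) auto
  have s: "?s \<ge> 0" by (intro sum_nonneg) (simp add: final_weight_nonneg)
  have ex: "excess P \<sigma> j \<mu> = ?s - q" by (simp add: excess_def fw)
  have "excess P \<sigma> j \<mu> \<ge> 0 \<and> (excess P \<sigma> j \<mu> = 0 \<longleftrightarrow> monomial_value \<mu> (weight P \<sigma> l) = next_value P \<sigma> l)"
  proof (cases "\<exists>i\<in>remaining P \<sigma> l. Poly_Mapping.lookup \<mu> i \<noteq> 0")
    case True
    then obtain i where i: "i \<in> remaining P \<sigma> l" "Poly_Mapping.lookup \<mu> i \<noteq> 0" by blast
    have "monomial_value \<mu> (weight P \<sigma> l) = \<infinity>"
      using weight_le_monomial_value[OF i(2), of "weight P \<sigma> l"] i(1)
        weight_eq_infinity_iff[of P \<sigma> l i] by (simp add: top_unique)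
    then have 1: "monomial_value \<mu> (weight P \<sigma> l) \<noteq> next_value P \<sigma> l" by (simp add: q)
    have "ennreal q + 1 \<le> weight P \<sigma> ?N i"
      using next_value_add_one_le_weight[OF np i(1)] by (simp add: q)
    also have "\<dots> \<le> ennreal ?s"
      using weight_le_monomial_value[OF i(2)] by (simp add: monomial_value_final_weight[OF np, symmetric])
    finally have "q + 1 \<le> ?s" using q(2) s by (simp flip: ennreal_1 ennreal_plus)
    with 1 show ?thesis by (simp add: ex)
  next
    case False
    have "monomial_value \<mu> (weight P \<sigma> l) = monomial_value \<mu> (weight P \<sigma> ?N)"
      using False lN by (intro monomial_value_cong weight_stable[symmetric]) auto
    then have 1: "monomial_value \<mu> (weight P \<sigma> l) = ennreal ?s"
      by (simp add: monomial_value_final_weight[OF np])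
    have "next_value P \<sigma> l \<le> monomial_value \<mu> (weight P \<sigma> l)"
      by (rule next_value_le_monomial_value[OF layer_SucD(1)[OF j] \<mu>])
    then show ?thesis unfolding 1 q ex using s q(2) by (auto simp: ennreal_le_iff)
  qed
  then show "excess P \<sigma> j \<mu> \<ge> 0"
    and "excess P \<sigma> j \<mu> = 0 \<longleftrightarrow> monomial_value \<mu> (weight P \<sigma> l) = next_value P \<sigma> l" by auto
qed

lemma excess_nonneg:
  assumes "noise_propagating P \<sigma>" "\<mu> \<in> Poly_Mapping.keys (P $ j)"
  shows "excess P \<sigma> j \<mu> \<ge> 0"
proof -
  obtain k where k: "j \<in> layer P \<sigma> k" using layer_exists[OF assms(1)] by metis
  show ?thesis
    using excess_noisy[of j P \<sigma> \<mu>] excess_layer_Suc(1)[OF assms(1) _ assms(2)] k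
    by (cases k) auto
qed

lemma poly_fun_sum_single:
  assumes "A \<subseteq> Poly_Mapping.keys p"
  shows "poly_fun (\<Sum>m\<in>A. Poly_Mapping.single m (Poly_Mapping.lookup p m)) x =
    (\<Sum>m\<in>A. Poly_Mapping.lookup p m * (\<Prod>i\<in>UNIV. (x $ i) ^ Poly_Mapping.lookup m i))"
proof -
  have fin: "finite A" using assms finite_keys finite_subset by metis
  let ?q = "\<Sum>m\<in>A. Poly_Mapping.single m (Poly_Mapping.lookup p m)"
  have lk: "Poly_Mapping.lookup ?q m = (if m \<in> A then Poly_Mapping.lookup p m else 0)" for m
    using fin by (simp add: lookup_sum lookup_single when_def)
  have "Poly_Mapping.keys ?q = A"
    using assms by (auto simp: in_keys_iff lk split: if_splits)
  then show ?thesis unfolding poly_fun_def by (simp add: lk)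
qed

lemma poly_fun_dominant_part:
  assumes np: "noise_propagating P \<sigma>"
  shows "poly_fun (dominant_part P \<sigma> $ j) x =
    (\<Sum>\<mu> | \<mu> \<in> Poly_Mapping.keys (P $ j) \<and> excess P \<sigma> j \<mu> = 0.
      Poly_Mapping.lookup (P $ j) \<mu> * (\<Prod>i\<in>UNIV. (x $ i) ^ Poly_Mapping.lookup \<mu> i))"
proof (cases "j \<in> layer P \<sigma> 0")
  case True
  then have "{\<mu> \<in> Poly_Mapping.keys (P $ j). excess P \<sigma> j \<mu> = 0} = {}"
    using excess_noisy[OF True] by (auto simp: less_le)
  then show ?thesis using True by (simp add: dominant_part_def poly_fun_def del: Collect_empty_eq)
next
  case False
  obtain k where k: "j \<in> layer P \<sigma> k" using layer_exists[OF np] by metis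
  with False obtain l where l: "j \<in> layer P \<sigma> (Suc l)" by (cases k) auto
  have the: "(THE l. j \<in> layer P \<sigma> (Suc l)) = l"
    using l by (intro the_equality) (auto dest: layer_unique[of j P \<sigma> "Suc l"])
  have set: "{\<mu>. \<mu> \<in> Poly_Mapping.keys (P $ j) \<and> monomial_value \<mu> (weight P \<sigma> l) = next_value P \<sigma> l} =
      {\<mu>. \<mu> \<in> Poly_Mapping.keys (P $ j) \<and> excess P \<sigma> j \<mu> = 0}"
    using excess_layer_Suc(2)[OF np l] by auto
  show ?thesis
    using False by (simp add: dominant_part_def the set poly_fun_sum_single[of _ "P $ j"] Let_def)
qed

section \<open>Normal distributions\<close>

definition gauss :: "real \<Rightarrow> real measure" where
  "gauss v = density lborel (\<lambda>x. ennreal (normal_density 0 (sqrt v) x))"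

lemma sets_gauss [measurable_cong, simp]: "sets (gauss v) = sets borel"
  by (simp add: gauss_def)

lemma space_gauss [simp]: "space (gauss v) = UNIV"
  by (simp add: gauss_def)

lemma prob_space_gauss: "v > 0 \<Longrightarrow> prob_space (gauss v)"
  unfolding gauss_def by (intro prob_space_normal_density) simp

lemma gauss_tail:
  assumes v: "v > 0" and a: "a > 0"
  shows "measure (gauss v) {x. \<bar>x\<bar> \<ge> a} \<le> v / a\<^sup>2"
proof -
  interpret prob_space "gauss v" by (rule prob_space_gauss[OF v])
  have m: "has_bochner_integral lborel (\<lambda>x. normal_density 0 (sqrt v) x * x ^ 2) v"
    using normal_moment_even[of "sqrt v" 0 1] v by (simp add: fact_2)
  have int: "integrable (gauss v) (\<lambda>x. x\<^sup>2)"
    unfolding gauss_def using m v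
    by (subst integrable_density) (auto simp: has_bochner_integral_iff)
  have val: "(\<integral>x. x\<^sup>2 \<partial>gauss v) = v"
    unfolding gauss_def using m v
    by (subst integral_density) (auto simp: has_bochner_integral_iff)
  have "measure (gauss v) {x \<in> space (gauss v). x\<^sup>2 \<ge> a\<^sup>2} \<le> (\<integral>x. x\<^sup>2 \<partial>gauss v) / a\<^sup>2"
    using a by (intro integral_Markov_inequality_measure[OF int, of "{}"]) auto
  moreover have "{x \<in> space (gauss v). x\<^sup>2 \<ge> a\<^sup>2} = {x. \<bar>x\<bar> \<ge> a}"
    using a by (auto simp: abs_le_square_iff[symmetric])
  ultimately show ?thesis by (simp add: val)
qed

text \<open>The standard normal density at \<open>L + 1\<close>, which bounds from below the mass of any interval of length one
inside \<open>[-(L + 1), L + 1]\<close>.\<close>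

definition gauss_bound :: "real \<Rightarrow> real" where
  "gauss_bound L = exp (- (L + 1)\<^sup>2 / 2) / sqrt (2 * pi)"

lemma gauss_bound_pos: "gauss_bound L > 0"
  by (simp add: gauss_bound_def)

lemma gauss_interval:
  assumes v: "v > 0" and p: "\<And>x. x \<in> {p<..<p + sqrt v} \<Longrightarrow> \<bar>x\<bar> \<le> (L + 1) * sqrt v"
    and A: "A \<in> sets borel" "{p<..<p + sqrt v} \<subseteq> A"
  shows "gauss_bound L \<le> measure (gauss v) A"
proof -
  interpret prob_space "gauss v" by (rule prob_space_gauss[OF v])
  let ?I = "{p<..<p + sqrt v}"
  have dens: "gauss_bound L / sqrt v \<le> normal_density 0 (sqrt v) x" if x: "x \<in> ?I" for x
  proof -
    have "x\<^sup>2 \<le> ((L + 1) * sqrt v)\<^sup>2" using p[OF x] by (metis abs_ge_zero power2_abs power_mono)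
    then have "x\<^sup>2 \<le> (L + 1)\<^sup>2 * v" using v by (simp add: power_mult_distrib)
    then have "x\<^sup>2 / (2 * v) \<le> (L + 1)\<^sup>2 / 2" using v by (simp add: field_simps)
    then show ?thesis using v
      by (simp add: gauss_bound_def normal_density_def real_sqrt_mult divide_right_mono)
  qed
  have "ennreal (gauss_bound L) = ennreal (gauss_bound L / sqrt v) * emeasure lborel ?I"
    using v gauss_bound_pos[of L] by (simp add: ennreal_mult[symmetric] less_imp_le)
  also have "\<dots> = (\<integral>\<^sup>+x. ennreal (gauss_bound L / sqrt v) * indicator ?I x \<partial>lborel)"
    by (subst nn_integral_cmult_indicator) auto
  also have "\<dots> \<le> (\<integral>\<^sup>+x. ennreal (normal_density 0 (sqrt v) x) * indicator ?I x \<partial>lborel)"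
    using dens by (intro nn_integral_mono) (auto split: split_indicator intro: ennreal_leI)
  also have "\<dots> = emeasure (gauss v) ?I"
    unfolding gauss_def by (subst emeasure_density) auto
  also have "\<dots> = ennreal (measure (gauss v) ?I)" by (rule emeasure_eq_measure)
  finally have "gauss_bound L \<le> measure (gauss v) ?I"
    by (simp add: ennreal_le_iff)
  also have "\<dots> \<le> measure (gauss v) A" using A by (intro finite_measure_mono) auto
  finally show ?thesis .
qed

text \<open>The bound depends on the threshold only relative to the standard deviation. This makes all
later estimates uniform in the scale.\<close>

lemma gauss_half_lines:
  assumes v: "v > 0" and c: "0 \<le> c" "c \<le> L * sqrt v"
  shows "gauss_bound L \<le> measure (gauss v) {c<..}" "gauss_bound L \<le> measure (gauss v) {..<- c}"
proof -
  have "\<bar>x\<bar> \<le> (L + 1) * sqrt v" if "x \<in> {c<..<c + sqrt v}" for x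
    using that c by (auto simp: algebra_simps)
  then show "gauss_bound L \<le> measure (gauss v) {c<..}"
    using v by (intro gauss_interval[of v c]) auto
  have "\<bar>x\<bar> \<le> (L + 1) * sqrt v" if "x \<in> {- c - sqrt v<..<(- c - sqrt v) + sqrt v}" for x
    using that c by (auto simp: algebra_simps)
  then show "gauss_bound L \<le> measure (gauss v) {..<- c}"
    using v by (intro gauss_interval[of v "- c - sqrt v"]) auto
qed

section \<open>Brownian increments\<close>

lemma nn_integral_lborel_prod_cart:
  fixes f :: "'n::finite \<Rightarrow> real \<Rightarrow> ennreal"
  assumes [measurable]: "\<And>i. f i \<in> borel_measurable borel"
  shows "(\<integral>\<^sup>+x. (\<Prod>i\<in>UNIV. f i (x $ i)) \<partial>(lborel :: (real ^ 'n) measure)) = (\<Prod>i\<in>UNIV. \<integral>\<^sup>+x. f i x \<partial>lborel)"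
proof -
  have inj: "inj (\<lambda>i::'n. axis i (1::real))" by (auto simp: inj_on_def axis_eq_axis)
  define k where "k = the_inv (\<lambda>i::'n. axis i (1::real))"
  have k: "k (axis i 1) = i" for i unfolding k_def by (rule the_inv_f_f[OF inj])
  have basis: "(Basis :: (real ^ 'n) set) = (\<lambda>i. axis i 1) ` UNIV"
    by (auto simp: Basis_vec_def)
  have re: "(\<Prod>b\<in>(Basis :: (real ^ 'n) set). h b) = (\<Prod>i\<in>UNIV. h (axis i 1))" for h :: "real ^ 'n \<Rightarrow> ennreal"
    unfolding basis using inj by (subst prod.reindex) auto
  show ?thesis
    using nn_integral_lborel_prod[of "\<lambda>b::real ^ 'n. f (k b)"]
    by (simp add: re k cart_eq_inner_axis[symmetric])
qed

lemma measurable_vec_nth: "(\<lambda>y :: real ^ 'n::finite. y $ i) \<in> borel_measurable borel"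
  by (intro borel_measurable_continuous_onI continuous_intros)

lemma abs_le_from_rationals:
  fixes h :: "real \<Rightarrow> real"
  assumes "continuous_on {a..b} h" "a < b" "\<And>t. t \<in> \<rat> \<inter> {a..b} \<Longrightarrow> \<bar>h t\<bar> \<le> c" "t \<in> {a..b}"
  shows "\<bar>h t\<bar> \<le> c"
proof -
  have cl: "closure ({a<..<b} \<inter> \<rat>) = {a..b}"
    using closure_open_Int_superset[of "{a<..<b}" "\<rat>"] assms(2) Rats_closure_real by simp
  have "norm (h t) \<le> c"
    by (rule continuous_on_closure_norm_le[of "{a<..<b} \<inter> \<rat>"]) (use assms cl in auto)
  then show ?thesis by simp
qed

lemma polynomial_function_lipschitz:
  fixes p :: "real \<Rightarrow> 'b::euclidean_space"
  assumes "polynomial_function p"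
  obtains L where "L \<ge> 0" "\<And>s t. s \<in> {a..b} \<Longrightarrow> t \<in> {a..b} \<Longrightarrow> norm (p t - p s) \<le> L * \<bar>t - s\<bar>"
proof -
  obtain p' where p': "polynomial_function p'" "\<And>x. (p has_vector_derivative (p' x)) (at x)"
    using has_vector_derivative_polynomial_function[OF assms] by blast
  have "compact (p' ` {a..b})"
    using p'(1) by (intro compact_continuous_image continuous_on_polymonial_function) auto
  then obtain L where L: "\<And>x. x \<in> {a..b} \<Longrightarrow> norm (p' x) \<le> L"
    using compact_imp_bounded bounded_iff by (metis imageI)
  have "(max L 0)-lipschitz_on {a..b} p"
  proof (cases "a \<le> b")
    case True
    have "norm (p' x) \<le> max L 0" if "x \<in> {a..b}" for x using L[OF that] by simp
    then show ?thesis
      by (rule bounded_vector_derivative_imp_lipschitz_on[where p' = p', rotated])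
        (use True p'(2) in \<open>auto intro: has_vector_derivative_at_within\<close>)
  qed simp
  from lipschitz_onD[OF this] show thesis
    by (intro that[of "max L 0"]) (auto simp: dist_norm)
qed

locale brownian_motion = prob_space M
  for M :: "'a measure" and F :: "real \<Rightarrow> 'a measure" and B :: "real \<Rightarrow> 'a \<Rightarrow> real ^ 'n::finite" +
  assumes subalg: "\<And>t. t \<ge> 0 \<Longrightarrow> subalgebra M (F t)"
    and filtration: "\<And>s t. 0 \<le> s \<Longrightarrow> s \<le> t \<Longrightarrow> sets (F s) \<subseteq> sets (F t)"
    and standard: "standard_brownian_motion M F B"
begin

lemma space_F: "t \<ge> 0 \<Longrightarrow> space (F t) = space M"
  using subalg by (simp add: subalgebra_def)

lemma sets_F: "t \<ge> 0 \<Longrightarrow> A \<in> sets (F t) \<Longrightarrow> A \<in> events"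
  using subalg by (auto simp: subalgebra_def)

lemma space_in_F: "t \<ge> 0 \<Longrightarrow> space M \<in> sets (F t)"
  using space_F sets.top by metis

lemma B_measurable_F: "0 \<le> t \<Longrightarrow> t \<le> s \<Longrightarrow> B t \<in> borel_measurable (F s)"
  using standard filtration[of t s] space_F
  unfolding standard_brownian_motion_def measurable_def by auto

lemma coord_measurable_F:
  "0 \<le> t \<Longrightarrow> t \<le> s \<Longrightarrow> (\<lambda>\<omega>. B t \<omega> $ i) \<in> borel_measurable (F s)"
  by (rule measurable_compose[OF B_measurable_F measurable_vec_nth])

lemma B_measurable: "0 \<le> t \<Longrightarrow> B t \<in> borel_measurable M"
  using B_measurable_F[of t t] subalg[of t] measurable_from_subalg by auto

lemma indep_increment:
  assumes "0 \<le> s" "s < t" "G \<in> sets (F s)" "A \<in> sets borel"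
  shows "prob (G \<inter> {\<omega> \<in> space M. B t \<omega> - B s \<omega> \<in> A}) = prob G * prob {\<omega> \<in> space M. B t \<omega> - B s \<omega> \<in> A}"
proof -
  have "indep_set (sets (F s)) {(\<lambda>\<omega>. B t \<omega> - B s \<omega>) -` A \<inter> space M | A. A \<in> sets borel}"
    using standard assms unfolding standard_brownian_motion_def by blast
  moreover have "{\<omega> \<in> space M. B t \<omega> - B s \<omega> \<in> A} = (\<lambda>\<omega>. B t \<omega> - B s \<omega>) -` A \<inter> space M" by auto
  ultimately show ?thesis using assms by (auto intro!: indep_setD)
qed

lemma prob_increment_box:
  assumes st: "0 \<le> s" "s < t" and A: "\<And>i. A i \<in> sets borel"
  shows "prob {\<omega> \<in> space M. \<forall>i. B t \<omega> $ i - B s \<omega> $ i \<in> A i} = (\<Prod>i\<in>UNIV. measure (gauss (t - s)) (A i))"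
proof -
  let ?Y = "\<lambda>\<omega>. B t \<omega> - B s \<omega>" and ?f = "normal_density 0 (sqrt (t - s))"
  let ?C = "{y :: real ^ 'n. \<forall>i. y $ i \<in> A i}"
  interpret g: prob_space "gauss (t - s)" using st by (intro prob_space_gauss) simp
  have C: "?C \<in> sets borel"
  proof -
    have "?C = (\<Inter>i. (\<lambda>y. y $ i) -` A i \<inter> space borel)" by auto
    also have "\<dots> \<in> sets borel"
      using A by (intro sets.countable_INT'') (auto intro!: measurable_sets_borel[OF measurable_vec_nth] countable_finite)
    finally show ?thesis .
  qed
  have d: "distributed M lborel ?Y (\<lambda>y. ennreal (\<Prod>i\<in>UNIV. ?f (y $ i)))"
    using standard st unfolding standard_brownian_motion_def by blast
  have "emeasure M {\<omega> \<in> space M. \<forall>i. B t \<omega> $ i - B s \<omega> $ i \<in> A i} = emeasure M (?Y -` ?C \<inter> space M)"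
    by (intro arg_cong[where f = "emeasure M"]) auto
  also have "\<dots> = (\<integral>\<^sup>+y. ennreal (\<Prod>i\<in>UNIV. ?f (y $ i)) * indicator ?C y \<partial>lborel)"
    using C by (intro distributed_emeasure[OF d]) auto
  also have "\<dots> = (\<integral>\<^sup>+y. (\<Prod>i\<in>UNIV. ennreal (?f (y $ i)) * indicator (A i) (y $ i)) \<partial>lborel)"
  proof (rule nn_integral_cong)
    fix y :: "real ^ 'n"
    have "indicator ?C y = (\<Prod>i\<in>UNIV. indicator (A i) (y $ i) :: ennreal)"
      by (cases "\<forall>i. y $ i \<in> A i") (auto simp: indicator_def prod_zero_iff)
    then show "ennreal (\<Prod>i\<in>UNIV. ?f (y $ i)) * indicator ?C y =
        (\<Prod>i\<in>UNIV. ennreal (?f (y $ i)) * indicator (A i) (y $ i))"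
      by (simp add: prod.distrib prod_ennreal)
  qed
  also have "\<dots> = (\<Prod>i\<in>UNIV. \<integral>\<^sup>+x. ennreal (?f x) * indicator (A i) x \<partial>lborel)"
    using A by (intro nn_integral_lborel_prod_cart[of "\<lambda>i x. ennreal (?f x) * indicator (A i) x"]
      borel_measurable_times borel_measurable_indicator) auto
  also have "\<dots> = (\<Prod>i\<in>UNIV. emeasure (gauss (t - s)) (A i))"
    using A by (intro prod.cong refl) (simp add: gauss_def emeasure_density)
  also have "\<dots> = ennreal (\<Prod>i\<in>UNIV. measure (gauss (t - s)) (A i))"
    by (simp add: g.emeasure_eq_measure prod_ennreal)
  finally show ?thesis by (simp add: emeasure_eq_measure prod_nonneg)
qed

lemma prob_increment_tail:
  assumes st: "0 \<le> s" "s < t" and a: "a > 0"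
  shows "prob {\<omega> \<in> space M. \<bar>B t \<omega> $ i - B s \<omega> $ i\<bar> \<ge> a} \<le> (t - s) / a\<^sup>2"
proof -
  interpret g: prob_space "gauss (t - s)" using st by (intro prob_space_gauss) simp
  define A where "A k = (if k = i then {x. \<bar>x\<bar> \<ge> a} else UNIV :: real set)" for k
  have [measurable]: "A k \<in> sets borel" for k by (simp add: A_def)
  have "{\<omega> \<in> space M. \<bar>B t \<omega> $ i - B s \<omega> $ i\<bar> \<ge> a} = {\<omega> \<in> space M. \<forall>k. B t \<omega> $ k - B s \<omega> $ k \<in> A k}"
    by (auto simp: A_def split: if_splits)
  then have "prob {\<omega> \<in> space M. \<bar>B t \<omega> $ i - B s \<omega> $ i\<bar> \<ge> a} = (\<Prod>k\<in>UNIV. measure (gauss (t - s)) (A k))"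
    using prob_increment_box[OF st, of A] by simp
  also have "\<dots> = (\<Prod>k\<in>UNIV. if k = i then measure (gauss (t - s)) {x. \<bar>x\<bar> \<ge> a} else 1)"
    using g.prob_space by (intro prod.cong refl) (auto simp: A_def)
  also have "\<dots> \<le> (t - s) / a\<^sup>2" using gauss_tail[of "t - s" a] st a by simp
  finally show ?thesis .
qed

lemma prob_increment_orthant:
  assumes st: "0 \<le> s" "s < t" and c: "0 \<le> c" "c \<le> L * sqrt (t - s)"
  shows "gauss_bound L ^ CARD('n) \<le>
    prob {\<omega> \<in> space M. \<forall>i. if i \<in> S then B t \<omega> $ i - B s \<omega> $ i < - c else c < B t \<omega> $ i - B s \<omega> $ i}"
proof -
  define A where "A i = (if i \<in> S then {..<- c} else {c<..})" for i
  have [measurable]: "A k \<in> sets borel" for k by (simp add: A_def)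
  have "gauss_bound L ^ CARD('n) = (\<Prod>i\<in>(UNIV::'n set). gauss_bound L)" by simp
  also have "\<dots> \<le> (\<Prod>i\<in>UNIV. measure (gauss (t - s)) (A i))"
    using gauss_half_lines[of "t - s" c L] c st gauss_bound_pos[of L]
    by (intro prod_mono) (auto simp: A_def less_imp_le)
  also have "\<dots> = prob {\<omega> \<in> space M. \<forall>i. B t \<omega> $ i - B s \<omega> $ i \<in> A i}"
    using prob_increment_box[OF st, of A] by simp
  also have "{\<omega> \<in> space M. \<forall>i. B t \<omega> $ i - B s \<omega> $ i \<in> A i} =
    {\<omega> \<in> space M. \<forall>i. if i \<in> S then B t \<omega> $ i - B s \<omega> $ i < - c else c < B t \<omega> $ i - B s \<omega> $ i}"
    by (auto simp: A_def split: if_splits)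
  finally show ?thesis .
qed

section \<open>A conditional maximal inequality\<close>

lemma increment_measurable_F:
  "0 \<le> s \<Longrightarrow> s \<le> t \<Longrightarrow> t \<le> u \<Longrightarrow> (\<lambda>\<omega>. B t \<omega> $ i - B s \<omega> $ i) \<in> borel_measurable (F u)"
  by (intro borel_measurable_diff coord_measurable_F) auto

lemma increment_event:
  assumes "0 \<le> s" "s \<le> t" "t \<le> u" "Measurable.pred borel Q"
  shows "{\<omega> \<in> space M. Q (B t \<omega> $ i - B s \<omega> $ i)} \<in> sets (F u)"
proof -
  have "{\<omega> \<in> space (F u). Q (B t \<omega> $ i - B s \<omega> $ i)} \<in> sets (F u)"
    by (rule predE) (intro measurable_compose[OF increment_measurable_F] assms)
  then show ?thesis using space_F[of u] assms by simp
qed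

text \<open>Ottaviani's inequality, conditionally on an event \<open>G\<close> of the past. Decompose according to the first time \<open>t\<close>
in \<open>Q\<close> at which the increment exceeds \<open>2 * a\<close>. The remaining increment after \<open>t\<close> is independent of the
past and smaller than \<open>a\<close> with probability at least \<open>1/2\<close>; if it is, the increment over \<open>[s, u]\<close> exceeds
\<open>a\<close>.\<close>

lemma maximal_inequality_finite:
  assumes s: "0 \<le> s" "s \<le> u" and Q: "finite Q" "Q \<subseteq> {s..u}" and G: "G \<in> sets (F s)" and a: "a > 0"
  shows "prob (G \<inter> {\<omega> \<in> space M. \<exists>t\<in>Q. \<bar>B t \<omega> $ i - B s \<omega> $ i\<bar> > 2 * a}) \<le> 2 * (u - s) / a\<^sup>2 * prob G"
proof -
  define E where "E = G \<inter> {\<omega> \<in> space M. \<exists>t\<in>Q. \<bar>B t \<omega> $ i - B s \<omega> $ i\<bar> > 2 * a}"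
  have Gm: "G \<in> events" using G s sets_F by blast
  have EG: "prob E \<le> prob G" unfolding E_def using Gm by (intro finite_measure_mono) auto
  \<comment> \<open>If the factor is at least one, the bound is trivial.\<close>
  consider "u = s" | "1 \<le> 2 * (u - s) / a\<^sup>2" | "s < u" "2 * (u - s) / a\<^sup>2 < 1" using s by linarith
  then have "prob E \<le> 2 * (u - s) / a\<^sup>2 * prob G"
  proof cases
    case 1
    then have "E = {}" using Q(2) a by (auto simp: E_def)
    then show ?thesis using 1 by simp
  next
    case 2
    then have "1 * prob G \<le> 2 * (u - s) / a\<^sup>2 * prob G" by (intro mult_right_mono) auto
    then show ?thesis using EG by simp
  next
    case 3
    \<comment> \<open>The increment exceeds the threshold for the first time at \<open>t\<close>.\<close>
    define H where "H t = G \<inter> {\<omega> \<in> space M. \<bar>B t \<omega> $ i - B s \<omega> $ i\<bar> > 2 * a} \<inter>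
      {\<omega> \<in> space M. \<forall>r\<in>{r\<in>Q. r < t}. \<not> \<bar>B r \<omega> $ i - B s \<omega> $ i\<bar> > 2 * a}" for t
    define K where "K t = H t \<inter> {\<omega> \<in> space M. \<bar>B u \<omega> $ i - B t \<omega> $ i\<bar> < a}" for t
    have HF: "H t \<in> sets (F t)" if "t \<in> Q" for t
    proof -
      have t: "s \<le> t" "0 \<le> t" using that Q(2) s by auto
      have "G \<in> sets (F t)" using G filtration[of s t] s t by auto
      moreover have "{\<omega> \<in> space M. \<bar>B t \<omega> $ i - B s \<omega> $ i\<bar> > 2 * a} \<in> sets (F t)"
        using s t by (intro increment_event) auto
      moreover have "{\<omega> \<in> space (F t). \<forall>r\<in>{r\<in>Q. r < t}. \<not> \<bar>B r \<omega> $ i - B s \<omega> $ i\<bar> > 2 * a} \<in> sets (F t)"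
      proof (rule sets.sets_Collect_finite_All)
        fix r assume "r \<in> {r \<in> Q. r < t}"
        then show "{\<omega> \<in> space (F t). \<not> \<bar>B r \<omega> $ i - B s \<omega> $ i\<bar> > 2 * a} \<in> sets (F t)"
          using s t Q(2) space_F[of t] increment_event[of s r t "\<lambda>x. \<not> \<bar>x\<bar> > 2 * a" i] by auto
      qed (use Q in auto)
      ultimately show ?thesis unfolding H_def using space_F[OF t(2)] by auto
    qed
    have Hm: "H t \<in> events" if "t \<in> Q" for t using sets_F[of t "H t"] HF[OF that] Q(2) s that by auto
    have Km: "K t \<in> events" if "t \<in> Q" for t
    proof -
      have "{\<omega> \<in> space M. \<bar>B u \<omega> $ i - B t \<omega> $ i\<bar> < a} \<in> sets (F u)"
        using that s Q(2) by (intro increment_event) auto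
      then have "{\<omega> \<in> space M. \<bar>B u \<omega> $ i - B t \<omega> $ i\<bar> < a} \<in> events" using s by (intro sets_F[of u]) auto
      then show ?thesis unfolding K_def using Hm[OF that] by auto
    qed
    have half: "prob (H t) \<le> 2 * prob (K t)" if t: "t \<in> Q" for t
    proof (cases "t = u")
      case True
      then have "K t = H t" using a sets.sets_into_space[OF Hm[OF t]] by (auto simp: K_def)
      then show ?thesis by simp
    next
      case False
      then have tu: "0 \<le> t" "t < u" "s \<le> t" using t Q(2) s by auto
      let ?A = "{y :: real ^ 'n. \<bar>y $ i\<bar> < a}"
      have Ab: "?A \<in> sets borel"
        using measurable_sets_borel[OF measurable_vec_nth, of "{x. \<bar>x\<bar> < a}" i] by (simp add: vimage_def)
      have "prob {\<omega> \<in> space M. \<bar>B u \<omega> $ i - B t \<omega> $ i\<bar> \<ge> a} \<le> (u - t) / a\<^sup>2"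
        using tu a by (intro prob_increment_tail)
      also have "\<dots> \<le> (u - s) / a\<^sup>2" using tu by (intro divide_right_mono) auto
      also have "\<dots> \<le> 1 / 2" using 3(2) by (simp only: times_divide_eq_right[symmetric])
      finally have "prob {\<omega> \<in> space M. \<bar>B u \<omega> $ i - B t \<omega> $ i\<bar> \<ge> a} \<le> 1 / 2" .
      moreover have "prob (space M - {\<omega> \<in> space M. \<bar>B u \<omega> $ i - B t \<omega> $ i\<bar> \<ge> a}) =
          1 - prob {\<omega> \<in> space M. \<bar>B u \<omega> $ i - B t \<omega> $ i\<bar> \<ge> a}"
        using tu s by (intro prob_compl sets_F[of u] increment_event) auto
      moreover have "space M - {\<omega> \<in> space M. \<bar>B u \<omega> $ i - B t \<omega> $ i\<bar> \<ge> a} =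
          {\<omega> \<in> space M. B u \<omega> - B t \<omega> \<in> ?A}" by auto
      ultimately have "1 / 2 \<le> prob {\<omega> \<in> space M. B u \<omega> - B t \<omega> \<in> ?A}" by simp
      then have "prob (H t) * (1 / 2) \<le> prob (H t) * prob {\<omega> \<in> space M. B u \<omega> - B t \<omega> \<in> ?A}"
        by (intro mult_left_mono) auto
      also have "\<dots> = prob (K t)"
        using indep_increment[OF tu(1,2) HF[OF t] Ab] unfolding K_def by simp
      finally show ?thesis by simp
    qed
    have sub: "E \<subseteq> (\<Union>t\<in>Q. H t)"
    proof
      fix \<omega> assume \<omega>: "\<omega> \<in> E"
      let ?R = "{t\<in>Q. \<bar>B t \<omega> $ i - B s \<omega> $ i\<bar> > 2 * a}"
      have R: "finite ?R" "?R \<noteq> {}" using \<omega> Q by (auto simp: E_def)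
      have "Min ?R \<in> ?R" using R by (rule Min_in)
      moreover have "\<not> \<bar>B r \<omega> $ i - B s \<omega> $ i\<bar> > 2 * a" if "r \<in> Q" "r < Min ?R" for r
        using that R Min_le[of ?R r] by auto
      ultimately have "\<omega> \<in> H (Min ?R)" using \<omega> unfolding H_def E_def by blast
      then show "\<omega> \<in> (\<Union>t\<in>Q. H t)" using \<open>Min ?R \<in> ?R\<close> by blast
    qed
    have disj: "disjoint_family_on K Q"
      unfolding disjoint_family_on_def
    proof (intro ballI impI)
      fix t r assume tr: "t \<in> Q" "r \<in> Q" "t \<noteq> r"
      have "H t \<inter> H r = {}"
      proof (cases "t < r")
        case True
        then show ?thesis using tr by (auto simp: H_def)
      next
        case False
        then have "r < t" using tr by simp
        then show ?thesis using tr by (auto simp: H_def)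
      qed
      then show "K t \<inter> K r = {}" by (auto simp: K_def)
    qed
    let ?A = "{y :: real ^ 'n. \<bar>y $ i\<bar> \<ge> a}"
    have Ab: "?A \<in> sets borel"
      using measurable_sets_borel[OF measurable_vec_nth, of "{x. \<bar>x\<bar> \<ge> a}" i] by (simp add: vimage_def)
    have big: "{\<omega> \<in> space M. B u \<omega> - B s \<omega> \<in> ?A} = {\<omega> \<in> space M. \<bar>B u \<omega> $ i - B s \<omega> $ i\<bar> \<ge> a}" by auto
    have KG: "(\<Union>t\<in>Q. K t) \<subseteq> G \<inter> {\<omega> \<in> space M. B u \<omega> - B s \<omega> \<in> ?A}"
      unfolding big by (auto simp: K_def H_def)
    have "prob E \<le> prob (\<Union>t\<in>Q. H t)"
      using sub Hm Q by (intro finite_measure_mono) auto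
    also have "\<dots> \<le> (\<Sum>t\<in>Q. prob (H t))"
      using Hm Q by (intro finite_measure_subadditive_finite) auto
    also have "\<dots> \<le> (\<Sum>t\<in>Q. 2 * prob (K t))" by (intro sum_mono half)
    also have "\<dots> = 2 * prob (\<Union>t\<in>Q. K t)"
      using Km Q disj by (subst finite_measure_finite_Union) (auto simp: sum_distrib_left)
    also have "\<dots> \<le> 2 * prob (G \<inter> {\<omega> \<in> space M. B u \<omega> - B s \<omega> \<in> ?A})"
    proof -
      have "{\<omega> \<in> space M. \<bar>B u \<omega> $ i - B s \<omega> $ i\<bar> \<ge> a} \<in> events"
        using s by (intro sets_F[of u] increment_event) auto
      then show ?thesis using KG Gm big by (intro mult_left_mono finite_measure_mono) auto
    qed
    also have "\<dots> = 2 * (prob G * prob {\<omega> \<in> space M. \<bar>B u \<omega> $ i - B s \<omega> $ i\<bar> \<ge> a})"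
      using indep_increment[OF s(1) 3(1) G Ab] by (simp add: big)
    also have "\<dots> \<le> 2 * (prob G * ((u - s) / a\<^sup>2))"
      using prob_increment_tail[OF s(1) 3(1) a, of i] by (intro mult_left_mono) auto
    also have "\<dots> = 2 * (u - s) / a\<^sup>2 * prob G" by simp
    finally show ?thesis .
  qed
  then show ?thesis by (simp add: E_def)
qed

lemma maximal_inequality:
  assumes s: "0 \<le> s" "s \<le> u" and D: "countable D" "D \<subseteq> {s..u}" and G: "G \<in> sets (F s)" and a: "a > 0"
  shows "prob (G \<inter> {\<omega> \<in> space M. \<exists>t\<in>D. \<bar>B t \<omega> $ i - B s \<omega> $ i\<bar> > 2 * a}) \<le> 2 * (u - s) / a\<^sup>2 * prob G"
proof (cases "D = {}")
  case True
  then show ?thesis using s by simp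
next
  case False
  define Q where "Q m = from_nat_into D ` {..m}" for m
  have QD: "Q m \<subseteq> D" for m using from_nat_into[OF False] by (auto simp: Q_def)
  have UQ: "(\<Union>m. Q m) = D"
    using range_from_nat_into[OF False D(1)] unfolding Q_def by blast
  define E where "E m = G \<inter> {\<omega> \<in> space M. \<exists>t\<in>Q m. \<bar>B t \<omega> $ i - B s \<omega> $ i\<bar> > 2 * a}" for m
  have Em: "E m \<in> events" for m
  proof -
    have "{\<omega> \<in> space M. \<exists>t\<in>Q m. \<bar>B t \<omega> $ i - B s \<omega> $ i\<bar> > 2 * a} =
        (\<Union>t\<in>Q m. {\<omega> \<in> space M. \<bar>B t \<omega> $ i - B s \<omega> $ i\<bar> > 2 * a})" by auto
    also have "\<dots> \<in> events"
    proof (intro sets.finite_UN)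
      fix t assume "t \<in> Q m"
      then have "t \<in> {s..u}" using QD D(2) by blast
      then show "{\<omega> \<in> space M. \<bar>B t \<omega> $ i - B s \<omega> $ i\<bar> > 2 * a} \<in> events"
        using s by (intro sets_F[of u] increment_event) auto
    qed (simp add: Q_def)
    finally show ?thesis using G s sets_F[of s G] unfolding E_def by auto
  qed
  have "(\<lambda>m. prob (E m)) \<longlonglongrightarrow> prob (\<Union>m. E m)"
    using Em by (intro finite_Lim_measure_incseq) (auto simp: incseq_def E_def Q_def)
  moreover have "prob (E m) \<le> 2 * (u - s) / a\<^sup>2 * prob G" for m
    unfolding E_def using s D(2) QD[of m] G a by (intro maximal_inequality_finite) (auto simp: Q_def)
  ultimately have "prob (\<Union>m. E m) \<le> 2 * (u - s) / a\<^sup>2 * prob G"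
    by (intro LIMSEQ_le_const2) auto
  moreover have "(\<Union>m. E m) = G \<inter> {\<omega> \<in> space M. \<exists>t\<in>D. \<bar>B t \<omega> $ i - B s \<omega> $ i\<bar> > 2 * a}"
    unfolding E_def UQ[symmetric] by auto
  ultimately show ?thesis by simp
qed

text \<open>The bound is scale invariant: it depends on the length of the interval and on the threshold \<open>a\<close> only
through \<open>(u - s) / a\<^sup>2\<close>.\<close>

lemma maximal_inequality_vec:
  assumes s: "0 \<le> s" "s \<le> u" and D: "countable D" "D \<subseteq> {s..u}" and G: "G \<in> sets (F s)" and a: "a > 0"
  shows "{\<omega> \<in> space M. \<exists>t\<in>D. \<exists>i. \<bar>B t \<omega> $ i - B s \<omega> $ i\<bar> > a} \<in> sets (F u)"
    and "prob (G \<inter> {\<omega> \<in> space M. \<exists>t\<in>D. \<exists>i. \<bar>B t \<omega> $ i - B s \<omega> $ i\<bar> > a}) \<le>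
      8 * real CARD('n) * (u - s) / a\<^sup>2 * prob G"
proof -
  let ?E = "\<lambda>i. {\<omega> \<in> space M. \<exists>t\<in>D. \<bar>B t \<omega> $ i - B s \<omega> $ i\<bar> > 2 * (a / 2)}"
  have EF: "?E i \<in> sets (F u)" for i
  proof -
    have "?E i = (\<Union>t\<in>D. {\<omega> \<in> space M. \<bar>B t \<omega> $ i - B s \<omega> $ i\<bar> > a})" by auto
    also have "\<dots> \<in> sets (F u)"
      using D s by (intro sets.countable_UN'') (auto intro!: increment_event)
    finally show ?thesis .
  qed
  have eq: "{\<omega> \<in> space M. \<exists>t\<in>D. \<exists>i. \<bar>B t \<omega> $ i - B s \<omega> $ i\<bar> > a} = (\<Union>i. ?E i)" by auto
  show "{\<omega> \<in> space M. \<exists>t\<in>D. \<exists>i. \<bar>B t \<omega> $ i - B s \<omega> $ i\<bar> > a} \<in> sets (F u)"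
    unfolding eq using EF by (intro sets.finite_UN) auto
  have Em: "G \<inter> ?E i \<in> events" for i
    using EF[of i] G s sets_F[of s G] sets_F[of u "?E i"] by auto
  have "prob (G \<inter> (\<Union>i. ?E i)) = prob (\<Union>i. G \<inter> ?E i)"
    by (intro arg_cong[where f = prob]) blast
  also have "\<dots> \<le> (\<Sum>i\<in>UNIV. prob (G \<inter> ?E i))"
    using Em by (intro finite_measure_subadditive_finite) auto
  also have "\<dots> \<le> (\<Sum>i\<in>(UNIV :: 'n set). 2 * (u - s) / (a / 2)\<^sup>2 * prob G)"
    using assms by (intro sum_mono maximal_inequality) auto
  also have "\<dots> = 8 * real CARD('n) * (u - s) / a\<^sup>2 * prob G"
    by (simp add: power_divide field_simps)
  finally show "prob (G \<inter> {\<omega> \<in> space M. \<exists>t\<in>D. \<exists>i. \<bar>B t \<omega> $ i - B s \<omega> $ i\<bar> > a}) \<le>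
      8 * real CARD('n) * (u - s) / a\<^sup>2 * prob G" unfolding eq .
qed

section \<open>Tracking a Lipschitz path\<close>

text \<open>The signs of the increments over \<open>[s, u]\<close> can be prescribed, even as a function \<open>S\<close> of the past, with
probability at least \<open>gauss_bound L ^ CARD('n)\<close>. By the maximal inequality the path leaves the
tolerance \<open>a\<close> on a short interval with at most half that probability.\<close>

lemma orthant_step:
  assumes s: "0 \<le> s" "s < u" and D: "countable D" "D \<subseteq> {s..u}" and G: "G \<in> sets (F s)"
    and S: "\<And>i. {\<omega> \<in> space M. i \<in> S \<omega>} \<in> sets (F s)"
    and c: "0 \<le> c" "c \<le> L * sqrt (u - s)"
    and a: "a > 0" "8 * real CARD('n) * (u - s) / a\<^sup>2 \<le> gauss_bound L ^ CARD('n) / 2"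
  shows "gauss_bound L ^ CARD('n) / 2 * prob G \<le>
    prob (G \<inter> {\<omega> \<in> space M. (\<forall>t\<in>D. \<forall>i. \<bar>B t \<omega> $ i - B s \<omega> $ i\<bar> \<le> a) \<and>
      (\<forall>i. if i \<in> S \<omega> then B u \<omega> $ i - B s \<omega> $ i < - c else c < B u \<omega> $ i - B s \<omega> $ i)})"
proof -
  let ?p = "gauss_bound L ^ CARD('n)"
  \<comment> \<open>The path leaves the tolerance; this costs at most half of the probability gained by the signs.\<close>
  define bad where "bad = {\<omega> \<in> space M. \<exists>t\<in>D. \<exists>i. \<bar>B t \<omega> $ i - B s \<omega> $ i\<bar> > a}"
  define orth where "orth T = {\<omega> \<in> space M. \<forall>i. if i \<in> T then B u \<omega> $ i - B s \<omega> $ i < - c else c < B u \<omega> $ i - B s \<omega> $ i}" for T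
  define GT where "GT T = G \<inter> {\<omega> \<in> space M. S \<omega> = T}" for T
  have Gm: "G \<in> events" using G s sets_F by blast
  have badm: "bad \<in> events"
    unfolding bad_def using s D G a(1) by (intro sets_F[of u] maximal_inequality_vec) auto
  have GT: "GT T \<in> sets (F s)" for T
  proof -
    have "{\<omega> \<in> space M. S \<omega> = T} = (\<Inter>i. {\<omega> \<in> space M. i \<in> S \<omega> \<longleftrightarrow> i \<in> T})" by auto
    also have "\<dots> \<in> sets (F s)"
    proof (intro sets.finite_INT)
      fix i
      have "{\<omega> \<in> space M. i \<in> S \<omega> \<longleftrightarrow> i \<in> T} = (if i \<in> T then {\<omega> \<in> space M. i \<in> S \<omega>} else space M - {\<omega> \<in> space M. i \<in> S \<omega>})"
        by auto
      also have "\<dots> \<in> sets (F s)" using S[of i] space_in_F[OF s(1)] by auto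
      finally show "{\<omega> \<in> space M. i \<in> S \<omega> \<longleftrightarrow> i \<in> T} \<in> sets (F s)" .
    qed auto
    finally show ?thesis unfolding GT_def using G by auto
  qed
  have GTm: "GT T \<in> events" for T using GT s sets_F by blast
  let ?A = "\<lambda>T. {y :: real ^ 'n. \<forall>i. if i \<in> T then y $ i < - c else c < y $ i}"
  have Ab: "?A T \<in> sets borel" for T
  proof -
    have "?A T = (\<Inter>i. (\<lambda>y. y $ i) -` (if i \<in> T then {..<- c} else {c<..}))"
      by (auto split: if_splits)
    also have "\<dots> \<in> sets borel"
      by (intro sets.countable_INT'') (auto intro!: measurable_sets_borel[OF measurable_vec_nth] countable_finite)
    finally show ?thesis .
  qed
  have orth: "orth T = {\<omega> \<in> space M. B u \<omega> - B s \<omega> \<in> ?A T}" for T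
    unfolding orth_def by auto
  have orthm: "orth T \<in> events" for T
  proof -
    have "(\<lambda>\<omega>. B u \<omega> - B s \<omega>) \<in> borel_measurable M"
      using s by (intro borel_measurable_diff B_measurable) auto
    from measurable_sets[OF this Ab[of T]] show ?thesis
      unfolding orth by (simp add: vimage_def Int_def conj_commute)
  qed
  have each: "?p / 2 * prob (GT T) \<le> prob (GT T \<inter> orth T - bad)" for T
  proof -
    have "?p * prob (GT T) \<le> prob (orth T) * prob (GT T)"
      using prob_increment_orthant[OF s c, of T] by (intro mult_right_mono) (auto simp: orth_def)
    also have "\<dots> = prob (GT T \<inter> orth T)"
      using indep_increment[OF s GT Ab] unfolding orth by simp
    also have "\<dots> \<le> prob ((GT T \<inter> orth T - bad) \<union> (GT T \<inter> bad))"
      using GTm orthm badm by (intro finite_measure_mono) auto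
    also have "\<dots> \<le> prob (GT T \<inter> orth T - bad) + prob (GT T \<inter> bad)"
      using GTm orthm badm by (intro measure_Un_le) auto
    also have "prob (GT T \<inter> bad) \<le> 8 * real CARD('n) * (u - s) / a\<^sup>2 * prob (GT T)"
      unfolding bad_def using s D GT a(1) by (intro maximal_inequality_vec) auto
    also have "\<dots> \<le> ?p / 2 * prob (GT T)" using a(2) by (intro mult_right_mono) auto
    finally show ?thesis by (simp add: field_simps)
  qed
  have "prob G = prob (\<Union>T. GT T)"
    using sets.sets_into_space[OF Gm] by (intro arg_cong[where f = prob]) (auto simp: GT_def)
  also have "\<dots> = (\<Sum>T\<in>UNIV. prob (GT T))"
    using GTm by (intro finite_measure_finite_Union) (auto simp: disjoint_family_on_def GT_def)
  finally have "?p / 2 * prob G = (\<Sum>T\<in>UNIV. ?p / 2 * prob (GT T))" by (simp add: sum_distrib_left)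
  also have "\<dots> \<le> (\<Sum>T\<in>UNIV. prob (GT T \<inter> orth T - bad))" by (intro sum_mono each)
  also have "\<dots> = prob (\<Union>T. GT T \<inter> orth T - bad)"
    using GTm orthm badm
    by (intro finite_measure_finite_Union[symmetric]) (auto simp: disjoint_family_on_def GT_def)
  also have "(\<Union>T. GT T \<inter> orth T - bad) = G \<inter> {\<omega> \<in> space M. (\<forall>t\<in>D. \<forall>i. \<bar>B t \<omega> $ i - B s \<omega> $ i\<bar> \<le> a) \<and>
      (\<forall>i. if i \<in> S \<omega> then B u \<omega> $ i - B s \<omega> $ i < - c else c < B u \<omega> $ i - B s \<omega> $ i)}"
    unfolding GT_def orth_def bad_def not_less[symmetric] by blast
  finally show ?thesis .
qed

text \<open>The amount by which the increment of \<open>B\<close> since time \<open>s\<close> differs from that of the target path \<open>g\<close>.\<close>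

definition deviation :: "(real \<Rightarrow> real ^ 'n) \<Rightarrow> real \<Rightarrow> real \<Rightarrow> 'a \<Rightarrow> 'n \<Rightarrow> real" where
  "deviation g s t \<omega> i = (B t \<omega> $ i - B s \<omega> $ i) - (g t $ i - g s $ i)"

lemma deviation_event:
  assumes "0 \<le> s" "s \<le> t" "t \<le> u" "Measurable.pred borel Q"
  shows "{\<omega> \<in> space M. Q (deviation g s t \<omega> i)} \<in> sets (F u)"
  unfolding deviation_def
  using assms by (intro increment_event[where Q = "\<lambda>x. Q (x - (g t $ i - g s $ i))"]
      measurable_compose[OF _ assms(4)] borel_measurable_diff) auto

text \<open>Restricting to rational times makes this an event of the filtration, which need not be complete.
On continuous paths it controls all times by \<open>abs_le_from_rationals\<close>.\<close>

definition tracks :: "real \<Rightarrow> real \<Rightarrow> (real \<Rightarrow> real ^ 'n) \<Rightarrow> real \<Rightarrow> 'a set" where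
  "tracks s u g a = {\<omega> \<in> space M. \<forall>t\<in>\<rat> \<inter> {s..u}. \<forall>i. \<bar>deviation g s t \<omega> i\<bar> \<le> a}"

lemma tracks_event:
  assumes "0 \<le> s" "s \<le> u"
  shows "tracks s u g a \<in> sets (F u)"
proof -
  have "tracks s u g a = space M - (\<Union>t\<in>\<rat> \<inter> {s..u}. \<Union>i. {\<omega> \<in> space M. a < \<bar>deviation g s t \<omega> i\<bar>})"
    unfolding tracks_def not_less[symmetric] by blast
  also have "\<dots> \<in> sets (F u)"
  proof (rule sets.Diff)
    show "space M \<in> sets (F u)" using assms by (intro space_in_F) auto
    show "(\<Union>t\<in>\<rat> \<inter> {s..u}. \<Union>i. {\<omega> \<in> space M. a < \<bar>deviation g s t \<omega> i\<bar>}) \<in> sets (F u)"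
    proof (rule sets.countable_UN'')
      show "countable (\<rat> \<inter> {s..u})" by (intro countable_Int1 countable_rat)
      fix t assume "t \<in> \<rat> \<inter> {s..u}"
      then show "(\<Union>i. {\<omega> \<in> space M. a < \<bar>deviation g s t \<omega> i\<bar>}) \<in> sets (F u)"
        using assms deviation_event[of s t u "\<lambda>x. a < \<bar>x\<bar>" g] by (intro sets.finite_UN) auto
    qed
  qed
  finally show ?thesis .
qed

text \<open>If each increment of \<open>B\<close> over \<open>[r, u]\<close> has the sign opposite to the present deviation and exceeds the
variation \<open>c\<close> of the target, then every coordinate of the deviation moves towards zero, by at most \<open>2 * a\<close>,
and thus remains within \<open>2 * a\<close> at time \<open>u\<close>. On the way it changes by at most \<open>2 * a\<close>, hence the
tolerance \<open>4 * a\<close> in between. Since the bound at the end is the bound assumed at the start, steps can be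
concatenated.\<close>

lemma tracking_step:
  assumes s: "0 \<le> s" "s \<le> r" "r < u" and G: "G \<in> sets (F r)"
    and a: "a > 0" "8 * real CARD('n) * (u - r) / a\<^sup>2 \<le> gauss_bound L ^ CARD('n) / 2"
    and c: "0 \<le> c" "c \<le> L * sqrt (u - r)" "c \<le> a"
    and g: "\<And>t i. t \<in> {r..u} \<Longrightarrow> \<bar>g t $ i - g r $ i\<bar> \<le> c"
  shows "gauss_bound L ^ CARD('n) / 2 * prob (G \<inter> tracks s r g (4 * a) \<inter> {\<omega> \<in> space M. \<forall>i. \<bar>deviation g s r \<omega> i\<bar> \<le> 2 * a})
    \<le> prob (G \<inter> tracks s u g (4 * a) \<inter> {\<omega> \<in> space M. \<forall>i. \<bar>deviation g s u \<omega> i\<bar> \<le> 2 * a})"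
proof -
  have r0: "0 \<le> r" using s by simp
  have fin: "{\<omega> \<in> space M. \<forall>i. \<bar>deviation g s t \<omega> i\<bar> \<le> 2 * a} \<in> sets (F t)" if "s \<le> t" for t
  proof -
    have "{\<omega> \<in> space (F t). \<forall>i\<in>UNIV. \<bar>deviation g s t \<omega> i\<bar> \<le> 2 * a} \<in> sets (F t)"
      using s that space_F[of t] deviation_event[of s t t "\<lambda>x. \<bar>x\<bar> \<le> 2 * a" g]
      by (intro sets.sets_Collect_finite_All) auto
    then show ?thesis using s that by (simp add: space_F)
  qed
  define G' where "G' = G \<inter> tracks s r g (4 * a) \<inter> {\<omega> \<in> space M. \<forall>i. \<bar>deviation g s r \<omega> i\<bar> \<le> 2 * a}"
  have G': "G' \<in> sets (F r)"
    unfolding G'_def using G s fin[of r] tracks_event[of s r g "4 * a"] by auto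
  define D where "D = insert u (\<rat> \<inter> {r..u})"
  define S where "S \<omega> = {i. deviation g s r \<omega> i > 0}" for \<omega>
  let ?T = "G' \<inter> {\<omega> \<in> space M. (\<forall>t\<in>D. \<forall>i. \<bar>B t \<omega> $ i - B r \<omega> $ i\<bar> \<le> a) \<and>
      (\<forall>i. if i \<in> S \<omega> then B u \<omega> $ i - B r \<omega> $ i < - c else c < B u \<omega> $ i - B r \<omega> $ i)}"
  have "gauss_bound L ^ CARD('n) / 2 * prob G' \<le> prob ?T"
  proof (rule orthant_step[OF r0 s(3) _ _ G' _ c(1,2) a])
    show "countable D" unfolding D_def by (intro countable_insert countable_Int1 countable_rat)
    show "D \<subseteq> {r..u}" using s by (auto simp: D_def)
    show "{\<omega> \<in> space M. i \<in> S \<omega>} \<in> sets (F r)" for i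
      using s deviation_event[of s r r "\<lambda>x. x > 0" g i] by (simp add: S_def)
  qed
  also have "\<dots> \<le> prob (G \<inter> tracks s u g (4 * a) \<inter> {\<omega> \<in> space M. \<forall>i. \<bar>deviation g s u \<omega> i\<bar> \<le> 2 * a})"
  proof (rule finite_measure_mono)
    show "?T \<subseteq> G \<inter> tracks s u g (4 * a) \<inter> {\<omega> \<in> space M. \<forall>i. \<bar>deviation g s u \<omega> i\<bar> \<le> 2 * a}"
    proof
      fix \<omega> assume \<omega>: "\<omega> \<in> ?T"
      have sm: "\<omega> \<in> space M" using \<omega> by blast
      have dev: "deviation g s t \<omega> i = deviation g s r \<omega> i + (B t \<omega> $ i - B r \<omega> $ i) - (g t $ i - g r $ i)" for t i
        by (simp add: deviation_def)
      have r2: "\<bar>deviation g s r \<omega> i\<bar> \<le> 2 * a" for i using \<omega> by (auto simp: G'_def)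
      have inc: "\<bar>B t \<omega> $ i - B r \<omega> $ i\<bar> \<le> a" if "t \<in> D" for t i using \<omega> that by blast
      have 1: "\<bar>deviation g s u \<omega> i\<bar> \<le> 2 * a" for i
      proof (cases "i \<in> S \<omega>")
        case True
        then have "B u \<omega> $ i - B r \<omega> $ i < - c" "deviation g s r \<omega> i > 0"
          using \<omega> by (auto simp: S_def)
        then show ?thesis using g[of u i] r2[of i] inc[of u i] s c(3) dev[of u i]
          by (auto simp: D_def)
      next
        case False
        then have "c < B u \<omega> $ i - B r \<omega> $ i" "\<not> deviation g s r \<omega> i > 0"
          using \<omega> by (auto simp: S_def)
        then show ?thesis using g[of u i] r2[of i] inc[of u i] s c(3) dev[of u i]
          by (auto simp: D_def)
      qed
      have 2: "\<bar>deviation g s t \<omega> i\<bar> \<le> 4 * a" if t: "t \<in> \<rat> \<inter> {s..u}" for t i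
      proof (cases "t \<le> r")
        case True
        then show ?thesis using \<omega> t by (auto simp: G'_def tracks_def)
      next
        case False
        then show ?thesis using t g[of t i] r2[of i] inc[of t i] c(3) dev[of t i]
          by (auto simp: D_def)
      qed
      show "\<omega> \<in> G \<inter> tracks s u g (4 * a) \<inter> {\<omega> \<in> space M. \<forall>i. \<bar>deviation g s u \<omega> i\<bar> \<le> 2 * a}"
        using 1 2 \<omega> sm by (auto simp: G'_def tracks_def)
    qed
    have "G \<in> sets (F u)" using G filtration[of r u] s by auto
    then show "G \<inter> tracks s u g (4 * a) \<inter> {\<omega> \<in> space M. \<forall>i. \<bar>deviation g s u \<omega> i\<bar> \<le> 2 * a} \<in> events"
      using s fin[of u] tracks_event[of s u g "4 * a"] by (intro sets_F[of u]) auto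
  qed
  finally show ?thesis unfolding G'_def .
qed

text \<open>Divide \<open>[s, u]\<close> into \<open>N\<close> equal steps. With \<open>N\<close> large, each of them satisfies the hypotheses of
\<open>tracking_step\<close>, and \<open>N\<close> depends on \<open>L\<close>, \<open>c\<close> and the dimension only, because the tolerance and
the Lipschitz constant of \<open>g\<close> scale with \<open>sqrt (u - s)\<close> like the Brownian increments.\<close>

lemma tracking:
  assumes L: "L \<ge> 0" and c: "c > 0"
  obtains \<kappa> where "\<kappa> > 0" "\<And>s u g G. 0 \<le> s \<Longrightarrow> s < u \<Longrightarrow> G \<in> sets (F s) \<Longrightarrow>
    (\<And>r t i. r \<in> {s..u} \<Longrightarrow> t \<in> {s..u} \<Longrightarrow> \<bar>g t $ i - g r $ i\<bar> \<le> L * \<bar>t - r\<bar> / sqrt (u - s)) \<Longrightarrow>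
    \<kappa> * prob G \<le> prob (G \<inter> tracks s u g (c * sqrt (u - s)))"
proof -
  define p where "p = gauss_bound L ^ CARD('n) / 2"
  have p: "p > 0" using gauss_bound_pos[of L] by (simp add: p_def)
  \<comment> \<open>The first bound makes \<open>g\<close> vary by at most \<open>a\<close> per step, the second makes it improbable to leave the tolerance within a step.\<close>
  obtain N0 :: nat where N0: "real N0 \<ge> max (4 * L / c) (128 * real CARD('n) / (c\<^sup>2 * p))"
    using real_arch_simple by blast
  define N where "N = Suc N0"
  have N: "real N \<ge> 1" "4 * L / c \<le> real N" "128 * real CARD('n) / (c\<^sup>2 * p) \<le> real N"
    using N0 by (auto simp: N_def)
  have LN: "4 * L \<le> c * real N" using N(2) c by (simp add: field_simps)
  have pN: "128 * real CARD('n) / (c\<^sup>2 * real N) \<le> p" using N(1,3) c p by (simp add: field_simps)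
  show thesis
  proof (rule that[of "p ^ N"])
    show "p ^ N > 0" using p by simp
    fix s u :: real and g :: "real \<Rightarrow> real ^ 'n" and G
    assume su: "0 \<le> s" "s < u" and G: "G \<in> sets (F s)"
      and g: "\<And>r t i. r \<in> {s..u} \<Longrightarrow> t \<in> {s..u} \<Longrightarrow> \<bar>g t $ i - g r $ i\<bar> \<le> L * \<bar>t - r\<bar> / sqrt (u - s)"
    define l where "l = u - s"
    define h where "h = l / real N"
    \<comment> \<open>Since \<open>tracking_step\<close> yields the tolerance \<open>4 * a\<close>.\<close>
    define a where "a = c * sqrt l / 4"
    define T where "T j = s + real j * h" for j
    have l: "l > 0" using su by (simp add: l_def)
    have h: "h > 0" "real N * h = l" using l N(1) by (auto simp: h_def)
    have sql: "l / sqrt l = sqrt l" using l by (simp add: real_div_sqrt)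
    let ?E = "\<lambda>t. G \<inter> tracks s t g (4 * a) \<inter> {\<omega> \<in> space M. \<forall>i. \<bar>deviation g s t \<omega> i\<bar> \<le> 2 * a}"
    have a: "a > 0" using c l by (simp add: a_def)
    have "p ^ j * prob G \<le> prob (?E (T j))" if "j \<le> N" for j
      using that
    proof (induction j)
      case 0
      have "?E (T 0) = G"
        using a sets.sets_into_space[OF sets_F[OF su(1) G]] by (auto simp: T_def tracks_def deviation_def)
      then show ?case by simp
    next
      case (Suc j)
      have TS: "T (Suc j) - T j = h" by (simp add: T_def algebra_simps)
      have Tj: "s \<le> T j" "T j < T (Suc j)" "T (Suc j) \<le> u"
      proof -
        show "s \<le> T j" "T j < T (Suc j)" using h by (auto simp: T_def)
        have "real (Suc j) * h \<le> real N * h" using Suc.prems h by (intro mult_right_mono) auto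
        then show "T (Suc j) \<le> u" using h l by (simp add: T_def l_def)
      qed
      have "p * prob (?E (T j)) \<le> prob (?E (T (Suc j)))"
        unfolding p_def
      proof (rule tracking_step[where c = "L * h / sqrt l"])
        show "0 \<le> s" "s \<le> T j" "T j < T (Suc j)" "a > 0" by (fact su Tj a)+
        show "G \<in> sets (F (T j))" using G filtration[of s "T j"] su Tj by auto
        have "8 * real CARD('n) * (T (Suc j) - T j) / a\<^sup>2 = 128 * real CARD('n) / (c\<^sup>2 * real N)"
          unfolding TS a_def h_def using l c N(1) by (simp add: power_divide power_mult_distrib field_simps)
        then show "8 * real CARD('n) * (T (Suc j) - T j) / a\<^sup>2 \<le> gauss_bound L ^ CARD('n) / 2"
          using pN by (simp add: p_def)
        show "0 \<le> L * h / sqrt l" using L h l by simp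
        have "h / sqrt l \<le> sqrt h"
        proof -
          have "h \<le> l" using h N(1) mult_right_mono[of 1 "real N" h] by simp
          then have "sqrt h * sqrt h \<le> sqrt h * sqrt l" using h by (intro mult_left_mono) auto
          then show ?thesis using h l by (simp add: field_simps)
        qed
        then show "L * h / sqrt l \<le> L * sqrt (T (Suc j) - T j)"
          unfolding TS using mult_left_mono[OF _ L] by fastforce
        have "L * h / sqrt l = L / real N * (l / sqrt l)" by (simp add: h_def)
        also have "\<dots> = L / real N * sqrt l" unfolding sql ..
        also have "\<dots> \<le> c / 4 * sqrt l"
          using LN N(1) l by (intro mult_right_mono) (auto simp: field_simps)
        finally show "L * h / sqrt l \<le> a" by (simp add: a_def)
        show "\<bar>g t $ i - g (T j) $ i\<bar> \<le> L * h / sqrt l" if t: "t \<in> {T j..T (Suc j)}" for t i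
        proof -
          have "\<bar>g t $ i - g (T j) $ i\<bar> \<le> L * \<bar>t - T j\<bar> / sqrt (u - s)"
            using t Tj by (intro g) auto
          also have "\<dots> \<le> L * h / sqrt l"
            using t TS L l unfolding l_def[symmetric] by (intro divide_right_mono mult_left_mono) auto
          finally show ?thesis .
        qed
      qed
      moreover have "p * (p ^ j * prob G) \<le> p * prob (?E (T j))"
        using Suc p by (intro mult_left_mono) auto
      ultimately show ?case by (simp add: mult.assoc)
    qed
    from this[of N] have "p ^ N * prob G \<le> prob (?E (T N))" by simp
    also have "T N = u" using h by (simp add: T_def l_def)
    also have "prob (?E u) \<le> prob (G \<inter> tracks s u g (4 * a))"
      using G su sets_F[of s G] sets_F[of u] tracks_event[of s u g "4 * a"] by (intro finite_measure_mono) auto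
    also have "4 * a = c * sqrt (u - s)" by (simp add: a_def l_def)
    finally show "p ^ N * prob G \<le> prob (G \<inter> tracks s u g (c * sqrt (u - s)))" .
  qed
qed

text \<open>The attempts on \<open>[e (Suc k), e k]\<close> are ordered backwards in time: those with larger \<open>k\<close> belong to the past
of those with smaller \<open>k\<close>. So \<open>n\<close> failures in a row have probability at most \<open>(1 - \<kappa>) ^ n\<close>.\<close>

lemma tracking_infinitely_often:
  assumes e: "\<And>k. e (Suc k) < e k" "\<And>k. e k > 0"
    and L: "L \<ge> 0" and c: "c > 0"
    and g: "\<And>k r t i. r \<in> {e (Suc k)..e k} \<Longrightarrow> t \<in> {e (Suc k)..e k} \<Longrightarrow>
      \<bar>g k t $ i - g k r $ i\<bar> \<le> L * \<bar>t - r\<bar> / sqrt (e k - e (Suc k))"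
  shows "AE \<omega> in M. \<forall>m. \<exists>k\<ge>m. \<omega> \<in> tracks (e (Suc k)) (e k) (g k) (c * sqrt (e k - e (Suc k)))"
proof -
  obtain \<kappa> where \<kappa>: "\<kappa> > 0" "\<And>s u g G. 0 \<le> s \<Longrightarrow> s < u \<Longrightarrow> G \<in> sets (F s) \<Longrightarrow>
    (\<And>r t i. r \<in> {s..u} \<Longrightarrow> t \<in> {s..u} \<Longrightarrow> \<bar>g t $ i - g r $ i\<bar> \<le> L * \<bar>t - r\<bar> / sqrt (u - s)) \<Longrightarrow>
    \<kappa> * prob G \<le> prob (G \<inter> tracks s u g (c * sqrt (u - s)))"
    using tracking[OF L c] by blast
  define T where "T k = tracks (e (Suc k)) (e k) (g k) (c * sqrt (e k - e (Suc k)))" for k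
  have TF: "T k \<in> sets (F (e k))" for k
    unfolding T_def using e[of k] e(2)[of "Suc k"] by (intro tracks_event) auto
  define A where "A m n = {\<omega> \<in> space M. \<forall>k\<in>{m..<m + n}. \<omega> \<notin> T k}" for m n
  have step: "A m (Suc n) = A (Suc m) n - T m" for m n
  proof -
    have "{m..<m + Suc n} = insert m {Suc m..<Suc m + n}" by auto
    then show ?thesis by (auto simp: A_def)
  qed
  have AF: "A m n \<in> sets (F (e m))" for m n
  proof (induction n arbitrary: m)
    case 0
    then show ?case using space_in_F[of "e m"] e(2)[of m] by (simp add: A_def)
  next
    case (Suc n)
    have "A (Suc m) n \<in> sets (F (e m))"
      using Suc filtration[of "e (Suc m)" "e m"] e(1)[of m] e(2)[of "Suc m"] by auto
    then show ?case unfolding step using TF[of m] by auto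
  qed
  have Am: "A m n \<in> events" for m n using AF e(2)[of m] sets_F[of "e m"] by auto
  have Tm: "T k \<in> events" for k using TF e(2)[of k] sets_F[of "e k"] by auto
  have bound: "prob (A (Suc m) n - T m) \<le> (1 - \<kappa>) * prob (A (Suc m) n)" for m n
  proof -
    have "\<kappa> * prob (A (Suc m) n) \<le> prob (A (Suc m) n \<inter> T m)"
      unfolding T_def using e(1)[of m] e(2)[of "Suc m"] g[of _ m] AF by (intro \<kappa>(2)) auto
    moreover have "prob (A (Suc m) n - T m) = prob (A (Suc m) n) - prob (A (Suc m) n \<inter> T m)"
      using Am Tm by (intro finite_measure_Diff')
    ultimately show ?thesis by (simp add: algebra_simps)
  qed
  have \<kappa>1: "\<kappa> \<le> 1"
  proof -
    have "prob (A 1 0) = 1" by (simp add: A_def prob_space)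
    then show ?thesis using order_trans[OF measure_nonneg bound[of 0 0]] by simp
  qed
  have pow: "prob (A m n) \<le> (1 - \<kappa>) ^ n" for m n
  proof (induction n arbitrary: m)
    case (Suc n)
    have "prob (A m (Suc n)) \<le> (1 - \<kappa>) * prob (A (Suc m) n)" unfolding step by (rule bound)
    also have "\<dots> \<le> (1 - \<kappa>) * (1 - \<kappa>) ^ n" using Suc \<kappa>1 by (intro mult_left_mono) auto
    finally show ?case by simp
  qed simp
  have "AE \<omega> in M. \<exists>k\<ge>m. \<omega> \<in> T k" for m
  proof -
    define Z where "Z = {\<omega> \<in> space M. \<forall>k\<in>{m..}. \<omega> \<notin> T k}"
    have Zm: "Z \<in> events"
    proof -
      have "Z = space M - (\<Union>k\<in>{m..}. T k)" by (auto simp: Z_def)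
      then show ?thesis using Tm by auto
    qed
    have "prob Z \<le> (1 - \<kappa>) ^ n" for n
    proof -
      have "prob Z \<le> prob (A m n)" using Am by (intro finite_measure_mono) (auto simp: Z_def A_def)
      then show ?thesis using pow[of m n] by simp
    qed
    moreover have "(\<lambda>n. (1 - \<kappa>) ^ n) \<longlonglongrightarrow> 0" using \<kappa> \<kappa>1 by (intro LIMSEQ_power_zero) auto
    ultimately have "prob Z \<le> 0" by (intro LIMSEQ_le_const) auto
    then have "prob Z = 0" by (simp add: measure_le_0_iff)
    then have "AE \<omega> in M. \<omega> \<notin> Z" using Zm prob_eq_0 by blast
    with AE_space show ?thesis by eventually_elim (auto simp: Z_def)
  qed
  then have "AE \<omega> in M. \<forall>m. \<exists>k\<ge>m. \<omega> \<in> T k" by (simp add: AE_all_countable)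
  then show ?thesis by (simp add: T_def)
qed

section \<open>Recurrence of rescaled Brownian paths\<close>

text \<open>The path \<open>f\<close> is replaced by a polynomial \<open>g\<close>, which is Lipschitz. At infinitely many scales
\<open>e k\<close> the Brownian path tracks the rescaled \<open>g\<close> from time \<open>e (Suc k)\<close> on, and before that time
both are small at scale \<open>e k\<close>.\<close>

theorem rescaled_paths_recurrent:
  assumes f: "continuous_on {0..1} f" "f 0 = 0" and \<eta>: "\<eta> > 0"
  shows "AE \<omega> in M. \<forall>r>0. \<exists>\<epsilon>. 0 < \<epsilon> \<and> \<epsilon> < r \<and>
    (\<forall>s\<in>{0..1}. norm (B (\<epsilon> * s) \<omega> /\<^sub>R sqrt \<epsilon> - f s) \<le> \<eta>)"
proof -
  define n where "n = real CARD('n)"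
  have n: "n \<ge> 1" by (simp add: n_def Suc_leI)
  \<comment> \<open>The deviation is at most \<open>3 * d\<close> in each of the \<open>n\<close> coordinates, and \<open>g\<close> is within \<open>2 * d\<close> of \<open>f\<close>.\<close>
  define d where "d = \<eta> / (3 * n + 2)"
  have d: "d > 0" "3 * n * d + 2 * d = \<eta>"
  proof -
    show "d > 0" using \<eta> n by (simp add: d_def)
    have "(3 * n + 2) * d = \<eta>" using n by (simp add: d_def)
    then show "3 * n * d + 2 * d = \<eta>" by (simp add: algebra_simps)
  qed
  obtain g0 where g0: "polynomial_function g0" "\<And>s. s \<in> {0..1} \<Longrightarrow> norm (f s - g0 s) < d"
    using Stone_Weierstrass_polynomial_function[OF _ f(1) d(1)] by auto
  define g where "g s = g0 s - g0 0" for s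
  have g00: "g 0 = 0" by (simp add: g_def)
  have fg: "norm (g s - f s) \<le> 2 * d" if "s \<in> {0..1}" for s
  proof -
    have "g s - f s = (f 0 - g0 0) - (f s - g0 s)" by (simp add: g_def f(2))
    also have "norm \<dots> \<le> norm (f 0 - g0 0) + norm (f s - g0 s)" by (rule norm_triangle_ineq4)
    finally show ?thesis using g0(2)[of 0] g0(2)[OF that] by simp
  qed
  obtain L where L: "L \<ge> 0" "\<And>s t. s \<in> {0..1} \<Longrightarrow> t \<in> {0..1} \<Longrightarrow> norm (g0 t - g0 s) \<le> L * \<bar>t - s\<bar>"
    using polynomial_function_lipschitz[OF g0(1), of 0 1] by blast
  have gL: "\<bar>g t $ i - g s $ i\<bar> \<le> L * \<bar>t - s\<bar>" if "s \<in> {0..1}" "t \<in> {0..1}" for s t i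
    using L(2)[OF that] component_le_norm_cart[of "g0 t - g0 s" i] by (simp add: g_def)
  \<comment> \<open>The scales decrease so fast that the ratios of consecutive ones are summable.\<close>
  define e where "e k = 1 / (fact (Suc k) :: real)\<^sup>2" for k
  have e_pos: "e k > 0" for k by (simp add: e_def)
  have e_Suc: "e (Suc k) = e k * (1 / real (k + 2) ^ 2)" for k
    unfolding e_def fact_Suc[of "Suc k"] by (simp add: power_mult_distrib add.commute del: fact_Suc)
  have e_decreasing: "e (Suc k) < e k" for k
  proof -
    have "1 < real (k + 2) ^ 2" by (intro one_less_power) auto
    then have "1 / real (k + 2) ^ 2 < 1" by (simp add: divide_less_eq)
    from mult_strict_left_mono[OF this e_pos[of k]] show ?thesis unfolding e_Suc by simp
  qed
  have e_lim: "e \<longlonglongrightarrow> 0"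
  proof (rule tendsto_sandwich[of "\<lambda>_. 0" _ _ "\<lambda>k. 1 / real (Suc k)"])
    show "\<forall>\<^sub>F k in sequentially. e k \<le> 1 / real (Suc k)"
    proof (intro always_eventually allI)
      fix k
      have "real (Suc k) \<le> fact (Suc k)"
        using fact_ge_self[of "Suc k"] by (metis of_nat_fact of_nat_le_iff)
      moreover have "(1::real) \<le> fact (Suc k)" by (rule fact_ge_1)
      ultimately have "1 * real (Suc k) \<le> fact (Suc k) * fact (Suc k)" by (intro mult_mono) auto
      then show "e k \<le> 1 / real (Suc k)"
        unfolding e_def power2_eq_square
        by (intro divide_left_mono) auto
    qed
    show "(\<lambda>k. 1 / real (Suc k)) \<longlonglongrightarrow> 0" using LIMSEQ_inverse_real_of_nat by (simp add: inverse_eq_divide)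
  qed (auto intro!: always_eventually less_imp_le e_pos)
  define G where "G k t = sqrt (e k) *\<^sub>R g (t / e k)" for k t
  have G: "\<bar>G k t $ i - G k r $ i\<bar> \<le> L * \<bar>t - r\<bar> / sqrt (e k)"
    if "r \<in> {0..e k}" "t \<in> {0..e k}" for k r t i
  proof -
    have "\<bar>G k t $ i - G k r $ i\<bar> = sqrt (e k) * \<bar>g (t / e k) $ i - g (r / e k) $ i\<bar>"
      using e_pos[of k] by (simp add: G_def abs_mult flip: right_diff_distrib)
    also have "\<dots> \<le> sqrt (e k) * (L * \<bar>t / e k - r / e k\<bar>)"
      using that e_pos[of k] by (intro mult_left_mono gL) auto
    also have "\<bar>t / e k - r / e k\<bar> = \<bar>t - r\<bar> / e k"
      using e_pos[of k] by (simp flip: diff_divide_distrib)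
    also have "sqrt (e k) * (L * (\<bar>t - r\<bar> / e k)) = L * \<bar>t - r\<bar> * (sqrt (e k) / e k)" by simp
    also have "sqrt (e k) / e k = 1 / sqrt (e k)"
      using e_pos[of k] by (simp add: field_simps)
    finally show ?thesis by simp
  qed
  have often: "AE \<omega> in M. \<forall>m. \<exists>k\<ge>m. \<omega> \<in> tracks (e (Suc k)) (e k) (G k) (d * sqrt (e k - e (Suc k)))"
  proof (rule tracking_infinitely_often[of e L d G, OF e_decreasing e_pos L(1) d(1)])
    fix k r t i assume rt: "r \<in> {e (Suc k)..e k}" "t \<in> {e (Suc k)..e k}"
    have "\<bar>G k t $ i - G k r $ i\<bar> \<le> L * \<bar>t - r\<bar> / sqrt (e k)"
      using rt e_pos[of "Suc k"] by (intro G) auto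
    also have "\<dots> \<le> L * \<bar>t - r\<bar> / sqrt (e k - e (Suc k))"
      using L(1) e_decreasing[of k] e_pos[of "Suc k"] by (intro divide_left_mono) auto
    finally show "\<bar>G k t $ i - G k r $ i\<bar> \<le> L * \<bar>t - r\<bar> / sqrt (e k - e (Suc k))" .
  qed
  \<comment> \<open>The initial piece, up to time \<open>e (Suc k)\<close>, is not small at scale \<open>e k\<close>.\<close>
  define S where "S k = {\<omega> \<in> space M. \<exists>t\<in>\<rat> \<inter> {0..e (Suc k)}. \<exists>i. \<bar>B t \<omega> $ i - B 0 \<omega> $ i\<bar> > d * sqrt (e k)}" for k
  have SF: "S k \<in> events" and Sp: "prob (S k) \<le> 8 * n / d\<^sup>2 * (1 / real (k + 2) ^ 2)" for k
  proof -
    have 1: "0 \<le> e (Suc k)" "d * sqrt (e k) > 0" "countable (\<rat> \<inter> {0..e (Suc k)})"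
      using e_pos[of "Suc k"] e_pos[of k] d(1) by (auto intro!: countable_Int1 countable_rat)
    note mi = maximal_inequality_vec[OF order_refl 1(1) 1(3) _ space_in_F[OF order_refl] 1(2)]
    show "S k \<in> events" unfolding S_def using e_pos[of "Suc k"] by (intro sets_F[of "e (Suc k)"] mi) auto
    have "prob (S k) = prob (space M \<inter> S k)" by (intro arg_cong[where f = prob]) (auto simp: S_def)
    also have "\<dots> \<le> 8 * n * (e (Suc k) - 0) / (d * sqrt (e k))\<^sup>2 * prob (space M)"
      unfolding S_def n_def by (intro mi) auto
    also have "\<dots> = 8 * n / d\<^sup>2 * (1 / real (k + 2) ^ 2)"
      using e_pos[of k] d(1) by (simp add: e_Suc power_mult_distrib prob_space del: of_nat_add)
    finally show "prob (S k) \<le> 8 * n / d\<^sup>2 * (1 / real (k + 2) ^ 2)" .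
  qed
  have "summable (\<lambda>k. 8 * n / d\<^sup>2 * (1 / real (k + 2) ^ 2))"
  proof -
    have "summable (\<lambda>k. inverse ((real (k + 2))\<^sup>2))"
      using inverse_power_summable[of 2, where 'a = real] summable_iff_shift[of "\<lambda>k. inverse ((real k)\<^sup>2)" 2] by simp
    then show ?thesis by (intro summable_mult) (simp add: inverse_eq_divide)
  qed
  then have "summable (\<lambda>k. prob (S k))"
    by (rule summable_comparison_test[rotated]) (use Sp in auto)
  then have rare: "AE \<omega> in M. eventually (\<lambda>k. \<omega> \<in> space M - S k) sequentially"
    using SF by (intro borel_cantelli_AE1) (auto simp: less_top[symmetric])
  have B0: "AE \<omega> in M. B 0 \<omega> = 0" and Bc: "AE \<omega> in M. continuous_on {0..} (\<lambda>t. B t \<omega>)"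
    using standard by (auto simp: standard_brownian_motion_def)
  from often rare B0 Bc show ?thesis
  proof eventually_elim
    case (elim \<omega>)
    note often = elim(1) and rare = elim(2) and B0 = elim(3) and Bc = elim(4)
    show ?case
    proof (intro allI impI)
      fix r :: real assume r: "r > 0"
      have lim2: "(\<lambda>k. L / real (k + 2)) \<longlonglongrightarrow> 0"
        using LIMSEQ_ignore_initial_segment[OF lim_const_over_n[of L], of 2] by simp
      have "eventually (\<lambda>k. \<omega> \<in> space M - S k \<and> e k < r \<and> L / real (k + 2) < d) sequentially"
        using rare order_tendstoD(2)[OF e_lim r] order_tendstoD(2)[OF lim2 d(1)] by eventually_elim auto
      then obtain m where m: "\<And>k. k \<ge> m \<Longrightarrow> \<omega> \<in> space M - S k \<and> e k < r \<and> L / real (k + 2) < d"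
        by (auto simp: eventually_sequentially)
      obtain k where k: "k \<ge> m" "\<omega> \<in> tracks (e (Suc k)) (e k) (G k) (d * sqrt (e k - e (Suc k)))"
        using often by blast
      define \<epsilon> where "\<epsilon> = e k"
      define \<rho> where "\<rho> = e (Suc k)"
      have \<epsilon>: "0 < \<epsilon>" "\<epsilon> < r" using e_pos m[OF k(1)] by (auto simp: \<epsilon>_def)
      have \<rho>: "0 < \<rho>" "\<rho> < \<epsilon>" using e_pos e_decreasing by (auto simp: \<epsilon>_def \<rho>_def)
      have cont: "continuous_on {a..b} (\<lambda>t. B t \<omega> $ i)" if "0 \<le> a" for a b i
        using that by (intro continuous_on_component continuous_on_subset[OF Bc]) auto
      have gcont: "continuous_on S g" for S
        unfolding g_def by (intro continuous_intros continuous_on_polymonial_function g0(1))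
      have Gcont: "continuous_on S (G k)" for S
        unfolding G_def using e_pos[of k]
        by (intro continuous_intros continuous_on_compose2[OF gcont[of UNIV]]) auto
      have first: "\<bar>B t \<omega> $ i - G k t $ i\<bar> \<le> 2 * d * sqrt \<epsilon>" if t: "t \<in> {0..\<rho>}" for t i
      proof -
        have "\<bar>B t \<omega> $ i\<bar> \<le> d * sqrt \<epsilon>"
        proof (rule abs_le_from_rationals[OF cont \<rho>(1) _ t])
          fix t assume t: "t \<in> \<rat> \<inter> {0..\<rho>}"
          have "\<omega> \<notin> S k" "\<omega> \<in> space M" using m[OF k(1)] by auto
          then have "\<not> \<bar>B t \<omega> $ i - B 0 \<omega> $ i\<bar> > d * sqrt \<epsilon>"
            using t unfolding S_def \<rho>_def[symmetric] \<epsilon>_def[symmetric] by blast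
          then show "\<bar>B t \<omega> $ i\<bar> \<le> d * sqrt \<epsilon>" by (simp add: B0)
        qed simp
        moreover have "\<bar>G k t $ i\<bar> \<le> d * sqrt \<epsilon>"
        proof -
          have "\<bar>G k t $ i - G k 0 $ i\<bar> \<le> L * \<bar>t - 0\<bar> / sqrt (e k)"
            using t \<rho> e_pos[of k] by (intro G) (auto simp: \<epsilon>_def)
          also have "\<dots> \<le> L * \<rho> / sqrt \<epsilon>"
            unfolding \<epsilon>_def[symmetric] using t L(1) \<epsilon> by (intro divide_right_mono mult_left_mono) auto
          also have "\<rho> = \<epsilon> * (1 / real (k + 2) ^ 2)" unfolding \<rho>_def \<epsilon>_def by (rule e_Suc)
          also have "L * (\<epsilon> * (1 / real (k + 2) ^ 2)) / sqrt \<epsilon> = (L / real (k + 2)) * (1 / real (k + 2)) * (\<epsilon> / sqrt \<epsilon>)"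
            by (simp add: power2_eq_square)
          also have "\<epsilon> / sqrt \<epsilon> = sqrt \<epsilon>" using \<epsilon> by (simp add: real_div_sqrt)
          also have "(L / real (k + 2)) * (1 / real (k + 2)) * sqrt \<epsilon> \<le> (d * 1) * sqrt \<epsilon>"
            using m[OF k(1)] L(1) d(1) \<epsilon> by (intro mult_right_mono mult_mono) auto
          finally show ?thesis by (simp add: G_def g00)
        qed
        ultimately show ?thesis by simp
      qed
      have second: "\<bar>B t \<omega> $ i - G k t $ i\<bar> \<le> 3 * d * sqrt \<epsilon>" if t: "t \<in> {\<rho>..\<epsilon>}" for t i
      proof -
        have "\<bar>deviation (G k) \<rho> t \<omega> i\<bar> \<le> d * sqrt (\<epsilon> - \<rho>)"
        proof (rule abs_le_from_rationals[OF _ \<rho>(2) _ t])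
          show "continuous_on {\<rho>..\<epsilon>} (\<lambda>t. deviation (G k) \<rho> t \<omega> i)"
            unfolding deviation_def using \<rho>
            by (intro continuous_intros cont continuous_on_component Gcont) auto
          show "\<bar>deviation (G k) \<rho> t \<omega> i\<bar> \<le> d * sqrt (\<epsilon> - \<rho>)" if "t \<in> \<rat> \<inter> {\<rho>..\<epsilon>}" for t
            using k(2) that by (auto simp: tracks_def \<epsilon>_def \<rho>_def)
        qed
        also have "\<dots> \<le> d * sqrt \<epsilon>" using d(1) \<rho> by (intro mult_left_mono) auto
        finally have "\<bar>deviation (G k) \<rho> t \<omega> i\<bar> \<le> d * sqrt \<epsilon>" .
        then show ?thesis using first[of \<rho> i] \<rho> by (simp add: deviation_def)
      qed
      have all: "\<bar>B t \<omega> $ i - G k t $ i\<bar> \<le> 3 * d * sqrt \<epsilon>" if t: "t \<in> {0..\<epsilon>}" for t i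
      proof (cases "t \<le> \<rho>")
        case True
        have "2 * d * sqrt \<epsilon> \<le> 3 * d * sqrt \<epsilon>" using d(1) \<epsilon> by (intro mult_right_mono) auto
        then show ?thesis using first[of t i] t True by auto
      qed (use second t in auto)
      have "norm (B (\<epsilon> * s) \<omega> /\<^sub>R sqrt \<epsilon> - f s) \<le> \<eta>" if s: "s \<in> {0..1}" for s
      proof -
        have es: "\<epsilon> * s \<in> {0..\<epsilon>}" using s \<epsilon> by (auto intro: mult_left_le)
        have Gs: "G k (\<epsilon> * s) = sqrt \<epsilon> *\<^sub>R g s" using \<epsilon> by (simp add: G_def \<epsilon>_def[symmetric])
        have "norm (B (\<epsilon> * s) \<omega> /\<^sub>R sqrt \<epsilon> - g s) \<le> (\<Sum>i\<in>UNIV. \<bar>(B (\<epsilon> * s) \<omega> /\<^sub>R sqrt \<epsilon> - g s) $ i\<bar>)"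
          by (rule norm_le_l1_cart)
        also have "\<dots> \<le> (\<Sum>i\<in>(UNIV :: 'n set). 3 * d)"
        proof (rule sum_mono)
          fix i
          have "(B (\<epsilon> * s) \<omega> /\<^sub>R sqrt \<epsilon> - g s) $ i = (B (\<epsilon> * s) \<omega> $ i - G k (\<epsilon> * s) $ i) / sqrt \<epsilon>"
            unfolding Gs using \<epsilon> by (simp add: field_simps)
          then show "\<bar>(B (\<epsilon> * s) \<omega> /\<^sub>R sqrt \<epsilon> - g s) $ i\<bar> \<le> 3 * d"
            using all[OF es, of i] \<epsilon> by (simp add: field_simps)
        qed
        also have "\<dots> = 3 * n * d" by (simp add: n_def)
        finally have 1: "norm (B (\<epsilon> * s) \<omega> /\<^sub>R sqrt \<epsilon> - g s) \<le> 3 * n * d" .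
        have "norm (B (\<epsilon> * s) \<omega> /\<^sub>R sqrt \<epsilon> - f s) \<le> norm (B (\<epsilon> * s) \<omega> /\<^sub>R sqrt \<epsilon> - g s) + norm (g s - f s)"
          using norm_triangle_ineq[of "B (\<epsilon> * s) \<omega> /\<^sub>R sqrt \<epsilon> - g s" "g s - f s"] by simp
        then show ?thesis using 1 fg[OF s] d(2) by linarith
      qed
      with \<epsilon> show "\<exists>\<epsilon>. 0 < \<epsilon> \<and> \<epsilon> < r \<and> (\<forall>s\<in>{0..1}. norm (B (\<epsilon> * s) \<omega> /\<^sub>R sqrt \<epsilon> - f s) \<le> \<eta>)" by blast
    qed
  qed
qed

end

section \<open>The rescaled drift\<close>

text \<open>The bound \<open>C\<close> is carried along in the induction for the sake of products.\<close>

lemma real_polynomial_function_lipschitz_on_bounded: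
  fixes f :: "'a::real_normed_vector \<Rightarrow> real"
  assumes "real_polynomial_function f" "bounded S"
  shows "\<exists>C K. C \<ge> 0 \<and> K \<ge> 0 \<and> (\<forall>x\<in>S. \<bar>f x\<bar> \<le> C \<and> (\<forall>y\<in>S. \<bar>f x - f y\<bar> \<le> K * norm (x - y)))"
  using assms(1)
proof (induction f rule: real_polynomial_function.induct)
  case (linear f)
  obtain b where b: "b > 0" "\<And>x. x \<in> S \<Longrightarrow> norm x \<le> b" using assms(2) bounded_pos by metis
  obtain K where K: "K > 0" "\<And>x. norm (f x) \<le> norm x * K"
    using bounded_linear.pos_bounded[OF linear] by blast
  have "\<bar>f x\<bar> \<le> b * K" if "x \<in> S" for x
    using order_trans[OF K(2)[of x] mult_right_mono[OF b(2)[OF that], of K]] K(1) by simp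
  moreover have "\<bar>f x - f y\<bar> \<le> K * norm (x - y)" for x y
    using K(2)[of "x - y"] by (simp add: bounded_linear.linear[OF linear] linear_diff mult.commute)
  ultimately show ?case using b(1) K(1) by (intro exI[of _ "b * K"] exI[of _ K]) auto
next
  case (const c)
  show ?case by (intro exI[of _ "\<bar>c\<bar>"] exI[of _ 0]) auto
next
  case (add f g)
  then obtain C K C' K' where *: "C \<ge> 0" "K \<ge> 0" "C' \<ge> 0" "K' \<ge> 0"
    "\<forall>x\<in>S. \<bar>f x\<bar> \<le> C \<and> (\<forall>y\<in>S. \<bar>f x - f y\<bar> \<le> K * norm (x - y))"
    "\<forall>x\<in>S. \<bar>g x\<bar> \<le> C' \<and> (\<forall>y\<in>S. \<bar>g x - g y\<bar> \<le> K' * norm (x - y))" by blast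
  have "\<bar>f x + g x\<bar> \<le> C + C'" if "x \<in> S" for x
    using *(5)[rule_format, OF that] *(6)[rule_format, OF that] by linarith
  moreover have "\<bar>f x + g x - (f y + g y)\<bar> \<le> (K + K') * norm (x - y)" if "x \<in> S" "y \<in> S" for x y
    unfolding distrib_right
    using *(5)[rule_format, OF that(1)] *(6)[rule_format, OF that(1)] that(2) by fastforce
  ultimately show ?case using *(1-4) by (intro exI[of _ "C + C'"] exI[of _ "K + K'"]) auto
next
  case (mult f g)
  then obtain C K C' K' where *: "C \<ge> 0" "K \<ge> 0" "C' \<ge> 0" "K' \<ge> 0"
    "\<forall>x\<in>S. \<bar>f x\<bar> \<le> C \<and> (\<forall>y\<in>S. \<bar>f x - f y\<bar> \<le> K * norm (x - y))"
    "\<forall>x\<in>S. \<bar>g x\<bar> \<le> C' \<and> (\<forall>y\<in>S. \<bar>g x - g y\<bar> \<le> K' * norm (x - y))" by blast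
  have "\<bar>f x * g x\<bar> \<le> C * C'" if "x \<in> S" for x
    using * that by (auto simp: abs_mult intro!: mult_mono)
  moreover have "\<bar>f x * g x - f y * g y\<bar> \<le> (C * K' + K * C') * norm (x - y)" if xy: "x \<in> S" "y \<in> S" for x y
  proof -
    have "f x * g x - f y * g y = f x * (g x - g y) + (f x - f y) * g y" by (simp add: algebra_simps)
    then have "\<bar>f x * g x - f y * g y\<bar> \<le> \<bar>f x\<bar> * \<bar>g x - g y\<bar> + \<bar>f x - f y\<bar> * \<bar>g y\<bar>"
      by (metis abs_mult abs_triangle_ineq)
    also have "\<dots> \<le> C * (K' * norm (x - y)) + (K * norm (x - y)) * C'"
      using * xy by (intro add_mono mult_mono) auto
    finally show ?thesis by (simp add: algebra_simps)
  qed
  ultimately show ?case using *(1-4) by (intro exI[of _ "C * C'"] exI[of _ "C * K' + K * C'"]) auto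
qed

lemma real_polynomial_function_poly_fun: "real_polynomial_function (poly_fun p)"
  unfolding poly_fun_def[abs_def]
  by (rule real_polynomial_function_sum[OF finite_keys], rule real_polynomial_function.intros(4),
      rule real_polynomial_function.intros(2), rule real_polynomial_function_prod[OF finite],
      rule real_polynomial_function_power, rule real_polynomial_function.intros(1),
      rule bounded_linear_vec_nth)

lemma continuous_on_vector_field: "continuous_on S (vector_field Q)"
  unfolding vector_field_def[abs_def]
  using real_polynomial_function_poly_fun
  by (intro continuous_on_vec_lambda continuous_on_polymonial_function) (simp add: real_polynomial_function_eq)

lemma vector_field_lipschitz_on_bounded:
  fixes Q :: "'n::finite rpoly ^ 'n"
  assumes "bounded S"
  obtains K where "K \<ge> 0" "\<And>x y. x \<in> S \<Longrightarrow> y \<in> S \<Longrightarrow>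
    norm (vector_field Q x - vector_field Q y) \<le> K * norm (x - y)"
proof -
  have "\<exists>K\<ge>0. \<forall>x\<in>S. \<forall>y\<in>S. \<bar>poly_fun (Q $ i) x - poly_fun (Q $ i) y\<bar> \<le> K * norm (x - y)" for i
    using real_polynomial_function_lipschitz_on_bounded[OF real_polynomial_function_poly_fun[of "Q $ i"] assms] by blast
  then obtain K where K: "\<And>i. K i \<ge> 0"
    "\<And>i x y. x \<in> S \<Longrightarrow> y \<in> S \<Longrightarrow> \<bar>poly_fun (Q $ i) x - poly_fun (Q $ i) y\<bar> \<le> K i * norm (x - y)"
    by metis
  show thesis
  proof (rule that[of "\<Sum>i\<in>UNIV. K i"])
    show "0 \<le> sum K UNIV" using K(1) by (intro sum_nonneg) auto
    fix x y assume xy: "x \<in> S" "y \<in> S"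
    have "norm (vector_field Q x - vector_field Q y) \<le> (\<Sum>i\<in>UNIV. \<bar>(vector_field Q x - vector_field Q y) $ i\<bar>)"
      by (rule norm_le_l1_cart)
    also have "\<dots> \<le> (\<Sum>i\<in>UNIV. K i * norm (x - y))"
      using K(2)[OF xy] by (intro sum_mono) (simp add: vector_field_def)
    finally show "norm (vector_field Q x - vector_field Q y) \<le> sum K UNIV * norm (x - y)"
      by (simp add: sum_distrib_right)
  qed
qed

text \<open>The drift of the rescaled process; \<open>scaled_field_eq\<close> relates it to \<open>P\<close>.\<close>

definition scaled_field :: "'n::finite rpoly ^ 'n \<Rightarrow> real ^ 'n \<Rightarrow> real \<Rightarrow> real ^ 'n \<Rightarrow> real ^ 'n" where
  "scaled_field P \<sigma> \<epsilon> x = (\<chi> j. \<Sum>\<mu>\<in>Poly_Mapping.keys (P $ j).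
    \<epsilon> powr excess P \<sigma> j \<mu> * (Poly_Mapping.lookup (P $ j) \<mu> * (\<Prod>i\<in>UNIV. (x $ i) ^ Poly_Mapping.lookup \<mu> i)))"

lemma scaled_field_eq:
  assumes "\<epsilon> > 0"
  shows "scaled_field P \<sigma> \<epsilon> x $ j =
    \<epsilon> * poly_fun (P $ j) (\<chi> i. \<epsilon> powr final_weight P \<sigma> i * x $ i) / \<epsilon> powr final_weight P \<sigma> j"
proof -
  let ?w = "final_weight P \<sigma>"
  have "\<epsilon> powr excess P \<sigma> j \<mu> * (Poly_Mapping.lookup (P $ j) \<mu> * (\<Prod>i\<in>UNIV. (x $ i) ^ Poly_Mapping.lookup \<mu> i)) =
    \<epsilon> / \<epsilon> powr ?w j * (Poly_Mapping.lookup (P $ j) \<mu> * (\<Prod>i\<in>UNIV. (\<epsilon> powr ?w i * x $ i) ^ Poly_Mapping.lookup \<mu> i))" for \<mu>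
  proof -
    have "(\<epsilon> powr ?w i) ^ Poly_Mapping.lookup \<mu> i = \<epsilon> powr (real (Poly_Mapping.lookup \<mu> i) * ?w i)" for i
      using assms by (simp add: powr_realpow[symmetric] powr_powr mult.commute)
    then have "(\<Prod>i\<in>UNIV. (\<epsilon> powr ?w i * x $ i) ^ Poly_Mapping.lookup \<mu> i) =
        \<epsilon> powr (\<Sum>i\<in>UNIV. real (Poly_Mapping.lookup \<mu> i) * ?w i) * (\<Prod>i\<in>UNIV. (x $ i) ^ Poly_Mapping.lookup \<mu> i)"
      using assms by (simp add: power_mult_distrib prod.distrib powr_sum)
    moreover have "\<epsilon> powr excess P \<sigma> j \<mu> =
        \<epsilon> / \<epsilon> powr ?w j * \<epsilon> powr (\<Sum>i\<in>UNIV. real (Poly_Mapping.lookup \<mu> i) * ?w i)"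
      using assms by (simp add: excess_def powr_add powr_diff)
    ultimately show ?thesis by simp
  qed
  then show ?thesis
    by (simp add: scaled_field_def poly_fun_def sum_distrib_left sum_divide_distrib)
qed

lemma continuous_on_scaled_field: "continuous_on S (scaled_field P \<sigma> \<epsilon>)"
  unfolding scaled_field_def[abs_def]
  by (intro continuous_on_vec_lambda continuous_intros)

text \<open>The terms of excess zero add up to the dominant part, and all others have a positive power of \<open>\<epsilon>\<close>.\<close>

lemma scaled_field_converges:
  fixes P :: "'n::finite rpoly ^ 'n"
  assumes np: "noise_propagating P \<sigma>" and \<theta>: "\<theta> > 0"
  obtains \<epsilon>\<^sub>1 where "\<epsilon>\<^sub>1 > 0" "\<And>\<epsilon> x. 0 < \<epsilon> \<Longrightarrow> \<epsilon> < \<epsilon>\<^sub>1 \<Longrightarrow> norm x \<le> R \<Longrightarrow>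
    norm (scaled_field P \<sigma> \<epsilon> x - vector_field (dominant_part P \<sigma>) x) \<le> \<theta>"
proof -
  define N where "N j = {\<mu> \<in> Poly_Mapping.keys (P $ j). excess P \<sigma> j \<mu> > 0}" for j
  define mon where "mon \<mu> x = (\<Prod>i\<in>UNIV. (x $ i) ^ Poly_Mapping.lookup \<mu> i)" for \<mu> and x :: "real ^ 'n"
  define C where "C \<mu> = (\<Prod>i\<in>UNIV. \<bar>R\<bar> ^ Poly_Mapping.lookup \<mu> (i :: 'n))" for \<mu>
  define E where "E \<epsilon> = (\<Sum>j\<in>UNIV. \<Sum>\<mu>\<in>N j. \<epsilon> powr excess P \<sigma> j \<mu> * (\<bar>Poly_Mapping.lookup (P $ j) \<mu>\<bar> * C \<mu>))" for \<epsilon>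
  have fin: "finite (N j)" for j by (simp add: N_def)
  have "(E \<longlongrightarrow> (\<Sum>j\<in>(UNIV :: 'n set). \<Sum>\<mu>\<in>N j. 0)) (at_right 0)"
    unfolding E_def
  proof (intro tendsto_sum tendsto_mult_left_zero tendsto_zero_powrI[where b = "excess P \<sigma> _ _"])
    show "\<forall>\<^sub>F x in at_right (0::real). 0 \<le> x"
      by (auto simp: eventually_at_right_less eventually_at_filter)
  qed (auto simp: N_def)
  then have "\<forall>\<^sub>F \<epsilon> in at_right 0. E \<epsilon> < \<theta>" using \<theta> by (auto dest: order_tendstoD(2))
  then obtain \<epsilon>1 where \<epsilon>1: "\<epsilon>1 > 0" "\<And>\<epsilon>. 0 < \<epsilon> \<Longrightarrow> \<epsilon> < \<epsilon>1 \<Longrightarrow> E \<epsilon> < \<theta>"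
    by (auto simp: eventually_at_right_field)
  show thesis
  proof (rule that[OF \<epsilon>1(1)])
    fix \<epsilon> and x :: "real ^ 'n" assume \<epsilon>: "0 < \<epsilon>" "\<epsilon> < \<epsilon>1" and x: "norm x \<le> R"
    have mon: "\<bar>mon \<mu> x\<bar> \<le> C \<mu>" for \<mu>
    proof -
      have "\<bar>x $ i\<bar> \<le> \<bar>R\<bar>" for i using component_le_norm_cart[of x i] x by linarith
      then show ?thesis unfolding mon_def C_def abs_prod
        by (intro prod_mono) (auto simp: power_abs intro: power_mono)
    qed
    have comp: "\<bar>(scaled_field P \<sigma> \<epsilon> x - vector_field (dominant_part P \<sigma>) x) $ j\<bar>
        \<le> (\<Sum>\<mu>\<in>N j. \<epsilon> powr excess P \<sigma> j \<mu> * (\<bar>Poly_Mapping.lookup (P $ j) \<mu>\<bar> * C \<mu>))" for j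
    proof -
      let ?Z = "{\<mu>. \<mu> \<in> Poly_Mapping.keys (P $ j) \<and> excess P \<sigma> j \<mu> = 0}"
      let ?t = "\<lambda>\<mu>. \<epsilon> powr excess P \<sigma> j \<mu> * (Poly_Mapping.lookup (P $ j) \<mu> * mon \<mu> x)"
      have keys: "Poly_Mapping.keys (P $ j) = N j \<union> ?Z" "N j \<inter> ?Z = {}"
        using excess_nonneg[OF np, of _ j] by (force simp: N_def)+
      have "scaled_field P \<sigma> \<epsilon> x $ j = (\<Sum>\<mu>\<in>N j \<union> ?Z. ?t \<mu>)"
        by (simp add: scaled_field_def mon_def flip: keys(1))
      also have "\<dots> = (\<Sum>\<mu>\<in>N j. ?t \<mu>) + (\<Sum>\<mu>\<in>?Z. ?t \<mu>)"
        using keys(2) fin by (intro sum.union_disjoint) auto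
      also have "(\<Sum>\<mu>\<in>?Z. ?t \<mu>) = vector_field (dominant_part P \<sigma>) x $ j"
        using \<epsilon> by (simp add: vector_field_def poly_fun_dominant_part[OF np] mon_def)
      finally have "\<bar>(scaled_field P \<sigma> \<epsilon> x - vector_field (dominant_part P \<sigma>) x) $ j\<bar> = \<bar>\<Sum>\<mu>\<in>N j. ?t \<mu>\<bar>" by simp
      also have "\<dots> \<le> (\<Sum>\<mu>\<in>N j. \<bar>?t \<mu>\<bar>)" by (rule sum_abs)
      also have "\<dots> \<le> (\<Sum>\<mu>\<in>N j. \<epsilon> powr excess P \<sigma> j \<mu> * (\<bar>Poly_Mapping.lookup (P $ j) \<mu>\<bar> * C \<mu>))"
        using mon by (intro sum_mono) (auto simp: abs_mult intro!: mult_left_mono)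
      finally show ?thesis .
    qed
    have "norm (scaled_field P \<sigma> \<epsilon> x - vector_field (dominant_part P \<sigma>) x) \<le>
        (\<Sum>j\<in>UNIV. \<bar>(scaled_field P \<sigma> \<epsilon> x - vector_field (dominant_part P \<sigma>) x) $ j\<bar>)"
      by (rule norm_le_l1_cart)
    also have "\<dots> \<le> E \<epsilon>" unfolding E_def by (intro sum_mono comp)
    finally show "norm (scaled_field P \<sigma> \<epsilon> x - vector_field (dominant_part P \<sigma>) x) \<le> \<theta>"
      using \<epsilon>1(2)[OF \<epsilon>] by linarith
  qed
qed

section \<open>Stability of solutions\<close>

text \<open>A form of Gronwall's lemma whose integral inequality is available only as long as \<open>u\<close> has stayed below
\<open>r\<close>. At the first time at which \<open>u\<close> reaches \<open>C' * exp (K * s)\<close>, which is at most \<open>r\<close>, the inequality would force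
\<open>u\<close> to lie strictly below this value, as \<open>C < C'\<close>.\<close>

lemma gronwall_bootstrap:
  fixes u :: "real \<Rightarrow> real"
  assumes cont: "continuous_on {0..T} u" and C: "C < C'" "C' > 0" and K: "K \<ge> 0" and u0: "u 0 \<le> C"
    and r: "C' * exp (K * T) \<le> r"
    and step: "\<And>s. s \<in> {0..T} \<Longrightarrow> (\<And>q. q \<in> {0..s} \<Longrightarrow> u q \<le> r) \<Longrightarrow> u s \<le> C + K * integral {0..s} u"
    and s: "s \<in> {0..T}"
  shows "u s < r"
proof -
  let ?e = "\<lambda>q. C' * exp (K * q)"
  have er: "?e q \<le> r" if "q \<in> {0..T}" for q
  proof -
    have "K * q \<le> K * T" using that K by (intro mult_left_mono) auto
    then have "?e q \<le> ?e T" using C(2) by simp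
    then show ?thesis using r by linarith
  qed
  have "u s < ?e s"
  proof (rule ccontr)
    assume "\<not> u s < ?e s"
    define Z where "Z = {q \<in> {0..T}. u q - ?e q \<in> {0..}}"
    have "closed ({0..T} \<inter> (\<lambda>q. u q - ?e q) -` {0..})"
      by (intro continuous_closed_preimage continuous_intros cont)
    moreover have "{0..T} \<inter> (\<lambda>q. u q - ?e q) -` {0..} = Z" by (auto simp: Z_def)
    ultimately have "closed Z" by simp
    then have "compact Z" by (intro compact_eq_bounded_closed[THEN iffD2]) (auto simp: Z_def intro: bounded_subset[OF bounded_closed_interval[of 0 T]])
    moreover have "Z \<noteq> {}" using s \<open>\<not> u s < ?e s\<close> by (auto simp: Z_def)
    ultimately obtain p where p: "p \<in> Z" "\<And>q. q \<in> Z \<Longrightarrow> p \<le> q" using compact_attains_inf by metis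
    have pT: "p \<in> {0..T}" "u p \<ge> ?e p" using p(1) by (auto simp: Z_def)
    have "\<exists>q\<ge>0. q \<le> p \<and> u q - ?e q = 0"
    proof (rule IVT')
      show "u 0 - ?e 0 \<le> 0" using u0 C by simp
      show "continuous_on {0..p} (\<lambda>q. u q - ?e q)"
        using pT by (intro continuous_intros continuous_on_subset[OF cont]) auto
    qed (use pT in auto)
    then obtain q where q: "0 \<le> q" "q \<le> p" "u q = ?e q" by auto
    then have "q \<in> Z" using pT by (auto simp: Z_def)
    then have qp: "q = p" using p(2)[of q] q by simp
    have le: "u q' \<le> ?e q'" if "q' \<in> {0..p}" for q'
    proof (cases "q' = p")
      case False
      then have "q' \<notin> Z" using that p(2)[of q'] by auto
      then show ?thesis using that pT by (auto simp: Z_def)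
    qed (use q qp in auto)
    have up: "u p \<le> C + K * integral {0..p} u"
    proof (rule step[OF pT(1)])
      fix q' assume "q' \<in> {0..p}"
      then show "u q' \<le> r" using le[of q'] er[of q'] pT by auto
    qed
    have hi: "((\<lambda>q. K * ?e q) has_integral (?e p - ?e 0)) {0..p}"
      using pT by (intro fundamental_theorem_of_calculus)
        (auto simp: has_real_derivative_iff_has_vector_derivative[symmetric] intro!: derivative_eq_intros)
    have "?e 0 = C'" by simp
    with integral_unique[OF hi] have I: "integral {0..p} (\<lambda>q. K * ?e q) = ?e p - C'" by argo
    have "K * integral {0..p} u = integral {0..p} (\<lambda>q. K * u q)" by simp
    also have "\<dots> \<le> integral {0..p} (\<lambda>q. K * ?e q)"
    proof (rule integral_le)
      show "(\<lambda>q. K * u q) integrable_on {0..p}"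
        using pT by (intro integrable_continuous_real continuous_intros continuous_on_subset[OF cont]) auto
      show "(\<lambda>q. K * ?e q) integrable_on {0..p}"
        by (intro integrable_continuous_real continuous_intros)
      show "K * u q \<le> K * ?e q" if "q \<in> {0..p}" for q using le[OF that] K by (intro mult_left_mono)
    qed
    finally have "u p \<le> C + (?e p - C')" using up I by simp
    then show False using C pT(2) by simp
  qed
  then show ?thesis using er[OF s] by simp
qed

text \<open>The vector fields are compared on a ball of radius \<open>R + 1\<close> only; since \<open>r \<le> 1\<close>, the perturbed solution stays in
it as long as it is within \<open>r\<close> of \<open>\<phi>\<close>, and this is what \<open>gronwall_bootstrap\<close> provides for.\<close>

lemma perturbed_solution_close:
  fixes \<phi> X :: "real \<Rightarrow> 'a::euclidean_space"
  assumes \<phi>: "continuous_on {0..1} \<phi>" and X: "continuous_on {0..1} X"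
    and A: "\<And>S. continuous_on S A" and A': "\<And>S. continuous_on S A'"
    and \<phi>_eq: "\<And>s. s \<in> {0..1} \<Longrightarrow> \<phi> s = integral {0..s} (\<lambda>q. A (\<phi> q)) + a s"
    and X_eq: "\<And>s. s \<in> {0..1} \<Longrightarrow> X s = integral {0..s} (\<lambda>q. A' (X q)) + a' s"
    and R: "\<And>s. s \<in> {0..1} \<Longrightarrow> norm (\<phi> s) \<le> R"
    and K: "K \<ge> 0" "\<And>x y. norm x \<le> R + 1 \<Longrightarrow> norm y \<le> R + 1 \<Longrightarrow> norm (A x - A y) \<le> K * norm (x - y)"
    and near: "\<And>x. norm x \<le> R + 1 \<Longrightarrow> norm (A' x - A x) \<le> \<theta>"
    and forcing: "\<And>s. s \<in> {0..1} \<Longrightarrow> norm (a' s - a s) \<le> \<theta>"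
    and \<theta>: "\<theta> > 0" "3 * \<theta> * exp K \<le> r" "r \<le> 1" and s: "s \<in> {0..1}"
  shows "norm (X s - \<phi> s) < r"
proof (rule gronwall_bootstrap[where T = 1 and C = "2 * \<theta>" and C' = "3 * \<theta>" and K = K and u = "\<lambda>s. norm (X s - \<phi> s)"])
  show "continuous_on {0..1} (\<lambda>s. norm (X s - \<phi> s))" by (intro continuous_intros \<phi> X)
  show "norm (X 0 - \<phi> 0) \<le> 2 * \<theta>"
    using forcing[of 0] X_eq[of 0] \<phi>_eq[of 0] \<theta> by simp
  fix s :: real assume s: "s \<in> {0..1}" and le: "\<And>q. q \<in> {0..s} \<Longrightarrow> norm (X q - \<phi> q) \<le> r"
  have sub: "{0..s} \<subseteq> {0..1}" using s by auto
  have c: "continuous_on {0..s} (\<lambda>q. A' (X q))" "continuous_on {0..s} (\<lambda>q. A (\<phi> q))"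
    by (rule continuous_on_compose2[OF A'[of UNIV] continuous_on_subset[OF X sub]], simp)
       (rule continuous_on_compose2[OF A[of UNIV] continuous_on_subset[OF \<phi> sub]], simp)
  have cu: "continuous_on {0..s} (\<lambda>q. norm (X q - \<phi> q))"
    by (intro continuous_intros continuous_on_subset[OF X sub] continuous_on_subset[OF \<phi> sub])
  have "X s - \<phi> s = integral {0..s} (\<lambda>q. A' (X q) - A (\<phi> q)) + (a' s - a s)"
    using X_eq[OF s] \<phi>_eq[OF s] c by (simp add: integral_diff integrable_continuous_real)
  then have "norm (X s - \<phi> s) \<le> norm (integral {0..s} (\<lambda>q. A' (X q) - A (\<phi> q))) + norm (a' s - a s)"
    by (metis norm_triangle_ineq)
  also have "norm (integral {0..s} (\<lambda>q. A' (X q) - A (\<phi> q))) \<le> integral {0..s} (\<lambda>q. \<theta> + K * norm (X q - \<phi> q))"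
  proof (rule integral_norm_bound_integral)
    show "(\<lambda>q. A' (X q) - A (\<phi> q)) integrable_on {0..s}"
      by (intro integrable_continuous_real continuous_intros c)
    show "(\<lambda>q. \<theta> + K * norm (X q - \<phi> q)) integrable_on {0..s}"
      by (intro integrable_continuous_real continuous_intros cu)
    fix q assume q: "q \<in> {0..s}"
    have \<phi>q: "norm (\<phi> q) \<le> R" using q s by (intro R) auto
    have Xq: "norm (X q) \<le> R + 1"
      using le[OF q] \<theta>(3) \<phi>q norm_triangle_sub[of "X q" "\<phi> q"] by linarith
    have "norm (A' (X q) - A (\<phi> q)) \<le> norm (A' (X q) - A (X q)) + norm (A (X q) - A (\<phi> q))"
      using norm_triangle_ineq[of "A' (X q) - A (X q)" "A (X q) - A (\<phi> q)"] by simp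
    also have "\<dots> \<le> \<theta> + K * norm (X q - \<phi> q)"
      using near[OF Xq] K(2)[OF Xq, of "\<phi> q"] \<phi>q by (intro add_mono) auto
    finally show "norm (A' (X q) - A (\<phi> q)) \<le> \<theta> + K * norm (X q - \<phi> q)" .
  qed
  also have "integral {0..s} (\<lambda>q. \<theta> + K * norm (X q - \<phi> q)) = s * \<theta> + K * integral {0..s} (\<lambda>q. norm (X q - \<phi> q))"
    using s cu by (subst integral_add) (auto intro!: integrable_continuous_real continuous_intros)
  also have "s * \<theta> \<le> \<theta>" using s \<theta>(1) by (simp add: mult_left_le_one_le)
  finally show "norm (X s - \<phi> s) \<le> 2 * \<theta> + K * integral {0..s} (\<lambda>q. norm (X q - \<phi> q))"
    using forcing[OF s] by simp
qed (use \<theta> K s in auto)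

lemma bounded_linear_diag: "bounded_linear (\<lambda>z. \<chi> i. \<sigma> $ i * z $ i :: real ^ 'n::finite)"
  by (intro linear_conv_bounded_linear[THEN iffD1] linearI) (auto simp: vec_eq_iff algebra_simps)

lemma norm_diag_le: "norm (\<chi> i. \<sigma> $ i * z $ i :: real ^ 'n::finite) \<le> (\<Sum>i\<in>UNIV. \<bar>\<sigma> $ i\<bar>) * norm z"
proof -
  have "norm (\<chi> i. \<sigma> $ i * z $ i) \<le> (\<Sum>i\<in>UNIV. \<bar>(\<chi> i. \<sigma> $ i * z $ i) $ i\<bar>)" by (rule norm_le_l1_cart)
  also have "\<dots> \<le> (\<Sum>i\<in>UNIV. \<bar>\<sigma> $ i\<bar> * norm z)"
    by (intro sum_mono) (auto simp: abs_mult intro!: mult_left_mono component_le_norm_cart)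
  finally show ?thesis by (simp add: sum_distrib_right)
qed

text \<open>The difference of both sides is absolutely continuous with derivative zero almost everywhere.\<close>

lemma controlled_solution_integral_eq:
  fixes \<phi> :: "real \<Rightarrow> real ^ 'n::finite"
  assumes sol: "controlled_solution Q \<sigma> f x \<phi>" and f: "f \<in> cameron_martin" and t: "t \<in> {0..1}"
  shows "\<phi> t = x + integral {0..t} (\<lambda>s. vector_field Q (\<phi> s)) + (\<chi> i. \<sigma> $ i * f t $ i)"
proof -
  let ?A = "\<lambda>s. vector_field Q (\<phi> s)" and ?D = "\<lambda>z :: real ^ 'n. \<chi> i. \<sigma> $ i * z $ i"
  have ac: "absolutely_continuous_on {0..1} \<phi>" and \<phi>0: "\<phi> 0 = x"
    using sol by (auto simp: controlled_solution_def)
  have acf: "absolutely_continuous_on {0..1} f" and f0: "f 0 = 0"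
    using f by (auto simp: cameron_martin_def)
  have cA: "continuous_on {0..1} ?A"
    by (rule continuous_on_compose2[OF continuous_on_vector_field[of UNIV]
          absolutely_continuous_on_imp_continuous_on[OF ac]]) simp
  define I where "I s = integral {0..s} ?A" for s
  have I: "(I has_vector_derivative ?A s) (at s within {0..1})" if "s \<in> {0..1}" for s
    unfolding I_def using integral_has_vector_derivative[OF cA that] .
  obtain C where C: "\<And>s. s \<in> {0..1} \<Longrightarrow> norm (?A s) \<le> C"
    using compact_imp_bounded[OF compact_continuous_image[OF cA compact_Icc]]
    unfolding bounded_iff by (metis imageI)
  have "C-lipschitz_on {0..1} (\<lambda>s. - I s)"
    by (rule bounded_vector_derivative_imp_lipschitz_on[of 0 1 _ "\<lambda>s. - ?A s"])
       (use I C in \<open>auto intro!: has_vector_derivative_minus\<close>)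
  then have acI: "absolutely_continuous_on {0..1} (\<lambda>s. - I s)"
    by (rule lipschitz_on_imp_absolutely_continuous_on)
  have bl: "bounded_linear (\<lambda>z. - ?D z)" by (intro bounded_linear_minus bounded_linear_diag)
  obtain L where "L-lipschitz_on UNIV (\<lambda>z. - ?D z)" using bounded_linear.lipschitz_boundE[OF bl] by blast
  from lipschitz_on_compose_absolutely_continuous_on[OF this acf]
  have acD: "absolutely_continuous_on {0..1} (\<lambda>s. - ?D (f s))" .
  define u where "u s = \<phi> s + - I s + - ?D (f s)" for s
  have acu: "absolutely_continuous_on {0..1} u"
    unfolding u_def by (intro absolutely_continuous_on_add ac acI acD)
  have der: "(u has_vector_derivative 0) (at s within {0..1})"
    if s: "s \<in> {0..1}" and v: "(f has_vector_derivative v) (at s within {0..1})"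
      "(\<phi> has_vector_derivative (?A s + ?D v)) (at s within {0..1})" for s v
  proof -
    have "(u has_vector_derivative (?A s + ?D v) + - ?A s + - ?D v) (at s within {0..1})"
      unfolding u_def
      by (intro has_vector_derivative_add has_vector_derivative_minus v(2) I[OF s]
          bounded_linear.has_vector_derivative[OF bl v(1)])
    then show ?thesis by simp
  qed
  have AE: "AE s in lebesgue_on {0..1}. (u has_vector_derivative 0) (at s within {0..1})"
  proof -
    have "AE s in lebesgue_on {0..1}. s \<in> {0..1::real}" by (rule AE_I2) simp
    moreover have "AE s in lebesgue_on {0..1}. \<exists>v. (f has_vector_derivative v) (at s within {0..1}) \<and>
        (\<phi> has_vector_derivative (?A s + ?D v)) (at s within {0..1})"
      using sol by (simp add: controlled_solution_def)
    ultimately show ?thesis by eventually_elim (use der in blast)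
  qed
  have sub: "{0..t} \<subseteq> {0..1}" using t by auto
  have "AE s in lebesgue. s \<in> {0..1} \<longrightarrow> (u has_vector_derivative 0) (at s within {0..1})"
    using AE by (subst (asm) AE_restrict_space_iff) auto
  then have "AE s in lebesgue. s \<in> {0..t} \<longrightarrow> (u has_vector_derivative 0) (at s within {0..t})"
    by eventually_elim (use sub in \<open>auto intro: has_vector_derivative_within_subset\<close>)
  then have "AE s in lebesgue_on {0..t}. (u has_vector_derivative 0) (at s within {0..t})"
    by (subst AE_restrict_space_iff) auto
  then have "u t = u 0"
    using absolutely_continuous_on_zero_derivative_constant[OF absolutely_continuous_on_subset[OF acu sub]] t by auto
  moreover have "u 0 = x" by (simp add: u_def I_def \<phi>0 f0 vec_eq_iff)
  ultimately show ?thesis by (simp add: u_def I_def algebra_simps)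
qed

text \<open>A coordinate with noise has weight \<open>1/2\<close>, so \<open>S\<^sub>\<epsilon>\<close> divides the noise by \<open>sqrt \<epsilon>\<close>; the other coordinates
have no noise term.\<close>

lemma dominant_scaling_solution:
  fixes y :: "real \<Rightarrow> real ^ 'n::finite"
  assumes \<epsilon>: "\<epsilon> > 0" and \<sigma>: "\<And>i. \<sigma> $ i \<ge> 0" and y: "continuous_on {0..\<epsilon>} y"
    and eq: "\<And>t. t \<in> {0..\<epsilon>} \<Longrightarrow> y t = integral {0..t} (\<lambda>s. vector_field P (y s)) + (\<chi> i. \<sigma> $ i * w t $ i)"
    and X_def: "\<And>s. X s = dominant_scaling P \<sigma> \<epsilon> (y (\<epsilon> * s))"
  shows "continuous_on {0..1} X"
    and "s \<in> {0..1} \<Longrightarrow> X s = integral {0..s} (\<lambda>q. scaled_field P \<sigma> \<epsilon> (X q)) + (\<chi> i. \<sigma> $ i * (w (\<epsilon> * s) /\<^sub>R sqrt \<epsilon>) $ i)"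
proof -
  let ?w = "final_weight P \<sigma>"
  have im: "\<epsilon> * s \<in> {0..\<epsilon>}" if "s \<in> {0..1}" for s using that \<epsilon> by (auto intro: mult_left_le)
  have cy: "continuous_on {0..1} (\<lambda>s. y (\<epsilon> * s))"
    by (rule continuous_on_compose2[OF y]) (use im in \<open>auto intro!: continuous_intros\<close>)
  have "continuous_on {0..1} (\<lambda>s. dominant_scaling P \<sigma> \<epsilon> (y (\<epsilon> * s)))"
    unfolding dominant_scaling_def
    using \<epsilon> by (intro continuous_on_vec_lambda continuous_intros continuous_on_component cy) auto
  then show cX: "continuous_on {0..1} X" by (simp add: X_def cong: continuous_on_cong)
  assume s: "s \<in> {0..1}"
  have sub: "{0..s} \<subseteq> {0..1}" using s by auto
  have intX: "(\<lambda>q. scaled_field P \<sigma> \<epsilon> (X q)) integrable_on {0..s}"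
    by (intro integrable_continuous_real continuous_on_compose2[OF continuous_on_scaled_field[of UNIV]]
        continuous_on_subset[OF cX sub]) auto
  have "{0..\<epsilon> * s} \<subseteq> {0..\<epsilon>}" using im[OF s] by auto
  then have inty: "(\<lambda>q. vector_field P (y q)) integrable_on {0..\<epsilon> * s}"
    by (intro integrable_continuous_real continuous_on_compose2[OF continuous_on_vector_field[of UNIV]]
        continuous_on_subset[OF y]) auto
  show "X s = integral {0..s} (\<lambda>q. scaled_field P \<sigma> \<epsilon> (X q)) + (\<chi> i. \<sigma> $ i * (w (\<epsilon> * s) /\<^sub>R sqrt \<epsilon>) $ i)"
  proof (subst vec_eq_iff, intro allI)
    fix i
    have un: "(\<chi> i. \<epsilon> powr ?w i * X q $ i) = y (\<epsilon> * q)" for q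
      using \<epsilon> by (simp add: X_def dominant_scaling_def vec_eq_iff)
    have "integral {0..s} (\<lambda>q. scaled_field P \<sigma> \<epsilon> (X q)) $ i = integral {0..s} (\<lambda>q. scaled_field P \<sigma> \<epsilon> (X q) $ i)"
      using intX by simp
    also have "\<dots> = integral {0..s} (\<lambda>q. \<epsilon> / \<epsilon> powr ?w i * poly_fun (P $ i) (y (\<epsilon> * q)))"
      by (intro integral_cong) (simp add: scaled_field_eq[OF \<epsilon>] un)
    also have "\<dots> = \<epsilon> / \<epsilon> powr ?w i * integral {0..s} (\<lambda>q. poly_fun (P $ i) (y (\<epsilon> * q)))"
      by (rule integral_mult_right)
    also have "integral {0..s} (\<lambda>q. poly_fun (P $ i) (y (\<epsilon> * q))) = integral {0..\<epsilon> * s} (\<lambda>q. poly_fun (P $ i) (y q)) / \<epsilon>"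
      using integral_stretch_real[of \<epsilon> 0 "\<epsilon> * s" "\<lambda>q. poly_fun (P $ i) (y q)"] \<epsilon> by simp
    also have "integral {0..\<epsilon> * s} (\<lambda>q. poly_fun (P $ i) (y q)) = integral {0..\<epsilon> * s} (\<lambda>q. vector_field P (y q)) $ i"
      using integral_component_eq_cart[OF inty, of i] by (simp add: vector_field_def)
    finally have 1: "integral {0..s} (\<lambda>q. scaled_field P \<sigma> \<epsilon> (X q)) $ i =
        integral {0..\<epsilon> * s} (\<lambda>q. vector_field P (y q)) $ i / \<epsilon> powr ?w i"
      using \<epsilon> by simp
    have 2: "\<sigma> $ i * (w (\<epsilon> * s) /\<^sub>R sqrt \<epsilon>) $ i = \<sigma> $ i * w (\<epsilon> * s) $ i / \<epsilon> powr ?w i"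
    proof (cases "\<sigma> $ i > 0")
      case True
      have "\<epsilon> powr ?w i = sqrt \<epsilon>" unfolding final_weight_noisy[OF True] using \<epsilon> by (simp add: powr_half_sqrt)
      then show ?thesis by (simp add: divide_inverse)
    next
      case False
      then have "\<sigma> $ i = 0" using \<sigma>[of i] by simp
      then show ?thesis by simp
    qed
    have "X s $ i = y (\<epsilon> * s) $ i / \<epsilon> powr ?w i" by (simp add: X_def dominant_scaling_def)
    also have "\<dots> = integral {0..\<epsilon> * s} (\<lambda>q. vector_field P (y q)) $ i / \<epsilon> powr ?w i + \<sigma> $ i * w (\<epsilon> * s) $ i / \<epsilon> powr ?w i"
      by (subst eq[OF im[OF s]]) (simp add: add_divide_distrib)
    finally show "X s $ i = (integral {0..s} (\<lambda>q. scaled_field P \<sigma> \<epsilon> (X q)) + (\<chi> i. \<sigma> $ i * (w (\<epsilon> * s) /\<^sub>R sqrt \<epsilon>) $ i)) $ i"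
      using 1 2 by simp
  qed
qed

section \<open>Regularity\<close>

lemma entrance_time_eq_0:
  assumes "\<And>r. r > 0 \<Longrightarrow> \<exists>t. 0 < t \<and> t < r \<and> x t \<omega> \<in> Some ` U"
  shows "entrance_time x U \<omega> = 0"
proof (rule antisym)
  show "entrance_time x U \<omega> \<le> 0"
  proof (rule ereal_le_epsilon2)
    fix r :: real assume "r > 0"
    then obtain t where t: "0 < t" "t < r" "x t \<omega> \<in> Some ` U" using assms by blast
    then have "entrance_time x U \<omega> \<le> ereal t" unfolding entrance_time_def by (intro Inf_lower) auto
    also have "\<dots> \<le> 0 + ereal r" using t by simp
    finally show "entrance_time x U \<omega> \<le> 0 + ereal r" .
  qed
  show "0 \<le> entrance_time x U \<omega>" unfolding entrance_time_def by (intro Inf_greatest) auto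
qed

theorem theorem8p1:
  fixes P :: "'n::finite rpoly ^ 'n"
    and \<sigma> :: "real ^ 'n"
    and M :: "'a measure"
    and F :: "real \<Rightarrow> 'a measure"
    and B :: "real \<Rightarrow> 'a \<Rightarrow> real ^ 'n"
    and x :: "real \<Rightarrow> 'a \<Rightarrow> (real ^ 'n) option"
    and U W :: "(real ^ 'n) set"
    and j :: 'n
    and \<delta> \<epsilon>\<^sub>0 :: real
    and b :: "('n \<Rightarrow> real) \<Rightarrow> real"
    and \<Gamma> V :: "real \<Rightarrow> (real ^ 'n) set"
  assumes "\<And>i. \<sigma> $ i \<ge> 0"
    and "filtered_prob_space M F"
    and "standard_brownian_motion M F B"
    and "pathwise_solution M P \<sigma> B 0 x"
    and "noise_propagating P \<sigma>"
    and "U \<noteq> {}" and "open U" and "has_continuous_boundary U" and "0 \<in> frontier U"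
    and "\<delta> > 0" and "b \<in> continuous_graph_map j"
    and "frontier U \<inter> ball 0 \<delta> = {y \<in> ball 0 \<delta>. y $ j = b (drop_coord j y)}"
    and "U \<inter> ball 0 \<delta> = {y \<in> ball 0 \<delta>. y $ j > b (drop_coord j y)}"
    and "\<And>\<epsilon>. V \<epsilon> = {y \<in> scaled_box P \<sigma> \<epsilon>. y $ j > b (drop_coord j y)}"
    and "\<And>\<epsilon>. \<Gamma> \<epsilon> = {y \<in> scaled_box P \<sigma> \<epsilon>. y $ j = b (drop_coord j y)}"
    and "\<epsilon>\<^sub>0 > 0"
    and "\<And>\<epsilon>. \<epsilon> \<in> {0<..<\<epsilon>\<^sub>0} \<Longrightarrow> \<Gamma> \<epsilon> = scaled_box P \<sigma> \<epsilon> \<inter> frontier U"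
    and "\<And>\<epsilon>. \<epsilon> \<in> {0<..<\<epsilon>\<^sub>0} \<Longrightarrow> V \<epsilon> = scaled_box P \<sigma> \<epsilon> \<inter> U"
    and "W \<noteq> {}" and "open W"
    and "\<And>\<epsilon>. \<epsilon> \<in> {0<..<\<epsilon>\<^sub>0} \<Longrightarrow> W \<subseteq> dominant_scaling P \<sigma> \<epsilon> ` V \<epsilon>"
    and "(\<Union>t\<in>{0<..1}. closure (accessible_set P \<sigma> t 0)) \<inter> W \<noteq> {}"
  shows "regular_start M x U"
proof -
  note \<sigma> = assms(1) and sol = assms(4) and np = assms(5) and \<epsilon>0 = assms(16)
    and VU = assms(18) and openW = assms(20) and WV = assms(21)
  interpret brownian_motion M F B
  proof (intro brownian_motion.intro brownian_motion_axioms.intro)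
    show "prob_space M" using assms(2) by (simp add: filtered_prob_space_def)
    show "subalgebra M (F t)" if "t \<ge> 0" for t
      using assms(2) that unfolding filtered_prob_space_def by blast
    show "sets (F s) \<subseteq> sets (F t)" if "0 \<le> s" "s \<le> t" for s t
      using assms(2) that unfolding filtered_prob_space_def by blast
  qed (rule assms(3))
  let ?D = "\<lambda>z :: real ^ 'n. \<chi> i. \<sigma> $ i * z $ i"
  obtain t y0 where t: "0 < t" "t \<le> 1" "y0 \<in> closure (accessible_set P \<sigma> t 0)" "y0 \<in> W"
    using assms(22) by auto
  then have "accessible_set P \<sigma> t 0 \<inter> W \<noteq> {}"
    using open_Int_closure_eq_empty[OF openW, of "accessible_set P \<sigma> t 0"] by blast
  then obtain f \<phi> where f: "f \<in> cameron_martin"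
    and \<phi>: "controlled_solution (dominant_part P \<sigma>) \<sigma> f 0 \<phi>" and \<phi>W: "\<phi> t \<in> W"
    unfolding accessible_set_def by blast
  obtain r where r: "0 < r" "r \<le> 1" "ball (\<phi> t) r \<subseteq> W"
  proof -
    obtain r where "r > 0" "ball (\<phi> t) r \<subseteq> W" using openW \<phi>W open_contains_ball by blast
    moreover have "ball (\<phi> t) (min r 1) \<subseteq> ball (\<phi> t) r" by (rule subset_ball) simp
    ultimately show thesis using that[of "min r 1"] by simp
  qed
  have \<phi>c: "continuous_on {0..1} \<phi>" and fc: "continuous_on {0..1} f" "f 0 = 0"
    using \<phi> f by (auto simp: controlled_solution_def cameron_martin_def
        intro: absolutely_continuous_on_imp_continuous_on)
  obtain R where R: "\<And>s. s \<in> {0..1} \<Longrightarrow> norm (\<phi> s) \<le> R"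
    using compact_imp_bounded[OF compact_continuous_image[OF \<phi>c compact_Icc]]
    unfolding bounded_iff by (metis imageI)
  obtain K where K: "K \<ge> 0" "\<And>x y. x \<in> cball 0 (R + 1) \<Longrightarrow> y \<in> cball 0 (R + 1) \<Longrightarrow>
      norm (vector_field (dominant_part P \<sigma>) x - vector_field (dominant_part P \<sigma>) y) \<le> K * norm (x - y)"
    using vector_field_lipschitz_on_bounded[OF bounded_cball] by blast
  \<comment> \<open>The error that \<open>perturbed_solution_close\<close> admits for the distance \<open>r\<close>.\<close>
  define \<theta> where "\<theta> = r / (3 * exp K)"
  have \<theta>: "\<theta> > 0" "3 * \<theta> * exp K \<le> r" using r by (auto simp: \<theta>_def)
  obtain \<epsilon>1 where \<epsilon>1: "\<epsilon>1 > 0" "\<And>\<epsilon> x. 0 < \<epsilon> \<Longrightarrow> \<epsilon> < \<epsilon>1 \<Longrightarrow> norm x \<le> R + 1 \<Longrightarrow>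
      norm (scaled_field P \<sigma> \<epsilon> x - vector_field (dominant_part P \<sigma>) x) \<le> \<theta>"
    using scaled_field_converges[OF np \<theta>(1)] by blast
  define S where "S = (\<Sum>i\<in>UNIV. \<bar>\<sigma> $ i\<bar>)"
  have S: "S \<ge> 0" by (simp add: S_def sum_nonneg)
  define \<eta> where "\<eta> = \<theta> / (S + 1)"
  have \<eta>: "\<eta> > 0" "S * \<eta> \<le> \<theta>" using \<theta>(1) S by (auto simp: \<eta>_def field_simps)
  have "AE \<omega> in M. entrance_time x U \<omega> = 0"
    using rescaled_paths_recurrent[OF fc \<eta>(1)] sol[unfolded pathwise_solution_def]
  proof eventually_elim
    case (elim \<omega>)
    from elim(2) obtain \<tau> y where \<tau>: "\<tau> > 0" "continuous_on {t. 0 \<le> t \<and> ereal t < \<tau>} y"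
      and y: "\<And>t. t \<ge> 0 \<Longrightarrow> ereal t < \<tau> \<Longrightarrow> x t \<omega> = Some (y t) \<and>
        y t = 0 + integral {0..t} (\<lambda>s. vector_field P (y s)) + ?D (B t \<omega>)" by blast
    show ?case
    proof (rule entrance_time_eq_0)
      fix r' :: real assume r': "r' > 0"
      obtain \<tau>' where \<tau>': "0 < \<tau>'" "ereal \<tau>' < \<tau>"
        using ereal_dense2[OF \<tau>(1)] by (auto simp: zero_ereal_def)
      \<comment> \<open>The solution has not exploded by time \<open>\<epsilon>\<close> once \<open>\<epsilon> < \<tau>'\<close>; so the rescaled equation holds on all of \<open>[0,1]\<close>.\<close>
      define m where "m = min (min \<epsilon>\<^sub>0 \<epsilon>1) (min r' \<tau>')"
      have "m > 0" using \<epsilon>0 \<epsilon>1(1) r' \<tau>'(1) by (simp add: m_def)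
      then obtain \<epsilon> where "0 < \<epsilon>" "\<epsilon> < m"
        and close: "\<And>s. s \<in> {0..1} \<Longrightarrow> norm (B (\<epsilon> * s) \<omega> /\<^sub>R sqrt \<epsilon> - f s) \<le> \<eta>"
        using elim(1) by blast
      then have \<epsilon>: "0 < \<epsilon>" "\<epsilon> < \<epsilon>\<^sub>0" "\<epsilon> < \<epsilon>1" "\<epsilon> < r'" "\<epsilon> < \<tau>'" by (auto simp: m_def)
      have alive: "ereal q < \<tau>" if "q \<in> {0..\<epsilon>}" for q
        using that \<epsilon>(5) \<tau>'(2) by (intro le_less_trans[OF _ \<tau>'(2)]) auto
      define X where "X s = dominant_scaling P \<sigma> \<epsilon> (y (\<epsilon> * s))" for s
      have yc: "continuous_on {0..\<epsilon>} y" by (rule continuous_on_subset[OF \<tau>(2)]) (use alive in auto)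
      have yeq: "y q = integral {0..q} (\<lambda>s. vector_field P (y s)) + ?D (B q \<omega>)" if "q \<in> {0..\<epsilon>}" for q
        using y[of q] alive[OF that] that by simp
      note X = dominant_scaling_solution[where w = "\<lambda>q. B q \<omega>", OF \<epsilon>(1) \<sigma> yc yeq X_def]
      have "norm (X t - \<phi> t) < r"
      proof (rule perturbed_solution_close[where A = "vector_field (dominant_part P \<sigma>)" and A' = "scaled_field P \<sigma> \<epsilon>"
            and a = "\<lambda>s. ?D (f s)" and a' = "\<lambda>s. ?D (B (\<epsilon> * s) \<omega> /\<^sub>R sqrt \<epsilon>)"])
        show "\<phi> s = integral {0..s} (\<lambda>q. vector_field (dominant_part P \<sigma>) (\<phi> q)) + ?D (f s)"
          if "s \<in> {0..1}" for s
          using controlled_solution_integral_eq[OF \<phi> f that] by simp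
        show "norm (?D (B (\<epsilon> * s) \<omega> /\<^sub>R sqrt \<epsilon>) - ?D (f s)) \<le> \<theta>" if s: "s \<in> {0..1}" for s
        proof -
          have "?D (B (\<epsilon> * s) \<omega> /\<^sub>R sqrt \<epsilon>) - ?D (f s) = ?D (B (\<epsilon> * s) \<omega> /\<^sub>R sqrt \<epsilon> - f s)"
            by (simp add: vec_eq_iff algebra_simps)
          then have "norm (?D (B (\<epsilon> * s) \<omega> /\<^sub>R sqrt \<epsilon>) - ?D (f s)) \<le> S * norm (B (\<epsilon> * s) \<omega> /\<^sub>R sqrt \<epsilon> - f s)"
            by (simp only: S_def norm_diag_le)
          also have "\<dots> \<le> S * \<eta>" using close[OF s] S by (intro mult_left_mono)
          finally show ?thesis using \<eta>(2) by simp
        qed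
      qed (use X \<phi>c R K \<epsilon>1(2) \<epsilon> \<theta> r t continuous_on_vector_field continuous_on_scaled_field in auto)
      then have "X t \<in> W" using r(3) by (auto simp: dist_norm norm_minus_commute)
      then obtain v where v: "v \<in> V \<epsilon>" "dominant_scaling P \<sigma> \<epsilon> v = X t"
        using WV[of \<epsilon>] \<epsilon> by auto
      then have "v = y (\<epsilon> * t)" using \<epsilon>(1) by (simp add: X_def dominant_scaling_def vec_eq_iff)
      then have yU: "y (\<epsilon> * t) \<in> U" using v(1) VU[of \<epsilon>] \<epsilon> by auto
      have et: "0 < \<epsilon> * t" "\<epsilon> * t \<le> \<epsilon>" using \<epsilon>(1) t by (auto intro: mult_left_le)
      then have "x (\<epsilon> * t) \<omega> = Some (y (\<epsilon> * t))" using y[of "\<epsilon> * t"] alive[of "\<epsilon> * t"] by simp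
      then show "\<exists>t. 0 < t \<and> t < r' \<and> x t \<omega> \<in> Some ` U"
        using et yU \<epsilon>(4) by (intro exI[of _ "\<epsilon> * t"]) auto
    qed
  qed
  then show ?thesis by (simp add: regular_start_def)
qed

end
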